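(* Let $H$ be the Hilbert transformation extended to $L^2(\mathbb{R}^3,\mathbb{H})$. Then $H$ has two nontrivial maximal invariant spaces ${}^q\!H^+$ and ${}^q\!H^-$, with $$L^2(\mathbb{R}^3,\mathbb{H})={}^q\!H^+\oplus{}^q\!H^-,$$ and $$Hf=f\quad\forall f\in{}^q\!H^+;\qquad Hg=-g\quad\forall g\in{}^q\!H^-.$$
   Context: $\mathbb{H}$ denotes the quaternions with units $e_1,e_2,e_3$, $e_j^2=-1$, $e_3=e_1e_2$, $e_je_k=-e_ke_j$ for $j\ne k$; function values are in $\mathbb{H}\otimes_{\mathbb{R}}\mathbb{C}$ with $i$ commuting with the $e_j$. $x\in\mathbb{R}^3$ is identified with $\underline{x}=x_1e_1+x_2e_2+x_3e_3$. The Hilbert transformation is $Hf(\underline{x})=c_3\,\mathrm{p.v.}\!\int_{\mathbb{R}^3}\frac{\underline{x}-\underline{y}}{|\underline{x}-\underline{y}|^{4}}f(\underline{y})\,d\underline{y}$, with $c_3=1/\pi^2$, so that $H^2=I$. $\mathrm{Spin}(3)$ is the group of unit quaternions; $\gamma:S^2\to\mathrm{Spin}(3)$ is a fixed choice with $\gamma(\omega)e_3\gamma(\omega)^{-1}=\omega$. Writing $L(w)=\{g(\underline{y})=\gamma(\underline{y}/|\underline{y}|)\alpha(\underline{y})w:\alpha\in L^2(\mathbb{R}^3)\}$ ($\alpha$ complex-valued), set $\tilde H^-_1=L(1-ie_3)$, $\tilde H_1^+=L(e_1+ie_2)$, $\tilde H_2^-=L(e_1-ie_2)$, $\tilde H_2^+=L(1+ie_3)$.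 With $\mathfrak{F}f(\underline{\xi})=\int_{\mathbb{R}^3}e^{-i2\pi\langle\underline{x},\underline{\xi}\rangle}f(\underline{x})\,d\underline{x}$ (extended to $L^2$), put ${}^q\!H_j^\pm=\mathfrak{F}\tilde H_j^\pm$ for $j=1,2$ and ${}^q\!H^\pm={}^q\!H_1^\pm\oplus{}^q\!H_2^\pm$.
   Formalization: "Maximal invariant" fails for ordinary invariant subspaces (qH^+ plus a proper closed part of qH^- is a larger proper one); it is read as maximal among closed complex subspaces on which H acts as a single scalar. The choice of γ is taken to be measurable. *)

theory Defs
  imports "HOL-Analysis.Analysis"
begin

section \<open>Complexified quaternions\<close>

text \<open>
  The algebra of quaternions with complex coefficients. The vector \<open>(a, b, c, d)\<close>, with
  components indexed by 1, 2, 3, 4, stands for \<open>a + b e\<^sub>1 + c e\<^sub>2 + d e\<^sub>3\<close>; the imaginary unit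
  \<open>\<i>\<close> of the coefficients acts by \<open>*s\<close>. The product is \<open>\<odot>\<close>, with unit \<open>qone\<close>: the library's
  \<open>*\<close> and \<open>1\<close> on vectors are componentwise and play no role. The norm is the
  Euclidean norm of the eight real coordinates.
\<close>

type_synonym cquat = "complex^4"

definition cq_mult :: "cquat \<Rightarrow> cquat \<Rightarrow> cquat"  (infixl "\<odot>" 70) where
  "p \<odot> q = vector
    [p$1 * q$1 - p$2 * q$2 - p$3 * q$3 - p$4 * q$4,
     p$1 * q$2 + p$2 * q$1 + p$3 * q$4 - p$4 * q$3,
     p$1 * q$3 - p$2 * q$4 + p$3 * q$1 + p$4 * q$2,
     p$1 * q$4 + p$2 * q$3 - p$3 * q$2 + p$4 * q$1]"

definition qone :: cquat where "qone = vector [1, 0, 0, 0]"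
definition e1 :: cquat where "e1 = vector [0, 1, 0, 0]"
definition e2 :: cquat where "e2 = vector [0, 0, 1, 0]"
definition e3 :: cquat where "e3 = vector [0, 0, 0, 1]"

definition pure_quat :: "real^3 \<Rightarrow> cquat" where
  "pure_quat x = complex_of_real (x$1) *s e1 + complex_of_real (x$2) *s e2 + complex_of_real (x$3) *s e3"

definition cq_inverse :: "cquat \<Rightarrow> cquat" where
  "cq_inverse q = (THE p. p \<odot> q = qone \<and> q \<odot> p = qone)"

lemma vector_4 [simp]:
  "(vector [a,b,c,d] :: 'a::zero^4)$1 = a"
  "(vector [a,b,c,d] :: 'a::zero^4)$2 = b"
  "(vector [a,b,c,d] :: 'a::zero^4)$3 = c"
  "(vector [a,b,c,d] :: 'a::zero^4)$4 = d"
  unfolding vector_def by simp_all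

lemmas cq_simps = vec_eq_iff forall_4 cq_mult_def qone_def e1_def e2_def e3_def pure_quat_def

lemma cq_units:
  "e1 \<odot> e1 = - qone" "e2 \<odot> e2 = - qone" "e3 \<odot> e3 = - qone"
  "e1 \<odot> e2 = e3" "e2 \<odot> e1 = - e3" "e2 \<odot> e3 = e1" "e3 \<odot> e2 = - e1" "e3 \<odot> e1 = e2" "e1 \<odot> e3 = - e2"
  "qone \<odot> q = q" "q \<odot> qone = q"
  by (simp_all add: cq_simps)

lemma cq_mult_assoc: "(p \<odot> q) \<odot> r = p \<odot> (q \<odot> r)"
  by (simp add: cq_simps algebra_simps)

lemma cq_mult_bilinear:
  "(p + q) \<odot> r = p \<odot> r + q \<odot> r" "p \<odot> (q + r) = p \<odot> q + p \<odot> r"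
  "(c *s p) \<odot> q = c *s (p \<odot> q)" "p \<odot> (c *s q) = c *s (p \<odot> q)"
  by (simp_all add: cq_simps algebra_simps)

lemma cq_inverse_eqI:
  assumes "p \<odot> q = qone" "q \<odot> p = qone"
  shows "cq_inverse q = p"
  unfolding cq_inverse_def using assms by (intro the_equality) (auto, metis cq_mult_assoc cq_units(10,11))

definition Spin3 :: "cquat set" where
  "Spin3 = {q. (\<forall>k. q$k \<in> \<real>) \<and> norm q = 1}"

text \<open>
  The choices of \<open>\<gamma>\<close> on the unit sphere; \<open>sgn y = y / |y|\<close>. The measurability clause makes
  \<open>\<gamma>(y/|y|) \<alpha>(y) w\<close> a measurable function of \<open>y\<close> whenever \<open>\<alpha>\<close> is. Values of \<open>\<gamma>\<close> off the
  sphere are irrelevant.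
\<close>

definition spin_section :: "(real^3 \<Rightarrow> cquat) \<Rightarrow> bool" where
  "spin_section \<gamma> \<longleftrightarrow>
     (\<forall>\<omega>\<in>sphere 0 1. \<gamma> \<omega> \<in> Spin3 \<and> \<gamma> \<omega> \<odot> e3 \<odot> cq_inverse (\<gamma> \<omega>) = pure_quat \<omega>) \<and>
     (\<lambda>y. \<gamma> (sgn y)) \<in> borel_measurable lebesgue"

lemma cq_inverse_Spin3:
  assumes "q \<in> Spin3"
  shows "cq_inverse q = vector [q$1, - q$2, - q$3, - q$4]"
proof -
  have "(\<Sum>k\<in>UNIV. (norm (q$k))\<^sup>2) = 1"
    using assms by (simp add: Spin3_def norm_vec_def L2_set_def)
  moreover have "complex_of_real ((norm (q$k))\<^sup>2) = q$k * q$k" for k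
    using assms by (simp add: Spin3_def complex_is_Real_iff complex_eq_iff cmod_def power2_eq_square)
  ultimately have "q$1 * q$1 + q$2 * q$2 + q$3 * q$3 + q$4 * q$4 = 1"
    by (metis sum_4 of_real_1 of_real_add)
  then show ?thesis
    by (intro cq_inverse_eqI) (simp_all add: cq_simps algebra_simps)
qed

lemma spin_section_exists: "\<exists>\<gamma>. spin_section \<gamma>"
proof -
  define \<gamma> where "\<gamma> \<omega> = (if \<omega>$3 = -1 then e1 else
     sqrt ((1 + \<omega>$3) / 2) *\<^sub>R qone - (\<omega>$2 / sqrt (2 * (1 + \<omega>$3))) *\<^sub>R e1 + (\<omega>$1 / sqrt (2 * (1 + \<omega>$3))) *\<^sub>R e2)" for \<omega> :: "real^3"
  have [measurable]: "(\<lambda>x::real^3. x$k) \<in> borel_measurable borel" for k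
    by (intro borel_measurable_continuous_onI continuous_intros)
  have "\<gamma> \<in> borel_measurable borel"
    unfolding \<gamma>_def by measurable
  moreover have "sgn \<in> borel_measurable (borel :: (real^3) measure)"
    unfolding sgn_div_norm[abs_def] by measurable
  ultimately have "(\<lambda>y. \<gamma> (sgn y)) \<in> borel_measurable lborel"
    by (simp add: measurable_compose)
  then have m: "(\<lambda>y. \<gamma> (sgn y)) \<in> borel_measurable lebesgue"
    by (rule measurable_completion)
  have "\<gamma> \<omega> \<in> Spin3 \<and> \<gamma> \<omega> \<odot> e3 \<odot> cq_inverse (\<gamma> \<omega>) = pure_quat \<omega>" if "\<omega> \<in> sphere 0 1" for \<omega>
  proof -
    have n: "(\<omega>$1)\<^sup>2 + (\<omega>$2)\<^sup>2 + (\<omega>$3)\<^sup>2 = 1"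
      using that by (simp add: norm_vec_def L2_set_def sum_3)
    show ?thesis
    proof (cases "\<omega>$3 = -1")
      case True
      with n have z: "\<omega>$1 = 0" "\<omega>$2 = 0" by (simp_all add: sum_power2_eq_zero_iff)
      have "e1 \<in> Spin3" by (simp add: Spin3_def e1_def forall_4 norm_vec_def L2_set_def sum_4)
      with True z show ?thesis by (simp add: \<gamma>_def cq_inverse_Spin3 cq_simps)
    next
      case False
      have "(\<omega>$3)\<^sup>2 \<le> 1\<^sup>2" using n zero_le_power2[of "\<omega>$1"] zero_le_power2[of "\<omega>$2"] unfolding one_power2 by linarith
      then have "\<bar>\<omega>$3\<bar> \<le> 1" using abs_le_square_iff[of "\<omega>$3" 1] by simp
      with False have pos: "1 + \<omega>$3 > 0" by linarith
      define s where "s = sqrt (2 * (1 + \<omega>$3))"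
      have s: "s > 0" "s * s = 2 * (1 + \<omega>$3)" using pos by (simp_all add: s_def)
      have w3: "\<omega>$3 = s * s / 2 - 1" unfolding s(2) by (simp add: field_simps)
      have "sqrt ((1 + \<omega>$3) / 2) = s / 2"
        using pos s by (intro real_sqrt_unique) (simp_all add: power2_eq_square)
      note h = this
      have g: "\<gamma> \<omega> = vector [complex_of_real (s / 2), complex_of_real (- \<omega>$2 / s), complex_of_real (\<omega>$1 / s), 0]"
        using False unfolding \<gamma>_def s_def[symmetric] h
        by (simp add: cq_simps scaleR_conv_of_real[where 'a=complex])
      have n': "(\<omega>$1) * (\<omega>$1) + (\<omega>$2) * (\<omega>$2) = s * s * (1 - s * s / 4)"
        using n unfolding w3 by (simp add: power2_eq_square algebra_simps)
      have "(s/2)\<^sup>2 + (\<omega>$2/s)\<^sup>2 + (\<omega>$1/s)\<^sup>2 = s * s / 4 + ((\<omega>$1) * (\<omega>$1) + (\<omega>$2) * (\<omega>$2)) / (s * s)"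
        using s(1) by (simp add: power2_eq_square field_simps)
      also have "\<dots> = 1" unfolding n' using s(1) by simp
      finally have nn: "(s/2)\<^sup>2 + (\<omega>$2/s)\<^sup>2 + (\<omega>$1/s)\<^sup>2 = 1" .
      then have S: "\<gamma> \<omega> \<in> Spin3"
        by (simp add: g Spin3_def forall_4 norm_vec_def L2_set_def sum_4 norm_divide power_divide)
      have "s * (s * (s * s)) = 4 * (\<omega>$1 * \<omega>$1) + (s * (s * (4 * \<omega>$3)) + 4 * (\<omega>$2 * \<omega>$2))"
        using n' unfolding w3 by (simp add: algebra_simps)
      then have c3: "complex_of_real (s * (s * (s * s))) =
          complex_of_real (4 * (\<omega>$1 * \<omega>$1) + (s * (s * (4 * \<omega>$3)) + 4 * (\<omega>$2 * \<omega>$2)))"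
        by simp
      show ?thesis
        using S s(1) c3 by (simp add: cq_inverse_Spin3 g cq_simps field_simps)
    qed
  qed
  with m show ?thesis unfolding spin_section_def by blast
qed

section \<open>Square-integrable functions\<close>

text \<open>
  Elements of \<open>L\<^sup>2(\<real>\<^sup>3)\<close> are given by Borel representatives, equality in \<open>L\<^sup>2\<close> being equality
  almost everywhere. All the subspaces below contain, with a function, all its
  representatives.
\<close>

abbreviation ae_eq :: "(real^3 \<Rightarrow> 'b) \<Rightarrow> (real^3 \<Rightarrow> 'b) \<Rightarrow> bool"  (infix "=\<^sub>a\<^sub>e" 50) where
  "f =\<^sub>a\<^sub>e g \<equiv> AE x in lborel. f x = g x"

definition L2 :: "(real^3 \<Rightarrow> 'b::euclidean_space) set" where
  "L2 = {f \<in> borel_measurable lborel. integrable lborel (\<lambda>x. (norm (f x))\<^sup>2)}"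

definition L2_norm :: "(real^3 \<Rightarrow> 'b::euclidean_space) \<Rightarrow> real" where
  "L2_norm f = sqrt (LINT x|lborel. (norm (f x))\<^sup>2)"

definition L2_tendsto :: "(nat \<Rightarrow> real^3 \<Rightarrow> 'b::euclidean_space) \<Rightarrow> (real^3 \<Rightarrow> 'b) \<Rightarrow> bool" where
  "L2_tendsto s f \<longleftrightarrow> (\<forall>n. s n \<in> L2) \<and> f \<in> L2 \<and> (\<lambda>n. L2_norm (\<lambda>x. s n x - f x)) \<longlonglongrightarrow> 0"

text \<open>Extension to \<open>L\<^sup>2\<close> by continuity of an operator \<open>T\<close> given on a dense set \<open>D\<close>.\<close>

definition L2_extension ::
    "(real^3 \<Rightarrow> cquat) set \<Rightarrow> ((real^3 \<Rightarrow> cquat) \<Rightarrow> real^3 \<Rightarrow> cquat) \<Rightarrow> (real^3 \<Rightarrow> cquat) \<Rightarrow> real^3 \<Rightarrow> cquat" where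
  "L2_extension D T f =
     (SOME g. \<exists>s. (\<forall>n. s n \<in> D) \<and> L2_tendsto s f \<and> L2_tendsto (\<lambda>n. T (s n)) g)"

section \<open>The Hilbert and Fourier transforms\<close>

definition hilbert_pv :: "(real^3 \<Rightarrow> cquat) \<Rightarrow> real^3 \<Rightarrow> cquat" where
  "hilbert_pv f x = (1 / pi\<^sup>2) *\<^sub>R
     Lim (at_right 0) (\<lambda>\<epsilon>. LINT y:{y. \<epsilon> < norm (x - y)}|lborel.
        (1 / norm (x - y) ^ 4) *\<^sub>R (pure_quat (x - y) \<odot> f y))"

text \<open>
  For Lipschitz functions of bounded support the principal value exists at every point,
  and these functions are dense in \<open>L\<^sup>2\<close>.
\<close>

definition lipschitz_bounded_support :: "(real^3 \<Rightarrow> cquat) set" where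
  "lipschitz_bounded_support = {f. (\<exists>K. K-lipschitz_on UNIV f) \<and> bounded {x. f x \<noteq> 0}}"

definition hilbert :: "(real^3 \<Rightarrow> cquat) \<Rightarrow> real^3 \<Rightarrow> cquat" where
  "hilbert = L2_extension lipschitz_bounded_support hilbert_pv"

definition fourier_integral :: "(real^3 \<Rightarrow> cquat) \<Rightarrow> real^3 \<Rightarrow> cquat" where
  "fourier_integral f \<xi> = (LINT x|lborel. exp (- \<i> * complex_of_real (2 * pi * (x \<bullet> \<xi>))) *s f x)"

definition fourier :: "(real^3 \<Rightarrow> cquat) \<Rightarrow> real^3 \<Rightarrow> cquat" where
  "fourier = L2_extension {f \<in> L2. integrable lborel f} fourier_integral"

section \<open>Subspaces of \<open>L\<^sup>2\<close>\<close>

text \<open>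
  Closed complex subspaces. Closedness includes closedness under almost everywhere equality
  (consider constant sequences).
\<close>

definition L2_subspace :: "(real^3 \<Rightarrow> cquat) set \<Rightarrow> bool" where
  "L2_subspace V \<longleftrightarrow> V \<subseteq> L2 \<and> (\<lambda>x. 0) \<in> V \<and>
     (\<forall>f\<in>V. \<forall>g\<in>V. (\<lambda>x. f x + g x) \<in> V) \<and>
     (\<forall>c::complex. \<forall>f\<in>V. (\<lambda>x. c *s f x) \<in> V) \<and>
     (\<forall>s f. (\<forall>n. s n \<in> V) \<and> L2_tendsto s f \<longrightarrow> f \<in> V)"

definition L2_nontrivial :: "(real^3 \<Rightarrow> cquat) set \<Rightarrow> bool" where
  "L2_nontrivial V \<longleftrightarrow> (\<exists>f\<in>V. \<not> f =\<^sub>a\<^sub>e (\<lambda>x. 0)) \<and> V \<noteq> L2"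

definition L2_sum :: "(real^3 \<Rightarrow> cquat) set \<Rightarrow> (real^3 \<Rightarrow> cquat) set \<Rightarrow> (real^3 \<Rightarrow> cquat) set" where
  "L2_sum U V = {f \<in> L2. \<exists>u\<in>U. \<exists>v\<in>V. f =\<^sub>a\<^sub>e (\<lambda>x. u x + v x)}"

definition L2_independent :: "(real^3 \<Rightarrow> cquat) set \<Rightarrow> (real^3 \<Rightarrow> cquat) set \<Rightarrow> bool" where
  "L2_independent U V \<longleftrightarrow> (\<forall>f \<in> U \<inter> V. f =\<^sub>a\<^sub>e (\<lambda>x. 0))"

text \<open>
  Invariant subspaces on which \<open>T\<close> acts by multiplication with one complex scalar. Maximality
  is maximality among these: a subspace maximal among all proper invariant subspaces is
  something else, since for \<open>T\<^sup>2 = I\<close> any sum of subspaces of the two eigenspaces is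
  invariant.
\<close>

definition scalar_invariant ::
    "((real^3 \<Rightarrow> cquat) \<Rightarrow> real^3 \<Rightarrow> cquat) \<Rightarrow> (real^3 \<Rightarrow> cquat) set \<Rightarrow> bool" where
  "scalar_invariant T V \<longleftrightarrow> L2_subspace V \<and> (\<forall>f\<in>V. T f \<in> V) \<and>
     (\<exists>c::complex. \<forall>f\<in>V. T f =\<^sub>a\<^sub>e (\<lambda>x. c *s f x))"

definition maximal_invariant ::
    "((real^3 \<Rightarrow> cquat) \<Rightarrow> real^3 \<Rightarrow> cquat) \<Rightarrow> (real^3 \<Rightarrow> cquat) set \<Rightarrow> bool" where
  "maximal_invariant T V \<longleftrightarrow> scalar_invariant T V \<and>
     (\<forall>W. scalar_invariant T W \<and> V \<subseteq> W \<longrightarrow> W = V)"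

section \<open>The spaces \<open>H\<^sub>j\<^sup>\<plusminus>\<close>\<close>

definition Lspace :: "(real^3 \<Rightarrow> cquat) \<Rightarrow> cquat \<Rightarrow> (real^3 \<Rightarrow> cquat) set" where
  "Lspace \<gamma> w = {g \<in> L2. \<exists>\<alpha> \<in> (L2 :: (real^3 \<Rightarrow> complex) set).
      g =\<^sub>a\<^sub>e (\<lambda>y. \<gamma> (sgn y) \<odot> (\<alpha> y *s w))}"

definition fourier_image :: "(real^3 \<Rightarrow> cquat) set \<Rightarrow> (real^3 \<Rightarrow> cquat) set" where
  "fourier_image V = {f \<in> L2. \<exists>g\<in>V. f =\<^sub>a\<^sub>e fourier g}"

definition qH1_minus :: "(real^3 \<Rightarrow> cquat) \<Rightarrow> (real^3 \<Rightarrow> cquat) set" where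
  "qH1_minus \<gamma> = fourier_image (Lspace \<gamma> (qone - \<i> *s e3))"

definition qH1_plus :: "(real^3 \<Rightarrow> cquat) \<Rightarrow> (real^3 \<Rightarrow> cquat) set" where
  "qH1_plus \<gamma> = fourier_image (Lspace \<gamma> (e1 + \<i> *s e2))"

definition qH2_minus :: "(real^3 \<Rightarrow> cquat) \<Rightarrow> (real^3 \<Rightarrow> cquat) set" where
  "qH2_minus \<gamma> = fourier_image (Lspace \<gamma> (e1 - \<i> *s e2))"

definition qH2_plus :: "(real^3 \<Rightarrow> cquat) \<Rightarrow> (real^3 \<Rightarrow> cquat) set" where
  "qH2_plus \<gamma> = fourier_image (Lspace \<gamma> (qone + \<i> *s e3))"

definition qH_plus :: "(real^3 \<Rightarrow> cquat) \<Rightarrow> (real^3 \<Rightarrow> cquat) set" where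
  "qH_plus \<gamma> = L2_sum (qH1_plus \<gamma>) (qH2_plus \<gamma>)"

definition qH_minus :: "(real^3 \<Rightarrow> cquat) \<Rightarrow> (real^3 \<Rightarrow> cquat) set" where
  "qH_minus \<gamma> = L2_sum (qH1_minus \<gamma>) (qH2_minus \<gamma>)"

end

theory Submission
  imports Defs "HOL-Probability.Probability"
begin

text \<open>
  On the Fourier side the Hilbert transformation is a multiplier: since
  \<open>x/(\<pi>\<^sup>2|x|\<^sup>4) = \<integral>\<^sub>0\<^sup>\<infinity> 2s\<^sup>-\<^sup>5 exp (-\<pi>|x|\<^sup>2/s\<^sup>2) x ds\<close> is a superposition of Gaussian moments, whose Fourier integrals
  are explicit, the kernel becomes \<open>-\<i> 2\<xi> \<integral>\<^sub>0\<^sup>\<infinity> exp (-\<pi>s\<^sup>2|\<xi>|\<^sup>2) ds = -\<i>\<xi>/|\<xi>|\<close>. Applied to \<open>\<F> g\<close> this is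
  \<open>\<F> (\<i>\<omega> g)\<close> with \<open>\<omega> = \<xi>/|\<xi>|\<close>, the sign being flipped by \<open>\<F>\<F> g(x) = g(-x)\<close>. As \<open>\<omega>\<gamma> = \<gamma> e\<^sub>3\<close>,
  multiplication by \<open>\<i>\<omega>\<close> turns \<open>\<gamma>\<alpha>w\<close> into \<open>\<gamma>\<alpha>(\<i>e\<^sub>3w)\<close>, and the four spinors \<open>w\<close> are eigenvectors of
  \<open>\<i>e\<^sub>3\<close> with eigenvalues \<open>\<plusminus>1\<close> that form a basis. Hence the two spaces are the full eigenspaces of the
  involution \<open>H\<close>, which gives the decomposition and the maximality.

  Of the Plancherel theorem only the boundedness of \<open>\<F>\<close> is needed, since \<open>\<F>\<F>\<close> is a reflection.
\<close>

section \<open>Complexified quaternions as a normed space\<close>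

text \<open>The kernel of H is integrable neither at 0 nor at infinity, and H is a chosen continuous
  extension of principal values, so the multiplier is reached through truncations. Restricting the
  superposition to a compact range of s gives an integrable multiplier and a bounded kernel, and for
  these the convolution formula is Fubini. As the range grows, the same functions have two limits: a
  pointwise one, the principal value, by oddness of the kernel and the Lipschitz condition, and one
  in L^2, by dominated convergence of the multipliers and boundedness of the Fourier transformation.
  They agree almost everywhere, and this yields at the same time the linearity and the L^2 bound
  that make the extension of H independent of choices. The constant 1/\<pi>^2 comes out of the
  substitution u = 1/s^2, as the integral of u exp (-\<pi>r^2 u) over u > 0 is
  1/(\<pi>r^2)^2.\<close>

lemma norm_cquat_power2: "(norm (v::cquat))\<^sup>2 = (\<Sum>k\<in>UNIV. (cmod (v$k))\<^sup>2)"
  by (simp add: norm_vec_def L2_set_def sum_nonneg)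

lemma norm_complex_scale: "norm (c *s (v::cquat)) = cmod c * norm v"
proof -
  have "(norm (c *s v))\<^sup>2 = (cmod c * norm v)\<^sup>2"
    by (simp add: norm_cquat_power2 norm_mult power_mult_distrib sum_distrib_left)
  then show ?thesis by (simp add: power2_eq_iff_nonneg)
qed

lemma scaleR_eq_complex_scale: "r *\<^sub>R (v::cquat) = complex_of_real r *s v"
  by (simp add: vec_eq_iff scaleR_conv_of_real[where 'a=complex])

lemma bounded_bilinear_complex_scale: "bounded_bilinear ((*s) :: complex \<Rightarrow> cquat \<Rightarrow> cquat)"
  by (rule bounded_bilinear.intro)
     (auto simp: vec_eq_iff algebra_simps norm_complex_scale intro: exI[of _ 1])

lemma bounded_bilinear_cq_mult: "bounded_bilinear (\<odot>)"
  unfolding bilinear_conv_bounded_bilinear[symmetric]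
  by (auto simp: bilinear_def linear_iff cq_mult_bilinear scaleR_eq_complex_scale)

section \<open>Measurability of the algebraic operations\<close>

lemma borel_measurable_complex_scale [measurable (raw)]:
  fixes v :: "'a \<Rightarrow> cquat"
  shows "c \<in> borel_measurable M \<Longrightarrow> v \<in> borel_measurable M \<Longrightarrow> (\<lambda>x. c x *s v x) \<in> borel_measurable M"
  by (rule borel_measurable_continuous_Pair)
     (auto intro!: bounded_bilinear.continuous_on[OF bounded_bilinear_complex_scale] continuous_intros)

lemma borel_measurable_cq_mult [measurable (raw)]:
  "p \<in> borel_measurable M \<Longrightarrow> q \<in> borel_measurable M \<Longrightarrow> (\<lambda>x. p x \<odot> q x) \<in> borel_measurable M"
  by (rule borel_measurable_continuous_Pair)
     (auto intro!: bounded_bilinear.continuous_on[OF bounded_bilinear_cq_mult] continuous_intros)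

lemma borel_measurable_vec_nth_complex [measurable (raw)]:
  fixes v :: "'a \<Rightarrow> cquat"
  shows "v \<in> borel_measurable M \<Longrightarrow> (\<lambda>x. v x $ k) \<in> borel_measurable M"
  by (rule borel_measurable_continuous_on[where f="\<lambda>v. v $ k"]) (auto intro!: continuous_intros)

lemma borel_measurable_vec_nth_real [measurable (raw)]:
  fixes v :: "'a \<Rightarrow> real^3"
  shows "v \<in> borel_measurable M \<Longrightarrow> (\<lambda>x. v x $ k) \<in> borel_measurable M"
  by (rule borel_measurable_continuous_on[where f="\<lambda>v. v $ k"]) (auto intro!: continuous_intros)

lemma borel_measurable_sgn_vec [measurable (raw)]:
  fixes v :: "'a \<Rightarrow> real^3"
  shows "v \<in> borel_measurable M \<Longrightarrow> (\<lambda>x. sgn (v x)) \<in> borel_measurable M"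
  unfolding sgn_div_norm by measurable

lemma linear_pure_quat: "linear pure_quat"
  by (rule linearI) (simp_all add: pure_quat_def vec_eq_iff algebra_simps scaleR_conv_of_real[where 'a=complex])

lemma borel_measurable_pure_quat [measurable (raw)]:
  "v \<in> borel_measurable M \<Longrightarrow> (\<lambda>x. pure_quat (v x)) \<in> borel_measurable M"
  by (rule borel_measurable_continuous_on[where f=pure_quat])
     (auto intro!: linear_continuous_on simp: linear_conv_bounded_linear[symmetric] linear_pure_quat)

text \<open>The inner product is the real one on the eight real coordinates, for which the adjoint
  of a complex scalar is its conjugate. This is what moves a Fourier phase from one factor to the
  other.\<close>

lemma inner_complex_scale: "(c *s v) \<bullet> w = v \<bullet> (cnj c *s (w::cquat))"
  by (simp add: inner_vec_def inner_complex_def sum.distrib[symmetric] algebra_simps)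

text \<open>Left multiplication by a real quaternion is its norm times an isometry. With complex
  coefficients on both sides the norm is not multiplicative: 1 + \<i> e3 and 1 - \<i> e3 have
  product 0.\<close>

lemma norm_real_quat_mult:
  assumes "\<forall>k. p$k \<in> \<real>"
  shows "norm (p \<odot> q) = norm p * norm q"
proof -
  define a b c d where "a = Re (p$1)" "b = Re (p$2)" "c = Re (p$3)" "d = Re (p$4)"
  have p: "p$1 = of_real a" "p$2 = of_real b" "p$3 = of_real c" "p$4 = of_real d"
    using assms by (simp_all add: a_b_c_d_def of_real_Re)
  have "(norm (p \<odot> q))\<^sup>2 = (norm p * norm q)\<^sup>2"
    unfolding norm_cquat_power2 power_mult_distrib cmod_power2
    by (simp add: sum_4 cq_mult_def p) (simp add: power2_eq_square algebra_simps)
  then show ?thesis by (simp add: power2_eq_iff_nonneg)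
qed

lemma norm_pure_quat: "norm (pure_quat x) = norm x"
proof -
  have "(norm (pure_quat x))\<^sup>2 = (norm x)\<^sup>2"
    by (simp add: norm_cquat_power2 sum_4 pure_quat_def e1_def e2_def e3_def norm_vec_def L2_set_def sum_3)
  then show ?thesis by (simp add: power2_eq_iff_nonneg)
qed

lemma norm_pure_quat_mult: "norm (pure_quat x \<odot> q) = norm x * norm q"
proof -
  have "\<forall>k. pure_quat x $ k \<in> \<real>"
    by (simp add: forall_4 pure_quat_def e1_def e2_def e3_def)
  then show ?thesis by (simp add: norm_real_quat_mult norm_pure_quat)
qed

text \<open>The Clifford relation; together with \<open>\<i> * \<i> = -1\<close> it makes
  \<i>\<omega> an involution for a unit vector \<omega>.\<close>

lemma pure_quat_square: "pure_quat x \<odot> pure_quat x = - ((norm x)\<^sup>2 *\<^sub>R qone)"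
proof -
  have n: "(norm x)\<^sup>2 = x$1 * x$1 + x$2 * x$2 + x$3 * x$3"
    by (simp add: norm_vec_def L2_set_def sum_3 power2_eq_square[symmetric])
  show ?thesis unfolding n
    by (simp add: cq_simps scaleR_conv_of_real[where 'a=complex])
qed

section \<open>Square-integrable functions\<close>

text \<open>The squared norm is the working quantity: |a + b|^2 <= 2|a|^2 + 2|b|^2 takes the place
  of Minkowski's inequality, and the resulting factors 2 do not affect convergence.\<close>

definition sq_int :: "(real^3 \<Rightarrow> 'b::euclidean_space) \<Rightarrow> real" where
  "sq_int f = (LINT x|lborel. (norm (f x))\<^sup>2)"

lemma L2_measurable [measurable_dest]: "f \<in> L2 \<Longrightarrow> f \<in> borel_measurable borel"
  by (simp add: L2_def)

lemma L2_integrable: "f \<in> L2 \<Longrightarrow> integrable lborel (\<lambda>x. (norm (f x))\<^sup>2)"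
  by (simp add: L2_def)

lemma L2I: "f \<in> borel_measurable borel \<Longrightarrow> integrable lborel (\<lambda>x. (norm (f x))\<^sup>2) \<Longrightarrow> f \<in> L2"
  by (simp add: L2_def)

lemma sq_int_nonneg [simp]: "0 \<le> sq_int f"
  by (simp add: sq_int_def)

lemma L2_dominated:
  assumes "g \<in> L2" and [measurable]: "f \<in> borel_measurable borel"
    and "AE x in lborel. norm (f x) \<le> c * norm (g x)" and "0 \<le> c"
  shows "f \<in> L2" and "sq_int f \<le> c\<^sup>2 * sq_int g"
proof -
  have b: "AE x in lborel. (norm (f x))\<^sup>2 \<le> c\<^sup>2 * (norm (g x))\<^sup>2"
    using assms(3) by eventually_elim (metis norm_ge_zero power_mono power_mult_distrib)
  have i: "integrable lborel (\<lambda>x. c\<^sup>2 * (norm (g x))\<^sup>2)"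
    using L2_integrable[OF assms(1)] by simp
  have j: "integrable lborel (\<lambda>x. (norm (f x))\<^sup>2)"
    by (rule Bochner_Integration.integrable_bound[OF i]) (use b in auto)
  then show "f \<in> L2" by (intro L2I) auto
  have "sq_int f \<le> (LINT x|lborel. c\<^sup>2 * (norm (g x))\<^sup>2)"
    unfolding sq_int_def by (rule integral_mono_AE[OF j i b])
  then show "sq_int f \<le> c\<^sup>2 * sq_int g" by (simp add: sq_int_def)
qed

lemma norm_add_power2_le: "(norm (a + b))\<^sup>2 \<le> 2 * (norm a)\<^sup>2 + 2 * (norm b)\<^sup>2"
proof -
  have "(norm (a + b))\<^sup>2 \<le> (norm a + norm b)\<^sup>2"
    by (intro power_mono norm_triangle_ineq) simp
  also have "\<dots> \<le> 2 * (norm a)\<^sup>2 + 2 * (norm b)\<^sup>2"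
    using sum_squares_ge_zero[of "norm a - norm b" 0] by (simp add: power2_eq_square algebra_simps)
  finally show ?thesis .
qed

lemma L2_add:
  assumes [measurable]: "f \<in> L2" "g \<in> L2"
  shows "(\<lambda>x. f x + g x) \<in> L2" and "sq_int (\<lambda>x. f x + g x) \<le> 2 * sq_int f + 2 * sq_int g"
proof -
  note fg = L2_integrable[OF assms(1)] L2_integrable[OF assms(2)]
  have i: "integrable lborel (\<lambda>x. 2 * (norm (f x))\<^sup>2 + 2 * (norm (g x))\<^sup>2)"
    using fg by simp
  have j: "integrable lborel (\<lambda>x. (norm (f x + g x))\<^sup>2)"
    by (rule Bochner_Integration.integrable_bound[OF i]) (auto intro: norm_add_power2_le)
  then show "(\<lambda>x. f x + g x) \<in> L2" by (intro L2I) auto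
  have "sq_int (\<lambda>x. f x + g x) \<le> (LINT x|lborel. 2 * (norm (f x))\<^sup>2 + 2 * (norm (g x))\<^sup>2)"
    unfolding sq_int_def by (rule integral_mono[OF j i]) (rule norm_add_power2_le)
  then show "sq_int (\<lambda>x. f x + g x) \<le> 2 * sq_int f + 2 * sq_int g"
    using fg by (simp add: sq_int_def)
qed

lemma L2_uminus: "f \<in> L2 \<Longrightarrow> (\<lambda>x. - f x) \<in> L2"
  by (simp add: L2_def)

lemma sq_int_uminus [simp]: "sq_int (\<lambda>x. - f x) = sq_int f"
  by (simp add: sq_int_def)

lemma L2_diff:
  assumes "f \<in> L2" "g \<in> L2"
  shows "(\<lambda>x. f x - g x) \<in> L2" and "sq_int (\<lambda>x. f x - g x) \<le> 2 * sq_int f + 2 * sq_int g"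
  using L2_add[OF assms(1) L2_uminus[OF assms(2)]] by simp_all

lemma sq_int_commute: "sq_int (\<lambda>x. f x - g x) = sq_int (\<lambda>x. g x - f x)"
  by (simp add: sq_int_def norm_minus_commute)

lemma sq_int_triangle:
  assumes "f \<in> L2" "g \<in> L2" "h \<in> L2"
  shows "sq_int (\<lambda>x. f x - h x) \<le> 2 * sq_int (\<lambda>x. f x - g x) + 2 * sq_int (\<lambda>x. g x - h x)"
  using L2_add(2)[OF L2_diff(1)[OF assms(1,2)] L2_diff(1)[OF assms(2,3)]] by simp

lemma L2_complex_scale:
  fixes f :: "real^3 \<Rightarrow> cquat"
  assumes "f \<in> L2"
  shows "(\<lambda>x. c *s f x) \<in> L2" and "sq_int (\<lambda>x. c *s f x) = (cmod c)\<^sup>2 * sq_int f"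
proof -
  have [measurable]: "f \<in> borel_measurable borel" using assms by simp
  show "(\<lambda>x. c *s f x) \<in> L2"
    by (rule L2_dominated(1)[OF assms, where c="cmod c"]) (auto simp: norm_complex_scale)
  show "sq_int (\<lambda>x. c *s f x) = (cmod c)\<^sup>2 * sq_int f"
    by (simp add: sq_int_def norm_complex_scale power_mult_distrib)
qed

lemma L2_zero: "(\<lambda>x. 0) \<in> L2"
  by (simp add: L2_def)

lemma L2_cong_AE:
  assumes "f \<in> L2" "g \<in> borel_measurable borel" "g =\<^sub>a\<^sub>e f"
  shows "g \<in> L2"
  by (rule L2_dominated(1)[OF assms(1,2), where c=1]) (use assms(3) in auto)

lemma sq_int_cong_AE:
  assumes "f =\<^sub>a\<^sub>e g"
  and [measurable]: "f \<in> borel_measurable borel" "g \<in> borel_measurable borel"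
  shows "sq_int f = sq_int g"
  unfolding sq_int_def by (rule integral_cong_AE) (use assms(1) in auto)

lemma sq_int_eq_0:
  assumes "f \<in> L2"
  shows "sq_int f = 0 \<longleftrightarrow> f =\<^sub>a\<^sub>e (\<lambda>x. 0)"
  unfolding sq_int_def using integral_nonneg_eq_0_iff_AE[OF L2_integrable[OF assms]] by simp

subsection \<open>Convergence\<close>

lemma L2_tendsto_iff:
  "L2_tendsto s f \<longleftrightarrow> (\<forall>n. s n \<in> L2) \<and> f \<in> L2 \<and> (\<lambda>n. sq_int (\<lambda>x. s n x - f x)) \<longlonglongrightarrow> 0"
proof -
  have "(\<lambda>n. sqrt (sq_int (\<lambda>x. s n x - f x))) \<longlonglongrightarrow> 0 \<longleftrightarrow> (\<lambda>n. sq_int (\<lambda>x. s n x - f x)) \<longlonglongrightarrow> 0"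
    using tendsto_real_sqrt[of "\<lambda>n. sq_int (\<lambda>x. s n x - f x)" 0 sequentially]
      tendsto_power[of "\<lambda>n. sqrt (sq_int (\<lambda>x. s n x - f x))" 0 sequentially 2] by auto
  then show ?thesis by (simp add: L2_tendsto_def L2_norm_def sq_int_def[symmetric])
qed

lemma L2_tendstoD:
  assumes "L2_tendsto s f"
  shows "s n \<in> L2" "f \<in> L2" "(\<lambda>n. sq_int (\<lambda>x. s n x - f x)) \<longlonglongrightarrow> 0"
  using assms by (auto simp: L2_tendsto_iff)

lemma L2_tendsto_bound:
  assumes "\<And>n. s n \<in> L2" "f \<in> L2" "\<And>n. sq_int (\<lambda>x. s n x - f x) \<le> b n" "b \<longlonglongrightarrow> 0"
  shows "L2_tendsto s f"
  unfolding L2_tendsto_iff using assms tendsto_sandwich[OF _ _ tendsto_const assms(4), of "\<lambda>n. sq_int (\<lambda>x. s n x - f x)"]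
  by simp

lemma L2_tendsto_unique:
  assumes "L2_tendsto s f" "L2_tendsto s g"
  shows "f =\<^sub>a\<^sub>e g"
proof -
  note F = L2_tendstoD[OF assms(1)] and G = L2_tendstoD[OF assms(2)]
  have l: "(\<lambda>n. 2 * sq_int (\<lambda>x. s n x - f x) + 2 * sq_int (\<lambda>x. s n x - g x)) \<longlonglongrightarrow> 2 * 0 + 2 * 0"
    by (intro tendsto_intros F G)
  have "sq_int (\<lambda>x. f x - g x) \<le> 2 * sq_int (\<lambda>x. s n x - f x) + 2 * sq_int (\<lambda>x. s n x - g x)" for n
    using sq_int_triangle[OF F(2,1) G(2)] by (subst sq_int_commute[of "s n" f]) simp
  then have "sq_int (\<lambda>x. f x - g x) \<le> 0"
    using LIMSEQ_le_const[OF l] by simp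
  then have "sq_int (\<lambda>x. f x - g x) = 0" by (simp add: antisym)
  then show ?thesis using sq_int_eq_0[OF L2_diff(1)[OF F(2) G(2)]] by simp
qed

lemma L2_tendsto_cong_AE:
  assumes "L2_tendsto s f" "\<And>n. t n \<in> borel_measurable borel" "\<And>n. t n =\<^sub>a\<^sub>e s n"
    "g \<in> borel_measurable borel" "g =\<^sub>a\<^sub>e f"
  shows "L2_tendsto t g"
proof -
  note S = L2_tendstoD[OF assms(1)]
  have [measurable]: "s n \<in> borel_measurable borel" "f \<in> borel_measurable borel" for n using S by auto
  note [measurable] = assms(2,4)
  have "sq_int (\<lambda>x. t n x - g x) = sq_int (\<lambda>x. s n x - f x)" for n
  proof (rule sq_int_cong_AE)
    show "(\<lambda>x. t n x - g x) =\<^sub>a\<^sub>e (\<lambda>x. s n x - f x)"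
      using assms(3)[of n] assms(5) by eventually_elim simp
  qed measurable
  then show ?thesis
    using S L2_cong_AE[OF S(1) assms(2,3)] L2_cong_AE[OF S(2) assms(4,5)] by (simp add: L2_tendsto_iff)
qed

lemma L2_tendsto_const: "f \<in> L2 \<Longrightarrow> L2_tendsto (\<lambda>n. f) f"
  by (simp add: L2_tendsto_iff sq_int_def)

lemma L2_tendsto_add:
  assumes "L2_tendsto s f" "L2_tendsto t g"
  shows "L2_tendsto (\<lambda>n x. s n x + t n x) (\<lambda>x. f x + g x)"
proof (rule L2_tendsto_bound[where b="\<lambda>n. 2 * sq_int (\<lambda>x. s n x - f x) + 2 * sq_int (\<lambda>x. t n x - g x)"])
  note F = L2_tendstoD[OF assms(1)] and G = L2_tendstoD[OF assms(2)]
  show "(\<lambda>x. s n x + t n x) \<in> L2" "(\<lambda>x. f x + g x) \<in> L2" for n using F G by (auto intro: L2_add)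
  show "sq_int (\<lambda>x. s n x + t n x - (f x + g x)) \<le> 2 * sq_int (\<lambda>x. s n x - f x) + 2 * sq_int (\<lambda>x. t n x - g x)" for n
    using L2_add(2)[OF L2_diff(1)[OF F(1,2)] L2_diff(1)[OF G(1,2)], of n n] by (simp add: algebra_simps)
  have "(\<lambda>n. 2 * sq_int (\<lambda>x. s n x - f x) + 2 * sq_int (\<lambda>x. t n x - g x)) \<longlonglongrightarrow> 2 * 0 + 2 * 0"
    by (intro tendsto_intros F G)
  then show "(\<lambda>n. 2 * sq_int (\<lambda>x. s n x - f x) + 2 * sq_int (\<lambda>x. t n x - g x)) \<longlonglongrightarrow> 0" by simp
qed

lemma L2_tendsto_complex_scale:
  fixes f :: "real^3 \<Rightarrow> cquat"
  assumes "L2_tendsto s f"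
  shows "L2_tendsto (\<lambda>n x. c *s s n x) (\<lambda>x. c *s f x)"
proof (rule L2_tendsto_bound[where b="\<lambda>n. (cmod c)\<^sup>2 * sq_int (\<lambda>x. s n x - f x)"])
  note F = L2_tendstoD[OF assms(1)]
  show "(\<lambda>x. c *s s n x) \<in> L2" "(\<lambda>x. c *s f x) \<in> L2" for n using F by (auto intro: L2_complex_scale)
  show "sq_int (\<lambda>x. c *s s n x - c *s f x) \<le> (cmod c)\<^sup>2 * sq_int (\<lambda>x. s n x - f x)" for n
    using L2_complex_scale(2)[OF L2_diff(1)[OF F(1,2)], of c n] by (simp add: vector_ssub_ldistrib)
  show "(\<lambda>n. (cmod c)\<^sup>2 * sq_int (\<lambda>x. s n x - f x)) \<longlonglongrightarrow> 0"
    using tendsto_mult_right_zero[OF F(3)] .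
qed

lemma L2_tendsto_dominated:
  fixes h :: "real^3 \<Rightarrow> 'c::euclidean_space"
  assumes "h \<in> L2" "0 \<le> c" and [measurable]: "\<And>n. s n \<in> borel_measurable borel" "f \<in> borel_measurable borel"
    and b: "\<And>n. AE x in lborel. norm (s n x) \<le> c * norm (h x)"
    and l: "AE x in lborel. (\<lambda>n. s n x) \<longlonglongrightarrow> f x"
  shows "L2_tendsto s f"
proof -
  have bf: "AE x in lborel. norm (f x) \<le> c * norm (h x)"
  proof -
    have "AE x in lborel. \<forall>n. norm (s n x) \<le> c * norm (h x)"
      using b by (simp add: AE_all_countable)
    then show ?thesis
      using l
    proof eventually_elim
      case (elim x)
      show ?case
        by (rule LIMSEQ_le_const2[OF tendsto_norm[OF elim(2)]]) (use elim in auto)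
    qed
  qed
  have L: "s n \<in> L2" "f \<in> L2" for n
    using L2_dominated(1)[OF assms(1) _ b assms(2)] L2_dominated(1)[OF assms(1) _ bf assms(2)] by auto
  have "(\<lambda>n. LINT x|lborel. (norm (s n x - f x))\<^sup>2) \<longlonglongrightarrow> (LINT x|(lborel::(real^3) measure). 0)"
  proof (rule integral_dominated_convergence[where w="\<lambda>x. (2 * c)\<^sup>2 * (norm (h x))\<^sup>2"])
    show "integrable lborel (\<lambda>x. (2 * c)\<^sup>2 * (norm (h x))\<^sup>2)" using L2_integrable[OF assms(1)] by simp
    show "AE x in lborel. (\<lambda>n. (norm (s n x - f x))\<^sup>2) \<longlonglongrightarrow> 0"
      using l by eventually_elim (auto intro!: tendsto_eq_intros)
    show "AE x in lborel. norm ((norm (s n x - f x))\<^sup>2) \<le> (2 * c)\<^sup>2 * (norm (h x))\<^sup>2" for n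
      using b[of n] bf
    proof eventually_elim
      case (elim x)
      then have "norm (s n x - f x) \<le> 2 * c * norm (h x)"
        using norm_triangle_ineq4[of "s n x" "f x"] by linarith
      then show ?case using power_mono[of "norm (s n x - f x)" "2 * c * norm (h x)" 2]
        by (simp add: power_mult_distrib)
    qed
  qed auto
  then show ?thesis using L by (simp add: L2_tendsto_iff sq_int_def)
qed

text \<open>Square integrability of the pointwise limit is a conclusion here. The bound is asked
  only eventually, so that it can be fed directly from a convergent sequence of norms.\<close>

lemma L2_Fatou:
  assumes [measurable]: "\<And>n. s n \<in> borel_measurable borel" "f \<in> borel_measurable borel"
    and l: "AE x in lborel. (\<lambda>n. s n x) \<longlonglongrightarrow> f x"
    and s: "\<And>n. s n \<in> L2" "eventually (\<lambda>n. sq_int (s n) \<le> B) sequentially"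
  shows "f \<in> L2" "sq_int f \<le> B"
proof -
  \<comment> \<open>\<open>ennreal\<close> sends negative numbers to 0, so the sign of B must be
    known before the final inequality can be read back in the reals.\<close>
  have B: "0 \<le> B"
  proof -
    obtain n where "sq_int (s n) \<le> B"
      using s(2) unfolding eventually_sequentially by blast
    then show ?thesis using sq_int_nonneg[of "s n"] by linarith
  qed
  have e: "(\<integral>\<^sup>+x. ennreal ((norm (s n x))\<^sup>2) \<partial>lborel) = ennreal (sq_int (s n))" for n
    unfolding sq_int_def by (rule nn_integral_eq_integral) (use L2_integrable[OF s(1)] in auto)
  have "(\<integral>\<^sup>+x. ennreal ((norm (f x))\<^sup>2) \<partial>lborel) = (\<integral>\<^sup>+x. liminf (\<lambda>n. ennreal ((norm (s n x))\<^sup>2)) \<partial>lborel)"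
  proof (rule nn_integral_cong_AE, use l in eventually_elim)
    fix x assume "(\<lambda>n. s n x) \<longlonglongrightarrow> f x"
    then have "(\<lambda>n. ennreal ((norm (s n x))\<^sup>2)) \<longlonglongrightarrow> ennreal ((norm (f x))\<^sup>2)"
      by (intro tendsto_ennrealI tendsto_intros)
    then show "ennreal ((norm (f x))\<^sup>2) = liminf (\<lambda>n. ennreal ((norm (s n x))\<^sup>2))"
      by (metis lim_imp_Liminf trivial_limit_sequentially)
  qed
  also have "\<dots> \<le> liminf (\<lambda>n. \<integral>\<^sup>+x. ennreal ((norm (s n x))\<^sup>2) \<partial>lborel)"
    by (rule nn_integral_liminf) auto
  also have "\<dots> \<le> ennreal B"
    unfolding e by (rule Liminf_le) (use s(2) in \<open>auto elim!: eventually_mono simp: ennreal_leI\<close>)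
  finally have le: "(\<integral>\<^sup>+x. ennreal ((norm (f x))\<^sup>2) \<partial>lborel) \<le> ennreal B" .
  then have i: "integrable lborel (\<lambda>x. (norm (f x))\<^sup>2)"
    by (intro integrableI_bounded) (auto intro: le_less_trans)
  then show "f \<in> L2" by (intro L2I) auto
  have "ennreal (sq_int f) \<le> ennreal B"
    using le unfolding sq_int_def by (subst nn_integral_eq_integral[symmetric]) (use i in auto)
  then show "sq_int f \<le> B" using B by simp
qed

text \<open>The bridge between the two kinds of limit: Fatou applied to \<open>s n - f\<close>
  bounds the squared norm of \<open>g - f\<close> by every positive number. It identifies both the
  inverse Fourier transform and the principal value.\<close>

lemma L2_tendsto_AE_eq:
  assumes "L2_tendsto s f" and [measurable]: "g \<in> borel_measurable borel"
    and "AE x in lborel. (\<lambda>n. s n x) \<longlonglongrightarrow> g x"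
  shows "g =\<^sub>a\<^sub>e f"
proof -
  note S = L2_tendstoD[OF assms(1)]
  have [measurable]: "s n \<in> borel_measurable borel" "f \<in> borel_measurable borel" for n using S by auto
  have *: "(\<lambda>x. g x - f x) \<in> L2 \<and> sq_int (\<lambda>x. g x - f x) \<le> e" if "e > 0" for e
  proof -
    have "AE x in lborel. (\<lambda>n. s n x - f x) \<longlonglongrightarrow> g x - f x"
      using assms(3) by eventually_elim (intro tendsto_intros)
    moreover have "eventually (\<lambda>n. sq_int (\<lambda>x. s n x - f x) \<le> e) sequentially"
      using order_tendstoD(2)[OF S(3) that] by eventually_elim simp
    ultimately show ?thesis
      using L2_Fatou[of "\<lambda>n x. s n x - f x" "\<lambda>x. g x - f x" e] L2_diff(1)[OF S(1,2)] by auto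
  qed
  have "sq_int (\<lambda>x. g x - f x) \<le> 0"
    by (rule field_le_epsilon) (use * in simp)
  then have "sq_int (\<lambda>x. g x - f x) = 0"
    using sq_int_nonneg[of "\<lambda>x. g x - f x"] by linarith
  then show ?thesis
    using sq_int_eq_0[of "\<lambda>x. g x - f x"] *[of 1] by simp
qed

subsection \<open>Completeness\<close>

text \<open>
  The limit of a rapidly convergent subsequence exists almost everywhere: since
  \<open>\<Sum>\<^sub>k 2\<^sup>k |s\<^sub>k\<^sub>+\<^sub>1 - s\<^sub>k|\<^sup>2\<close> has finite integral, the differences decay geometrically at almost
  every point.
\<close>

lemma AE_summable_of_sq_int:
  assumes d: "\<And>k. d k \<in> L2" "\<And>k. sq_int (d k) \<le> (1/4)^k"
  shows "AE x in lborel. summable (\<lambda>k. d k x)"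
proof -
  have [measurable]: "d k \<in> borel_measurable borel" for k using d by auto
  have "(\<integral>\<^sup>+x. (\<Sum>k. ennreal (2^k * (norm (d k x))\<^sup>2)) \<partial>lborel)
      = (\<Sum>k. \<integral>\<^sup>+x. ennreal (2^k * (norm (d k x))\<^sup>2) \<partial>lborel)"
    by (intro nn_integral_suminf) auto
  also have "\<dots> = (\<Sum>k. ennreal (2^k * sq_int (d k)))"
  proof -
    have "(\<integral>\<^sup>+x. ennreal (2^k * (norm (d k x))\<^sup>2) \<partial>lborel) = ennreal (2^k * sq_int (d k))" for k
      using L2_integrable[OF d(1)] by (subst nn_integral_eq_integral) (auto simp: sq_int_def)
    then show ?thesis by simp
  qed
  \<comment> \<open>The weight 2^k uses up half of the decay 4^-k: the remaining 2^-k is summable,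
    and the weight itself forces |d_k| to be of order 2^(-k/2) wherever the weighted sum is
    finite.\<close>
  also have "\<dots> \<le> (\<Sum>k. ennreal ((1/2)^k))"
  proof (intro suminf_le ennreal_leI)
    show "2^k * sq_int (d k) \<le> (1/2)^k" for k
      using mult_left_mono[OF d(2)[of k], of "2^k"] by (simp add: power_mult_distrib[symmetric])
  qed auto
  also have "\<dots> = ennreal (\<Sum>k. (1/2)^k)"
    by (rule suminf_ennreal2) auto
  finally have "(\<integral>\<^sup>+x. (\<Sum>k. ennreal (2^k * (norm (d k x))\<^sup>2)) \<partial>lborel) \<noteq> \<infinity>"
    by (auto simp: top_unique)
  then have "AE x in lborel. (\<Sum>k. ennreal (2^k * (norm (d k x))\<^sup>2)) \<noteq> \<infinity>"
    by (intro nn_integral_PInf_AE) auto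
  then show ?thesis
  proof eventually_elim
    fix x assume fin: "(\<Sum>k. ennreal (2^k * (norm (d k x))\<^sup>2)) \<noteq> \<infinity>"
    define S where "S = enn2real (\<Sum>k. ennreal (2^k * (norm (d k x))\<^sup>2))"
    have le: "(2^k * (norm (d k x))\<^sup>2) \<le> S" for k
    proof -
      define h where "h k = ennreal (2^k * (norm (d k x))\<^sup>2)" for k
      have "sum h {k} \<le> suminf h"
        by (rule sum_le_suminf) auto
      then have "ennreal (2^k * (norm (d k x))\<^sup>2) \<le> (\<Sum>k. ennreal (2^k * (norm (d k x))\<^sup>2))"
        by (simp add: h_def[abs_def])
      also have "\<dots> = ennreal S"
        unfolding S_def by (rule ennreal_enn2real[symmetric]) (use fin in \<open>simp add: less_top[symmetric]\<close>)
      finally show ?thesis by (subst (asm) ennreal_le_iff) (simp_all only: S_def enn2real_nonneg)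
    qed
    have "norm (d k x) \<le> sqrt S * sqrt (1/2) ^ k" for k
    proof -
      have "(norm (d k x))\<^sup>2 \<le> S * (1/2)^k"
        using le[of k] by (simp add: field_simps)
      then have "norm (d k x) \<le> sqrt (S * (1/2)^k)"
        by (rule real_le_rsqrt)
      also have "sqrt (S * (1/2)^k) = sqrt S * sqrt (1/2) ^ k"
        by (simp only: real_sqrt_mult real_sqrt_power)
      finally show ?thesis .
    qed
    moreover have "summable (\<lambda>k. sqrt S * sqrt (1/2) ^ k)"
    proof (intro summable_mult summable_geometric)
      have "sqrt (1/2) < sqrt 1" by (intro real_sqrt_less_mono) simp
      then show "norm (sqrt (1/2)) < (1::real)" by simp
    qed
    ultimately show "summable (\<lambda>k. d k x)"
      by (rule summable_comparison_test'[where N=0, rotated])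
  qed
qed

lemma L2_complete:
  assumes s: "\<And>n. s n \<in> L2"
    and c: "\<And>e. e > 0 \<Longrightarrow> \<exists>N. \<forall>m\<ge>N. \<forall>n\<ge>N. sq_int (\<lambda>x. s m x - s n x) \<le> e"
  shows "\<exists>f. L2_tendsto s f"
proof -
  have [measurable]: "s n \<in> borel_measurable borel" for n using s by auto
  have "\<exists>N. \<forall>k. \<forall>m\<ge>N k. \<forall>n\<ge>N k. sq_int (\<lambda>x. s m x - s n x) \<le> (1/4)^k"
    using c by (intro choice) simp
  then obtain N where N: "\<And>k m n. m \<ge> N k \<Longrightarrow> n \<ge> N k \<Longrightarrow> sq_int (\<lambda>x. s m x - s n x) \<le> (1/4)^k"
    by blast
  \<comment> \<open>Summing the thresholds makes the indices monotone and at least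
    \<open>N k\<close>; the extra k makes them unbounded.\<close>
  define r where "r k = (\<Sum>j\<le>k. N j) + k" for k
  have r: "N k \<le> r k" "r k \<le> r (Suc k)" "k \<le> r k" for k
    unfolding r_def by (auto intro: trans_le_add1 member_le_sum)
  define d where "d k x = s (r (Suc k)) x - s (r k) x" for k x
  have "AE x in lborel. summable (\<lambda>k. d k x)"
  proof (rule AE_summable_of_sq_int)
    show "d k \<in> L2" for k unfolding d_def by (intro L2_diff s)
    show "sq_int (d k) \<le> (1/4)^k" for k
      unfolding d_def by (rule N[OF order_trans[OF r(1,2)] r(1)])
  qed
  then have conv: "AE x in lborel. convergent (\<lambda>k. s (r k) x)"
  proof eventually_elim
    fix x assume "summable (\<lambda>k. d k x)"
    then have "(\<lambda>n. \<Sum>k<n. d k x) \<longlonglongrightarrow> (\<Sum>k. d k x)" by (rule summable_LIMSEQ)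
    then have "(\<lambda>n. s (r n) x - s (r 0) x) \<longlonglongrightarrow> (\<Sum>k. d k x)"
      unfolding d_def sum_lessThan_telescope[of "\<lambda>n. s (r n) x"] .
    from tendsto_add[OF this tendsto_const[of "s (r 0) x"]]
    show "convergent (\<lambda>k. s (r k) x)" by (auto simp: convergent_def)
  qed
  \<comment> \<open>Where the subsequence diverges, \<open>lim\<close> is an unspecified value; this
    concerns a null set only.\<close>
  define f where "f x = lim (\<lambda>k. s (r k) x)" for x
  have [measurable]: "f \<in> borel_measurable borel"
    unfolding f_def by measurable
  have l: "AE x in lborel. (\<lambda>k. s (r k) x) \<longlonglongrightarrow> f x"
    using conv by eventually_elim (simp add: f_def convergent_LIMSEQ_iff)
  \<comment> \<open>The Cauchy estimate is passed to the limit with n fixed and the second index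
    running along the subsequence, which gives convergence of the whole sequence at once.\<close>
  have D: "(\<lambda>x. s n x - f x) \<in> L2 \<and> sq_int (\<lambda>x. s n x - f x) \<le> e"
    if "e > 0" and n: "\<And>m. m \<ge> M \<Longrightarrow> sq_int (\<lambda>x. s n x - s m x) \<le> e" for n e M
  proof -
    have "AE x in lborel. (\<lambda>k. s n x - s (r k) x) \<longlonglongrightarrow> s n x - f x"
      using l by eventually_elim (intro tendsto_intros)
    moreover have "eventually (\<lambda>k. sq_int (\<lambda>x. s n x - s (r k) x) \<le> e) sequentially"
      using eventually_ge_at_top[of M] by eventually_elim (use n r(3) order_trans in blast)
    ultimately show ?thesis
      using L2_Fatou[of "\<lambda>k x. s n x - s (r k) x" "\<lambda>x. s n x - f x" e] L2_diff(1)[OF s s] by simp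
  qed
  have "f \<in> L2"
  proof -
    have "(\<lambda>x. s (N 0) x - f x) \<in> L2" using D[of 1 "N 0" "N 0"] N[of 0 "N 0"] by simp
    from L2_diff(1)[OF s[of "N 0"] this] show ?thesis by simp
  qed
  moreover have "(\<lambda>n. sq_int (\<lambda>x. s n x - f x)) \<longlonglongrightarrow> 0"
  proof (rule LIMSEQ_I)
    fix e :: real assume "e > 0"
    then obtain M where "\<forall>m\<ge>M. \<forall>n\<ge>M. sq_int (\<lambda>x. s m x - s n x) \<le> e/2"
      using c[of "e/2"] by auto
    then have "sq_int (\<lambda>x. s n x - f x) \<le> e/2" if "n \<ge> M" for n
      using D[of "e/2" M n] that \<open>e > 0\<close> by auto
    then show "\<exists>M. \<forall>n\<ge>M. norm (sq_int (\<lambda>x. s n x - f x) - 0) < e"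
      using \<open>e > 0\<close> by (intro exI[of _ M]) fastforce
  qed
  ultimately show ?thesis using s by (auto simp: L2_tendsto_iff)
qed

subsection \<open>Density of the Lipschitz functions with bounded support\<close>

abbreviation (input) "lipD \<equiv> lipschitz_bounded_support"

lemma L2_indicator_cball: "(\<lambda>x. indicator (cball 0 R) x :: real) \<in> L2"
proof (rule L2I)
  have "integrable lborel (indicator (cball (0::real^3) R) :: _ \<Rightarrow> real)"
    using emeasure_lborel_cball_finite[of "0::real^3" R] by (simp add: integrable_indicator_iff less_top)
  moreover have "(\<lambda>x. (norm (indicator (cball (0::real^3) R) x :: real))\<^sup>2) = indicator (cball 0 R)"
    by (auto simp: indicator_def)
  ultimately show "integrable lborel (\<lambda>x. (norm (indicator (cball (0::real^3) R) x :: real))\<^sup>2)" by simp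
qed (intro borel_measurable_indicator, simp)

lemma lipD_continuous: "f \<in> lipD \<Longrightarrow> continuous_on UNIV f"
  by (auto simp: lipschitz_bounded_support_def intro: lipschitz_on_continuous_on)

lemma lipD_bounds:
  assumes "f \<in> lipD"
  obtains R K M where "K \<ge> 0" "\<And>x y. norm (f x - f y) \<le> K * norm (x - y)" "R > 0"
    "\<And>x. R < norm x \<Longrightarrow> f x = 0" "M > 0" "\<And>x. norm (f x) \<le> M"
proof -
  from assms obtain K where K: "K-lipschitz_on UNIV f" and "bounded {x. f x \<noteq> 0}"
    by (auto simp: lipschitz_bounded_support_def)
  then obtain R where R: "R > 0" "{x. f x \<noteq> 0} \<subseteq> cball 0 R"
    unfolding bounded_pos by (metis mem_cball_0 subsetI)
  have out: "f x = 0" if "R < norm x" for x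
    using R that by force
  have "compact (f ` cball 0 R)"
    by (intro compact_continuous_image continuous_on_subset[OF lipD_continuous[OF assms]]) auto
  then obtain M where M: "M > 0" "\<And>x. norm x \<le> R \<Longrightarrow> norm (f x) \<le> M"
    using compact_imp_bounded[of "f ` cball 0 R"] unfolding bounded_pos by auto
  have "norm (f x) \<le> M" for x
    using M out by (cases "norm x \<le> R") auto
  moreover have "norm (f x - f y) \<le> K * norm (x - y)" for x y
    using lipschitz_onD[OF K] by (auto simp: dist_norm)
  ultimately show ?thesis using that lipschitz_on_nonneg[OF K] R(1) out M(1) by blast
qed

lemma lipD_subset_L2:
  assumes f: "f \<in> lipD"
  shows "f \<in> L2"
proof -
  obtain R M where *: "\<And>x. R < norm x \<Longrightarrow> f x = 0" "M > 0" "\<And>x. norm (f x) \<le> M"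
    using lipD_bounds[OF f] by metis
  show ?thesis
  proof (rule L2_dominated(1)[OF L2_indicator_cball[of R], where c=M])
    show "f \<in> borel_measurable borel"
      using lipD_continuous[OF f] by (rule borel_measurable_continuous_onI)
    show "AE x in lborel. norm (f x) \<le> M * norm (indicator (cball 0 R) x :: real)"
      using * by (intro AE_I2) (auto simp: indicator_def not_le)
  qed (use * in simp)
qed

lemma lipD_zero: "(\<lambda>x. 0) \<in> lipD"
  by (auto simp: lipschitz_bounded_support_def intro!: exI[of _ 0] lipschitz_onI)

lemma lipD_add:
  assumes "f \<in> lipD" "g \<in> lipD"
  shows "(\<lambda>x. f x + g x) \<in> lipD"
proof -
  from assms obtain K L where "K-lipschitz_on UNIV f" "L-lipschitz_on UNIV g"
    and b: "bounded {x. f x \<noteq> 0}" "bounded {x. g x \<noteq> 0}"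
    by (auto simp: lipschitz_bounded_support_def)
  then have "(K + L)-lipschitz_on UNIV (\<lambda>x. f x + g x)" by (intro lipschitz_on_add)
  moreover have "bounded {x. f x + g x \<noteq> 0}"
    by (rule bounded_subset[of "{x. f x \<noteq> 0} \<union> {x. g x \<noteq> 0}"]) (use b in auto)
  ultimately show ?thesis by (auto simp: lipschitz_bounded_support_def)
qed

lemma lipD_complex_scale:
  assumes "f \<in> lipD"
  shows "(\<lambda>x. c *s f x) \<in> lipD"
proof -
  from assms obtain K where K: "K-lipschitz_on UNIV f" and b: "bounded {x. f x \<noteq> 0}"
    by (auto simp: lipschitz_bounded_support_def)
  have "(cmod c * K)-lipschitz_on UNIV (\<lambda>x. c *s f x)"
  proof (rule lipschitz_onI)
    fix x y
    have "dist (c *s f x) (c *s f y) = cmod c * dist (f x) (f y)"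
      by (simp add: dist_norm norm_complex_scale flip: vector_ssub_ldistrib)
    then show "dist (c *s f x) (c *s f y) \<le> cmod c * K * dist x y"
      using mult_left_mono[OF lipschitz_onD[OF K, of x y], of "cmod c"] by (simp add: mult.assoc)
  qed (use lipschitz_on_nonneg[OF K] in simp)
  moreover have "bounded {x. c *s f x \<noteq> 0}"
    by (rule bounded_subset[OF b]) auto
  ultimately show ?thesis by (auto simp: lipschitz_bounded_support_def)
qed

text \<open>The closure of the Lipschitz functions in L^2. It is stable under limits and linear
  combinations, which is what an induction over Borel sets asks for; in the end it is all of
  L^2.\<close>

definition lip_closure :: "(real^3 \<Rightarrow> cquat) set" where
  "lip_closure = {f \<in> L2. \<forall>e>0. \<exists>g\<in>lipD. sq_int (\<lambda>x. f x - g x) < e}"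

lemma lip_closureI_tendsto:
  assumes "L2_tendsto s f" "\<And>n. s n \<in> lip_closure"
  shows "f \<in> lip_closure"
proof -
  note S = L2_tendstoD[OF assms(1)]
  have "\<exists>g\<in>lipD. sq_int (\<lambda>x. f x - g x) < e" if "e > 0" for e
  proof -
    from order_tendstoD(2)[OF S(3), of "e/4"] that obtain n where n: "sq_int (\<lambda>x. s n x - f x) < e/4"
      by (auto simp: eventually_sequentially)
    from assms(2)[of n] that obtain g where g: "g \<in> lipD" "sq_int (\<lambda>x. s n x - g x) < e/4"
      by (auto simp: lip_closure_def dest!: spec[of _ "e/4"])
    have "sq_int (\<lambda>x. f x - g x) \<le> 2 * sq_int (\<lambda>x. f x - s n x) + 2 * sq_int (\<lambda>x. s n x - g x)"
      by (rule sq_int_triangle[OF S(2,1) lipD_subset_L2[OF g(1)]])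
    with n g show ?thesis by (intro bexI[of _ g]) (auto simp: sq_int_commute[of f "s n"])
  qed
  then show ?thesis using S by (auto simp: lip_closure_def)
qed

lemma lipD_lip_closure: "f \<in> lipD \<Longrightarrow> f \<in> lip_closure"
  by (auto simp: lip_closure_def lipD_subset_L2 sq_int_def intro!: bexI[of _ f])

lemma lip_closure_L2: "f \<in> lip_closure \<Longrightarrow> f \<in> L2"
  by (simp add: lip_closure_def)

lemma lip_closure_tendsto:
  assumes "f \<in> lip_closure"
  obtains s where "\<And>n. s n \<in> lipD" "L2_tendsto s f"
proof -
  have "\<exists>s. \<forall>n. s n \<in> lipD \<and> sq_int (\<lambda>x. f x - s n x) < inverse (real (Suc n))"
    using assms by (intro choice) (auto simp: lip_closure_def Bex_def)
  then obtain s where s: "\<And>n. s n \<in> lipD" "\<And>n. sq_int (\<lambda>x. f x - s n x) < inverse (real (Suc n))" by blast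
  have "L2_tendsto s f"
    by (rule L2_tendsto_bound[where b="\<lambda>n. inverse (real (Suc n))"])
       (use s lipD_subset_L2 lip_closure_L2[OF assms] LIMSEQ_inverse_real_of_nat in
         \<open>auto simp: sq_int_commute[of _ f] less_imp_le\<close>)
  with s show ?thesis by (intro that)
qed

lemma lip_closure_add:
  assumes "f \<in> lip_closure" "g \<in> lip_closure"
  shows "(\<lambda>x. f x + g x) \<in> lip_closure"
proof -
  obtain s t where st: "\<And>n. s n \<in> lipD" "L2_tendsto s f" "\<And>n. t n \<in> lipD" "L2_tendsto t g"
    using assms by (metis lip_closure_tendsto)
  show ?thesis
    by (rule lip_closureI_tendsto[OF L2_tendsto_add[OF st(2,4)]]) (intro lipD_lip_closure lipD_add st)
qed

lemma lip_closure_complex_scale: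
  assumes "f \<in> lip_closure"
  shows "(\<lambda>x. c *s f x) \<in> lip_closure"
proof -
  obtain s where s: "\<And>n. s n \<in> lipD" "L2_tendsto s f"
    using assms by (metis lip_closure_tendsto)
  show ?thesis
    by (rule lip_closureI_tendsto[OF L2_tendsto_complex_scale[OF s(2)]]) (intro lipD_lip_closure lipD_complex_scale s)
qed

lemma lip_closure_diff: "f \<in> lip_closure \<Longrightarrow> g \<in> lip_closure \<Longrightarrow> (\<lambda>x. f x - g x) \<in> lip_closure"
  using lip_closure_add[OF _ lip_closure_complex_scale[of g "-1"], of f] by simp

lemma lip_closure_sum:
  "finite I \<Longrightarrow> (\<And>i. i \<in> I \<Longrightarrow> f i \<in> lip_closure) \<Longrightarrow> (\<lambda>x. \<Sum>i\<in>I. f i x) \<in> lip_closure"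
  by (induction I rule: finite_induct)
     (auto intro: lip_closure_add lipD_lip_closure lipD_zero)

text \<open>The Lipschitz functions min(1, n d(x, -U)) increase to the indicator of U, because the
  distance to the closed complement is positive exactly on U. Boundedness of U supplies the bounded
  support and the dominating function.\<close>

lemma lip_closure_open:
  assumes U: "open U" "U \<subseteq> cball 0 R"
  shows "(\<lambda>x. indicator U x *\<^sub>R c) \<in> lip_closure"
proof (rule lip_closureI_tendsto)
  define g where "g n x = min 1 (real n * infdist x (- U)) *\<^sub>R c" for n :: nat and x :: "real^3"
  \<comment> \<open>For an empty complement \<open>infdist\<close> would be 0 by convention and the
    approximation would collapse.\<close>
  have ne: "- U \<noteq> {}"
    using U(2) bounded_subset[OF bounded_cball, of U 0 R] by (metis Compl_empty_eq double_complement not_bounded_UNIV)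
  have z: "infdist x (- U) = 0 \<longleftrightarrow> x \<notin> U" for x
    using U(1) ne in_closed_iff_infdist_zero[of "- U" x] by (auto simp: closed_Compl)
  have lip: "(real n * norm c)-lipschitz_on UNIV (g n)" for n
  proof (rule lipschitz_onI)
    fix x y :: "real^3"
    have "\<bar>min 1 (real n * infdist x (- U)) - min 1 (real n * infdist y (- U))\<bar>
        \<le> \<bar>real n * infdist x (- U) - real n * infdist y (- U)\<bar>" by linarith
    also have "\<dots> = real n * \<bar>infdist x (- U) - infdist y (- U)\<bar>"
      by (metis abs_mult abs_of_nat right_diff_distrib)
    also have "\<dots> \<le> real n * dist x y"
      by (intro mult_left_mono infdist_triangle_abs) simp
    finally have "\<bar>min 1 (real n * infdist x (- U)) - min 1 (real n * infdist y (- U))\<bar> * norm c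
        \<le> real n * dist x y * norm c" by (rule mult_right_mono) simp
    moreover have "dist (g n x) (g n y) = \<bar>min 1 (real n * infdist x (- U)) - min 1 (real n * infdist y (- U))\<bar> * norm c"
      unfolding g_def dist_norm scaleR_diff_left[symmetric] by simp
    ultimately show "dist (g n x) (g n y) \<le> real n * norm c * dist x y"
      by (simp add: mult_ac)
  qed simp
  have "bounded {x. g n x \<noteq> 0}" for n
    by (rule bounded_subset[OF bounded_cball[of 0 R]]) (use U z in \<open>force simp: g_def\<close>)
  with lip have D: "g n \<in> lipD" for n by (auto simp: lipschitz_bounded_support_def)
  then show "g n \<in> lip_closure" for n by (rule lipD_lip_closure)
  have lim: "(\<lambda>n. g n x) \<longlonglongrightarrow> indicator U x *\<^sub>R c" for x
  proof (cases "x \<in> U")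
    case True
    then have "infdist x (- U) > 0" using z[of x] infdist_nonneg[of x "- U"] by linarith
    then obtain N :: nat where N: "real N * infdist x (- U) > 1" using reals_Archimedean3 by blast
    have "eventually (\<lambda>n. g n x = c) sequentially"
      using eventually_ge_at_top[of N]
    proof eventually_elim
      fix n assume "N \<le> n"
      then have "real N * infdist x (- U) \<le> real n * infdist x (- U)"
        by (intro mult_right_mono infdist_nonneg) simp
      with N show "g n x = c" by (simp add: g_def)
    qed
    with True show ?thesis by (simp add: tendsto_eventually)
  next
    case False
    then have "g n x = 0" for n by (simp add: g_def z)
    then show ?thesis using False by simp
  qed
  show "L2_tendsto g (\<lambda>x. indicator U x *\<^sub>R c)"
  proof (rule L2_tendsto_dominated[OF L2_indicator_cball[of R], of "norm c"])
    have [measurable]: "U \<in> sets borel" using U by simp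
    show "(\<lambda>x. indicator U x *\<^sub>R c) \<in> borel_measurable borel" by measurable
    show "g n \<in> borel_measurable borel" for n
      using lipD_continuous[OF D] by (rule borel_measurable_continuous_onI)
    show "AE x in lborel. (\<lambda>n. g n x) \<longlonglongrightarrow> indicator U x *\<^sub>R c" using lim by simp
    show "AE x in lborel. norm (g n x) \<le> norm c * norm (indicator (cball 0 R) x :: real)" for n
    proof (rule AE_I2)
      fix x
      show "norm (g n x) \<le> norm c * norm (indicator (cball 0 R) x :: real)"
      proof (cases "x \<in> U")
        case True
        moreover have "\<bar>min 1 (real n * infdist x (- U))\<bar> \<le> 1"
          using infdist_nonneg[of x "- U"] by (simp add: min_def)
        ultimately show ?thesis using U by (auto simp: g_def indicator_def mult_left_le_one_le)
      next
        case False
        then show ?thesis using z[of x] by (simp add: g_def)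
      qed
    qed
  qed simp
qed

text \<open>Dynkin's argument: the open sets are stable under intersection and generate the Borel
  sets. Intersecting with a fixed ball keeps all measures finite, so that complements become
  differences inside the ball and disjoint unions are dominated limits of partial sums.\<close>

lemma lip_closure_borel:
  assumes "A \<in> sets (borel :: (real^3) measure)"
  shows "(\<lambda>x. indicator (A \<inter> ball 0 R) x *\<^sub>R c) \<in> lip_closure"
proof -
  have "Int_stable {S :: (real^3) set. open S}" "{S :: (real^3) set. open S} \<subseteq> Pow UNIV"
    "A \<in> sigma_sets UNIV {S. open S}" using assms by (auto simp: Int_stable_def borel_def)
  then show ?thesis
  proof (induction rule: sigma_sets_induct_disjoint)
    case (basic A)
    then show ?case by (intro lip_closure_open[where R=R]) auto
  next
    case empty
    then show ?case by (simp add: lipD_lip_closure lipD_zero)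
  next
    case (compl A)
    have "(\<lambda>x. indicator (ball 0 R) x *\<^sub>R c - indicator (A \<inter> ball 0 R) x *\<^sub>R c) \<in> lip_closure"
      by (intro lip_closure_diff compl.IH lip_closure_open[where R=R]) auto
    also have "(\<lambda>x. indicator (ball 0 R) x *\<^sub>R c - indicator (A \<inter> ball 0 R) x *\<^sub>R c)
        = (\<lambda>x. indicator ((UNIV - A) \<inter> ball 0 R) x *\<^sub>R c)"
      by (auto simp: indicator_def)
    finally show ?case .
  next
    case (union A)
    have [measurable]: "A i \<in> sets borel" for i using union(2) by (auto simp: borel_def)
    show ?case
    proof (rule lip_closureI_tendsto)
      show "(\<lambda>x. \<Sum>i<n. indicator (A i \<inter> ball 0 R) x *\<^sub>R c) \<in> lip_closure" for n
        using union by (intro lip_closure_sum) auto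
      have s: "(\<lambda>i. indicator (A i \<inter> ball 0 R) x :: real) sums indicator (\<Union>(range A) \<inter> ball 0 R) x" for x
      proof -
        have "disjoint_family (\<lambda>i. A i \<inter> ball 0 R)"
          using union(1) by (auto simp: disjoint_family_on_def)
        from indicator_sums[of "\<lambda>i. A i \<inter> ball 0 R" x] this show ?thesis
          by (auto simp: disjoint_family_on_def)
      qed
      have eq: "(\<Sum>i<n. indicator (A i \<inter> ball 0 R) x *\<^sub>R c) = (\<Sum>i<n. indicator (A i \<inter> ball 0 R) x :: real) *\<^sub>R c" for n x
        by (simp add: scaleR_sum_left)
      show "L2_tendsto (\<lambda>n x. \<Sum>i<n. indicator (A i \<inter> ball 0 R) x *\<^sub>R c)
          (\<lambda>x. indicator (\<Union> (range A) \<inter> ball 0 R) x *\<^sub>R c)"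
      proof (rule L2_tendsto_dominated[OF L2_indicator_cball[of R], of "norm c"])
        show "AE x in lborel. (\<lambda>n. \<Sum>i<n. indicator (A i \<inter> ball 0 R) x *\<^sub>R c)
            \<longlonglongrightarrow> indicator (\<Union> (range A) \<inter> ball 0 R) x *\<^sub>R c"
          unfolding eq using s by (intro AE_I2 tendsto_intros) (simp add: sums_def)
        show "AE x in lborel. norm (\<Sum>i<n. indicator (A i \<inter> ball 0 R) x *\<^sub>R c)
            \<le> norm c * norm (indicator (cball 0 R) x :: real)" for n
        proof (rule AE_I2)
          fix x
          have "(\<Sum>i<n. indicator (A i \<inter> ball 0 R) x :: real) \<le> indicator (\<Union> (range A) \<inter> ball 0 R) x"
            using sum_le_suminf[OF sums_summable[OF s], of "{..<n}" x] sums_unique[OF s[of x]] by simp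
          also have "\<dots> \<le> indicator (cball 0 R) x" by (auto simp: indicator_def)
          finally have "(\<Sum>i<n. indicator (A i \<inter> ball 0 R) x :: real) \<le> indicator (cball 0 R) x" .
          moreover have "0 \<le> (\<Sum>i<n. indicator (A i \<inter> ball 0 R) x :: real)" by (intro sum_nonneg) auto
          ultimately show "norm (\<Sum>i<n. indicator (A i \<inter> ball 0 R) x *\<^sub>R c)
              \<le> norm c * norm (indicator (cball 0 R) x :: real)"
            unfolding eq by (simp add: mult.commute mult_left_mono)
        qed
        have B: "ball 0 R \<in> sets borel" by simp
        have "(\<Union>i. A i) \<inter> ball 0 R \<in> sets borel"
          by (intro sets.Int B sets.countable_UN) auto
        then show "(\<lambda>x. indicator (\<Union> (range A) \<inter> ball 0 R) x *\<^sub>R c) \<in> borel_measurable borel"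
          by (intro borel_measurable_scaleR borel_measurable_indicator) simp_all
        have "A i \<inter> ball 0 R \<in> sets borel" for i
          by (intro sets.Int B) simp
        then show "(\<lambda>x. \<Sum>i<n. indicator (A i \<inter> ball 0 R) x *\<^sub>R c) \<in> borel_measurable borel" for n
          by (intro borel_measurable_sum borel_measurable_scaleR borel_measurable_indicator) simp_all
      qed simp
    qed
  qed
qed

text \<open>A measurable f is a pointwise limit of simple functions bounded by 2|f|. Cutting the
  n-th one off to the ball of radius n makes it a finite combination of the indicators already
  treated and keeps 2|f| as dominating function.\<close>

lemma L2_imp_lip_closure:
  assumes "f \<in> L2"
  shows "f \<in> lip_closure"
proof -
  have [measurable]: "f \<in> borel_measurable borel" using assms by simp
  obtain F where F: "\<And>i. simple_function lborel (F i)" "\<And>x. (\<lambda>i. F i x) \<longlonglongrightarrow> f x"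
    "\<And>i x. norm (F i x) \<le> 2 * norm (f x)"
    using borel_measurable_implies_sequence_metric[of f lborel 0] by auto
  have mF: "F i \<in> borel_measurable borel" for i
    using borel_measurable_simple_function[OF F(1)[of i]] by simp
  show ?thesis
  proof (rule lip_closureI_tendsto)
    show "(\<lambda>x. indicator (ball 0 (real n)) x *\<^sub>R F n x) \<in> lip_closure" for n
    proof -
      have fin: "finite (range (F n))" using F(1)[of n] by (simp add: simple_function_def)
      have "(\<lambda>x. \<Sum>c\<in>range (F n). indicator (F n -` {c} \<inter> ball 0 (real n)) x *\<^sub>R c) \<in> lip_closure"
      proof (intro lip_closure_sum fin lip_closure_borel)
        show "F n -` {c} \<in> sets borel" for c
          using measurable_sets[OF mF[of n], of "{c}"] by simp
      qed
      also have "(\<lambda>x. \<Sum>c\<in>range (F n). indicator (F n -` {c} \<inter> ball 0 (real n)) x *\<^sub>R c)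
          = (\<lambda>x. indicator (ball 0 (real n)) x *\<^sub>R F n x)"
      proof
        fix x
        have "(\<Sum>c\<in>range (F n). indicator (F n -` {c} \<inter> ball 0 (real n)) x *\<^sub>R c)
            = (\<Sum>c\<in>range (F n). if c = F n x then indicator (ball 0 (real n)) x *\<^sub>R c else 0)"
          by (intro sum.cong) (auto simp: indicator_def)
        then show "(\<Sum>c\<in>range (F n). indicator (F n -` {c} \<inter> ball 0 (real n)) x *\<^sub>R c)
            = indicator (ball 0 (real n)) x *\<^sub>R F n x"
          using fin by simp
      qed
      finally show ?thesis .
    qed
    show "L2_tendsto (\<lambda>n x. indicator (ball 0 (real n)) x *\<^sub>R F n x) f"
    proof (rule L2_tendsto_dominated[OF assms, of 2])
      show "AE x in lborel. (\<lambda>n. indicator (ball 0 (real n)) x *\<^sub>R F n x) \<longlonglongrightarrow> f x"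
      proof (rule AE_I2)
        fix x :: "real^3"
        obtain N :: nat where N: "norm x < real N" using reals_Archimedean2 by blast
        have "eventually (\<lambda>n. F n x = indicator (ball 0 (real n)) x *\<^sub>R F n x) sequentially"
          using eventually_ge_at_top[of N] by eventually_elim (use N in \<open>auto simp: indicator_def\<close>)
        then show "(\<lambda>n. indicator (ball 0 (real n)) x *\<^sub>R F n x) \<longlonglongrightarrow> f x"
          using F(2)[of x] by (rule Lim_transform_eventually[rotated])
      qed
      show "AE x in lborel. norm (indicator (ball 0 (real n)) x *\<^sub>R F n x) \<le> 2 * norm (f x)" for n
        using F(3)[of n] by (auto simp: indicator_def)
      show "(\<lambda>x. indicator (ball 0 (real n)) x *\<^sub>R F n x) \<in> borel_measurable borel" for n
        by (intro borel_measurable_scaleR borel_measurable_indicator mF) simp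
    qed simp_all
  qed
qed

lemma lipschitz_dense:
  assumes "f \<in> L2"
  obtains s where "\<And>n. s n \<in> lipD" "L2_tendsto s f"
  by (rule lip_closure_tendsto[OF L2_imp_lip_closure[OF assms]]) (rule that)

section \<open>The Fourier integral\<close>

text \<open>In this form the simplifier sees that the phase has modulus one.\<close>

lemma fourier_integral_cis:
  "fourier_integral f \<xi> = (LINT x|lborel. cis (- (2 * pi * (x \<bullet> \<xi>))) *s f x)"
  by (simp add: fourier_integral_def cis_conv_exp)

lemma norm_cis_scale [simp]: "norm (cis t *s (v::cquat)) = norm v"
  by (simp add: norm_complex_scale)

lemma borel_measurable_cis [measurable (raw)]:
  "f \<in> borel_measurable M \<Longrightarrow> (\<lambda>x. cis (f x)) \<in> borel_measurable M"
  by (rule borel_measurable_continuous_on[where f=cis]) (auto intro!: continuous_intros)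

lemma cis_scale_cis_scale: "cis a *s (cis b *s (v::cquat)) = cis (a + b) *s v"
  by (simp add: cis_mult)

lemma integrable_cis_scale:
  fixes f :: "real^3 \<Rightarrow> cquat"
  assumes "integrable lborel f"
  shows "integrable lborel (\<lambda>x. cis (t * (x \<bullet> \<xi>)) *s f x)"
proof -
  have [measurable]: "f \<in> borel_measurable borel" using assms by auto
  show ?thesis
    by (rule Bochner_Integration.integrable_bound[OF assms]) auto
qed

lemma integrable_fourier:
  fixes f :: "real^3 \<Rightarrow> cquat"
  assumes "integrable lborel f"
  shows "integrable lborel (\<lambda>x. cis (- (2 * pi * (x \<bullet> \<xi>))) *s f x)"
  using integrable_cis_scale[OF assms, of "- (2 * pi)" \<xi>] by simp

lemma norm_fourier_integral_le: "norm (fourier_integral f \<xi>) \<le> (LINT x|lborel. norm (f x))"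
  unfolding fourier_integral_cis
  by (rule order_trans[OF integral_norm_bound]) simp

lemma borel_measurable_fourier_integral [measurable]:
  assumes [measurable]: "f \<in> borel_measurable borel"
  shows "fourier_integral f \<in> borel_measurable borel"
  unfolding fourier_integral_cis[abs_def] by measurable

lemma fourier_integral_add:
  assumes "integrable lborel f" "integrable lborel g"
  shows "fourier_integral (\<lambda>x. f x + g x) \<xi> = fourier_integral f \<xi> + fourier_integral g \<xi>"
  unfolding fourier_integral_cis
  using integrable_fourier[OF assms(1)] integrable_fourier[OF assms(2)]
  by (simp add: vector_add_ldistrib)

lemma fourier_integral_complex_scale:
  assumes "integrable lborel f"
  shows "fourier_integral (\<lambda>x. c *s f x) \<xi> = c *s fourier_integral f \<xi>"
proof -
  have "fourier_integral (\<lambda>x. c *s f x) \<xi> = (LINT x|lborel. c *s (cis (- (2 * pi * (x \<bullet> \<xi>))) *s f x))"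
    unfolding fourier_integral_cis by (simp add: mult.commute)
  also have "\<dots> = c *s fourier_integral f \<xi>"
    unfolding fourier_integral_cis
    by (rule integral_bounded_linear[OF bounded_bilinear.bounded_linear_right[OF bounded_bilinear_complex_scale]])
       (rule integrable_fourier[OF assms])
  finally show ?thesis .
qed

section \<open>Exchange of integrals: duality and the convolution formula\<close>

lemma integrable_lborel_product:
  fixes f :: "'a::euclidean_space \<Rightarrow> real" and g :: "'b::euclidean_space \<Rightarrow> real"
  assumes f: "integrable lborel f" and g: "integrable lborel g"
  shows "integrable (lborel \<Otimes>\<^sub>M lborel) (\<lambda>(x, y). f x * g y)"
proof -
  have [measurable]: "f \<in> borel_measurable borel" "g \<in> borel_measurable borel" using assms by auto
  show ?thesis
  proof (rule lborel_pair.Fubini_integrable)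
    show "integrable lborel (\<lambda>x. LINT y|lborel. norm (case (x, y) of (x, y) \<Rightarrow> f x * g y))"
      using f by (simp add: abs_mult)
    show "AE x in lborel. integrable lborel (\<lambda>y. case (x, y) of (x, y) \<Rightarrow> f x * g y)"
      using g by simp
  qed simp
qed

text \<open>A bound by a product of two integrable functions gives joint integrability; the phases
  have modulus one, so kernels of Fourier type admit such a bound.\<close>

lemma Fubini_bounded:
  fixes h :: "'a::euclidean_space \<Rightarrow> 'b::euclidean_space \<Rightarrow> 'c::{banach, second_countable_topology}"
  assumes f: "integrable lborel f" and g: "integrable lborel g"
    and h: "(\<lambda>(x, y). h x y) \<in> borel_measurable (lborel \<Otimes>\<^sub>M lborel)"
    and b: "\<And>x y. norm (h x y) \<le> f x * g y"
  shows "(LINT x|lborel. LINT y|lborel. h x y) = (LINT y|lborel. LINT x|lborel. h x y)"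
    and "integrable lborel (\<lambda>x. LINT y|lborel. h x y)"
proof -
  have i: "integrable (lborel \<Otimes>\<^sub>M lborel) (\<lambda>(x, y). h x y)"
    by (rule Bochner_Integration.integrable_bound[OF integrable_lborel_product[OF f g] h])
       (use b in \<open>auto intro!: AE_I2 intro: order_trans[OF _ abs_ge_self]\<close>)
  show "(LINT x|lborel. LINT y|lborel. h x y) = (LINT y|lborel. LINT x|lborel. h x y)"
    using lborel_pair.Fubini_integral[OF i] by simp
  show "integrable lborel (\<lambda>x. LINT y|lborel. h x y)"
    using lborel_pair.integrable_fst'[OF i] by simp
qed

text \<open>Fubini. Moving the phase across the real inner product conjugates it, whence the
  reflected argument on the right.\<close>

lemma fourier_integral_adjoint:
  assumes f: "integrable lborel f" and h: "integrable lborel h"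
  shows "(LINT \<xi>|lborel. fourier_integral f \<xi> \<bullet> h \<xi>) = (LINT x|lborel. f x \<bullet> fourier_integral h (- x))"
proof -
  have [measurable]: "f \<in> borel_measurable borel" "h \<in> borel_measurable borel" using assms by auto
  have "(LINT \<xi>|lborel. fourier_integral f \<xi> \<bullet> h \<xi>)
      = (LINT \<xi>|lborel. LINT x|lborel. (cis (- (2 * pi * (x \<bullet> \<xi>))) *s f x) \<bullet> h \<xi>)"
    unfolding fourier_integral_cis by (simp add: integrable_fourier[OF f])
  also have "\<dots> = (LINT x|lborel. LINT \<xi>|lborel. (cis (- (2 * pi * (x \<bullet> \<xi>))) *s f x) \<bullet> h \<xi>)"
  proof (rule Fubini_bounded(1)[OF integrable_norm[OF h] integrable_norm[OF f]])
    show "norm ((cis (- (2 * pi * (x \<bullet> \<xi>))) *s f x) \<bullet> h \<xi>) \<le> norm (h \<xi>) * norm (f x)" for x \<xi>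
      using Cauchy_Schwarz_ineq2[of "cis (- (2 * pi * (x \<bullet> \<xi>))) *s f x" "h \<xi>"] by (simp add: mult.commute)
  qed measurable
  also have "\<dots> = (LINT x|lborel. f x \<bullet> fourier_integral h (- x))"
  proof (rule Bochner_Integration.integral_cong[OF refl])
    fix x
    have "(LINT \<xi>|lborel. (cis (- (2 * pi * (x \<bullet> \<xi>))) *s f x) \<bullet> h \<xi>)
        = (LINT \<xi>|lborel. f x \<bullet> (cis (- (2 * pi * (\<xi> \<bullet> - x))) *s h \<xi>))"
      by (simp add: inner_complex_scale cis_cnj inner_commute[of x])
    also have "\<dots> = f x \<bullet> fourier_integral h (- x)"
      unfolding fourier_integral_cis by (rule integral_inner_right) (use integrable_fourier[OF h] in blast)
    finally show "(LINT \<xi>|lborel. (cis (- (2 * pi * (x \<bullet> \<xi>))) *s f x) \<bullet> h \<xi>) = f x \<bullet> fourier_integral h (- x)" .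
  qed
  finally show ?thesis .
qed

text \<open>\<open>fourier_integral f (- \<xi>)\<close> is the inverse transform of f, so the left
  side is the operator with multiplier m, and the two phases combine into the phase at x - y. The
  quaternionic factor m stays on the left throughout.\<close>

lemma fourier_integral_multiplier:
  assumes m: "integrable lborel m" and f: "integrable lborel f"
  shows "fourier_integral (\<lambda>\<xi>. m \<xi> \<odot> fourier_integral f (- \<xi>)) x
      = (LINT y|lborel. fourier_integral m (x - y) \<odot> f y)"
    and "integrable lborel (\<lambda>\<xi>. m \<xi> \<odot> fourier_integral f (- \<xi>))"
proof -
  have [measurable]: "f \<in> borel_measurable borel" "m \<in> borel_measurable borel" using assms by auto
  \<comment> \<open>The quaternionic product is bounded with some constant K with respect to the
    Euclidean norm; its value does not matter for integrability.\<close>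
  obtain K where K: "K > 0" "\<And>p q. norm (p \<odot> q) \<le> norm p * norm q * K"
    using bounded_bilinear.pos_bounded[OF bounded_bilinear_cq_mult] by blast
  have "fourier_integral (\<lambda>\<xi>. m \<xi> \<odot> fourier_integral f (- \<xi>)) x
      = (LINT \<xi>|lborel. LINT y|lborel. cis (- (2 * pi * (\<xi> \<bullet> (x - y)))) *s (m \<xi> \<odot> f y))"
    unfolding fourier_integral_cis[of _ x]
  proof (rule Bochner_Integration.integral_cong[OF refl])
    fix \<xi>
    have "cis (- (2 * pi * (\<xi> \<bullet> x))) *s (m \<xi> \<odot> fourier_integral f (- \<xi>))
        = (LINT y|lborel. (cis (- (2 * pi * (\<xi> \<bullet> x))) *s m \<xi>) \<odot> (cis (- (2 * pi * (y \<bullet> - \<xi>))) *s f y))"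
      unfolding fourier_integral_cis cq_mult_bilinear(3)[symmetric]
      by (rule integral_bounded_linear[OF bounded_bilinear.bounded_linear_right[OF bounded_bilinear_cq_mult], symmetric])
         (rule integrable_fourier[OF f])
    then show "cis (- (2 * pi * (\<xi> \<bullet> x))) *s (m \<xi> \<odot> fourier_integral f (- \<xi>))
        = (LINT y|lborel. cis (- (2 * pi * (\<xi> \<bullet> (x - y)))) *s (m \<xi> \<odot> f y))"
      by (simp only: cq_mult_bilinear cis_scale_cis_scale)
         (simp add: inner_diff_right inner_commute algebra_simps)
  qed
  also have "\<dots> = (LINT y|lborel. LINT \<xi>|lborel. cis (- (2 * pi * (\<xi> \<bullet> (x - y)))) *s (m \<xi> \<odot> f y))"
  proof (rule Fubini_bounded(1)[OF integrable_norm[OF m]])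
    show "integrable lborel (\<lambda>y. norm (f y) * K)" using f by simp
    show "norm (cis (- (2 * pi * (\<xi> \<bullet> (x - y)))) *s (m \<xi> \<odot> f y)) \<le> norm (m \<xi>) * (norm (f y) * K)" for \<xi> y
      using K(2)[of "m \<xi>" "f y"] by (simp add: mult.assoc)
  qed measurable
  also have "\<dots> = (LINT y|lborel. fourier_integral m (x - y) \<odot> f y)"
    unfolding fourier_integral_cis cq_mult_bilinear(3)[symmetric]
    by (intro Bochner_Integration.integral_cong[OF refl]
        integral_bounded_linear[OF bounded_bilinear.bounded_linear_left[OF bounded_bilinear_cq_mult]]
        integrable_fourier[OF m])
  finally show "fourier_integral (\<lambda>\<xi>. m \<xi> \<odot> fourier_integral f (- \<xi>)) x
      = (LINT y|lborel. fourier_integral m (x - y) \<odot> f y)" .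
  show "integrable lborel (\<lambda>\<xi>. m \<xi> \<odot> fourier_integral f (- \<xi>))"
  proof (rule Bochner_Integration.integrable_bound)
    show "integrable lborel (\<lambda>\<xi>. norm (m \<xi>) * (LINT x|lborel. norm (f x)) * K)"
      using m by simp
    show "AE \<xi> in lborel. norm (m \<xi> \<odot> fourier_integral f (- \<xi>))
        \<le> norm (norm (m \<xi>) * (LINT x|lborel. norm (f x)) * K)"
    proof (rule AE_I2)
      fix \<xi>
      have "norm (m \<xi> \<odot> fourier_integral f (- \<xi>)) \<le> norm (m \<xi>) * norm (fourier_integral f (- \<xi>)) * K"
        by (rule K(2))
      also have "\<dots> \<le> norm (m \<xi>) * (LINT x|lborel. norm (f x)) * K"
        using K(1) by (intro mult_mono norm_fourier_integral_le) auto
      finally show "norm (m \<xi> \<odot> fourier_integral f (- \<xi>)) \<le> norm (norm (m \<xi>) * (LINT x|lborel. norm (f x)) * K)"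
        by (simp add: abs_if)
    qed
  qed measurable
qed

section \<open>Reflections and translations\<close>

lemma lborel_integral_uminus:
  fixes f :: "'a::euclidean_space \<Rightarrow> 'b::{banach, second_countable_topology}"
  shows "integrable lborel (\<lambda>x. f (- x)) \<longleftrightarrow> integrable lborel f" "(LINT x|lborel. f (- x)) = (LINT x|lborel. f x)"
proof -
  have d: "distr lborel borel uminus = (lborel :: 'a measure)"
    using lborel_affine[of "-1" "0::'a"] by (simp add: density_1)
  have *: "integrable lborel (\<lambda>x. g (- x))" if "integrable lborel g" for g :: "'a \<Rightarrow> 'b"
  proof -
    have "integrable (distr lborel borel uminus) g" unfolding d by (rule that)
    then show ?thesis by (intro integrable_distr[of uminus lborel borel]) simp_all
  qed
  show "integrable lborel (\<lambda>x. f (- x)) \<longleftrightarrow> integrable lborel f"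
    using *[of f] *[of "\<lambda>x. f (- x)"] by auto
  show "(LINT x|lborel. f (- x)) = (LINT x|lborel. f x)"
  proof (cases "f \<in> borel_measurable borel")
    case True
    then show ?thesis by (subst d[symmetric]) (simp add: integral_distr)
  next
    case False
    \<comment> \<open>Without measurability neither function is integrable, and both integrals have
      the default value 0.\<close>
    then have "\<not> integrable lborel f" by auto
    moreover from this have "\<not> integrable lborel (\<lambda>x. f (- x))" using *[of "\<lambda>x. f (- x)"] by auto
    ultimately show ?thesis by (simp add: not_integrable_integral_eq)
  qed
qed

lemma AE_uminus:
  fixes P :: "real^3 \<Rightarrow> bool"
  assumes "AE x in lborel. P x"
  shows "AE x in lborel. P (- x)"
proof -
  have d: "distr lborel borel uminus = (lborel :: (real^3) measure)"
    using lborel_affine[of "-1" "0::real^3"] by (simp add: density_1)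
  have "AE x in distr lborel borel uminus. P x" unfolding d by (rule assms)
  then show ?thesis by (rule AE_distrD[rotated]) simp
qed

lemma lborel_integral_translate:
  fixes f :: "'a::euclidean_space \<Rightarrow> 'b::{banach, second_countable_topology}"
  assumes [measurable]: "f \<in> borel_measurable borel"
  shows "(LINT y|lborel. f (x - y)) = (LINT y|lborel. f y)"
    "integrable lborel (\<lambda>y. f (x - y)) \<longleftrightarrow> integrable lborel f"
proof -
  have d: "distr lborel borel (\<lambda>y. x - y) = (lborel :: 'a measure)"
    using lborel_affine[of "-1" x] by (simp add: density_1)
  show "(LINT y|lborel. f (x - y)) = (LINT y|lborel. f y)"
    by (subst (2) d[symmetric]) (simp add: integral_distr)
  show "integrable lborel (\<lambda>y. f (x - y)) \<longleftrightarrow> integrable lborel f"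
    by (subst (2) d[symmetric]) (simp add: integrable_distr_eq)
qed

lemma fourier_integral_uminus: "fourier_integral (\<lambda>x. f (- x)) \<xi> = fourier_integral f (- \<xi>)"
  unfolding fourier_integral_cis
  using lborel_integral_uminus(2)[of "\<lambda>x. cis (- (2 * pi * (x \<bullet> - \<xi>))) *s f x"] by simp

subsection \<open>Gaussians\<close>

text \<open>A rescaling of the characteristic function of the standard normal distribution.\<close>

lemma gaussian_fourier_real:
  fixes s t :: real
  assumes s: "s > 0"
  shows "has_bochner_integral lborel (\<lambda>u. cis (- (2 * pi * t * u)) * exp (- pi * s\<^sup>2 * u\<^sup>2))
     (complex_of_real (exp (- pi * t\<^sup>2 / s\<^sup>2) / s))"
proof -
  \<comment> \<open>The substitution x = cu turns exp(-x^2/2) into exp(-\<pi>s^2 u^2), and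
    \<open>\<tau>\<close> is chosen such that \<tau>x becomes -2\<pi>tu.\<close>
  define c where "c = sqrt (2 * pi) * s"
  define \<tau> where "\<tau> = - (2 * pi * t) / c"
  have c: "c > 0" "c\<^sup>2 = 2 * pi * s\<^sup>2" using s by (simp_all add: c_def power_mult_distrib)
  have \<tau>: "\<tau>\<^sup>2 / 2 = pi * t\<^sup>2 / s\<^sup>2"
    using s by (simp add: \<tau>_def power_divide c(2) power_mult_distrib) (simp add: power2_eq_square field_simps)
  have i0: "integrable lborel (\<lambda>x. complex_of_real (std_normal_density x) * cis (\<tau> * x))"
  proof (rule Bochner_Integration.integrable_bound)
    show "integrable lborel std_normal_density"
      using integrable_std_normal_moment[of 0] by simp
  qed (auto simp: norm_mult)
  have "(LINT x|lborel. complex_of_real (std_normal_density x) * cis (\<tau> * x)) = char std_normal_distribution \<tau>"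
    unfolding char_def by (subst integral_density) (auto simp: normal_density_nonneg cis_conv_exp scaleR_conv_of_real)
  also have "\<dots> = complex_of_real (exp (- pi * t\<^sup>2 / s\<^sup>2))"
    unfolding char_std_normal_distribution using \<tau> by simp
  finally have v0: "(LINT x|lborel. complex_of_real (std_normal_density x) * cis (\<tau> * x)) = complex_of_real (exp (- pi * t\<^sup>2 / s\<^sup>2))" .
  have eq: "complex_of_real (std_normal_density (0 + c * u)) * cis (\<tau> * (0 + c * u))
      = complex_of_real (1 / sqrt (2 * pi)) * (cis (- (2 * pi * t * u)) * exp (- pi * s\<^sup>2 * u\<^sup>2))" for u
  proof -
    have "(c * u)\<^sup>2 / 2 = pi * s\<^sup>2 * u\<^sup>2" by (simp add: power_mult_distrib c(2))
    moreover have "\<tau> * (c * u) = - (2 * pi * t * u)" using c by (simp add: \<tau>_def)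
    ultimately show ?thesis by (simp add: normal_density_def)
  qed
  have "integrable lborel (\<lambda>u. complex_of_real (1 / sqrt (2 * pi)) * (cis (- (2 * pi * t * u)) * exp (- pi * s\<^sup>2 * u\<^sup>2)))"
    using lborel_integrable_real_affine[OF i0, of c 0] c unfolding eq by simp
  then have "integrable lborel (\<lambda>u. complex_of_real (sqrt (2 * pi)) *
      (complex_of_real (1 / sqrt (2 * pi)) * (cis (- (2 * pi * t * u)) * exp (- pi * s\<^sup>2 * u\<^sup>2))))"
    by (rule integrable_mult_right)
  then have i: "integrable lborel (\<lambda>u. cis (- (2 * pi * t * u)) * exp (- pi * s\<^sup>2 * u\<^sup>2))"
    by simp
  have "complex_of_real (exp (- pi * t\<^sup>2 / s\<^sup>2))
     = c *\<^sub>R (LINT u|lborel. complex_of_real (1 / sqrt (2 * pi)) * (cis (- (2 * pi * t * u)) * exp (- pi * s\<^sup>2 * u\<^sup>2)))"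
    using lborel_integral_real_affine[of c "\<lambda>x. complex_of_real (std_normal_density x) * cis (\<tau> * x)" 0] c
    unfolding v0 eq by simp
  also have "\<dots> = complex_of_real s * (LINT u|lborel. cis (- (2 * pi * t * u)) * exp (- pi * s\<^sup>2 * u\<^sup>2))"
    by (simp add: c_def scaleR_conv_of_real)
  finally have "(LINT u|lborel. cis (- (2 * pi * t * u)) * exp (- pi * s\<^sup>2 * u\<^sup>2)) = complex_of_real (exp (- pi * t\<^sup>2 / s\<^sup>2) / s)"
    using s by (simp add: field_simps)
  with i show ?thesis by (simp add: has_bochner_integral_iff)
qed

lemma integrable_gaussian_moment:
  fixes s :: real
  assumes s: "s > 0"
  shows "integrable lborel (\<lambda>u. u * exp (- pi * s\<^sup>2 * u\<^sup>2))"
proof -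
  define c where "c = sqrt (2 * pi) * s"
  have c: "c > 0" "c\<^sup>2 = 2 * pi * s\<^sup>2" using s by (simp_all add: c_def power_mult_distrib)
  have eq: "std_normal_density (0 + c * u) * (0 + c * u)^1 = (c / sqrt (2 * pi)) * (u * exp (- pi * s\<^sup>2 * u\<^sup>2))" for u
  proof -
    have "(c * u)\<^sup>2 / 2 = pi * s\<^sup>2 * u\<^sup>2" by (simp add: power_mult_distrib c(2))
    then show ?thesis by (simp add: normal_density_def)
  qed
  have "integrable lborel (\<lambda>u. (c / sqrt (2 * pi)) * (u * exp (- pi * s\<^sup>2 * u\<^sup>2)))"
    using lborel_integrable_real_affine[OF integrable_std_normal_moment[of 1], of c 0] c unfolding eq by simp
  then show ?thesis using c by (subst (asm) integrable_mult_left_iff) simp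
qed

text \<open>The derivative of \<open>cis (-2\<pi>tu) exp (-\<pi>s\<^sup>2u\<^sup>2)\<close> in \<open>u\<close> integrates to zero.\<close>

lemma gaussian_moment_fourier_real:
  fixes s t :: real
  assumes s: "s > 0"
  shows "has_bochner_integral lborel (\<lambda>u. complex_of_real u * (cis (- (2 * pi * t * u)) * exp (- pi * s\<^sup>2 * u\<^sup>2)))
     (- \<i> * complex_of_real (t / s\<^sup>2 * (exp (- pi * t\<^sup>2 / s\<^sup>2) / s)))"
proof -
  define g where "g u = cis (- (2 * pi * t * u)) * exp (- pi * s\<^sup>2 * u\<^sup>2)" for u :: real
  have gi: "integrable lborel g" "integral\<^sup>L lborel g = complex_of_real (exp (- pi * t\<^sup>2 / s\<^sup>2) / s)"
    using gaussian_fourier_real[OF s, of t] by (simp_all add: has_bochner_integral_iff g_def[abs_def])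
  have [measurable]: "g \<in> borel_measurable borel" using gi by auto
  have ng: "norm (g u) = exp (- pi * s\<^sup>2 * u\<^sup>2)" for u
    by (simp add: g_def norm_mult)
  have ui: "integrable lborel (\<lambda>u. complex_of_real u * g u)"
    by (rule Bochner_Integration.integrable_bound[OF integrable_gaussian_moment[OF s]])
       (auto simp: norm_mult ng abs_mult)
  define d where "d u = - (2 * pi * t) * \<i> * g u - 2 * pi * s\<^sup>2 * (complex_of_real u * g u)" for u
  have di: "integrable lborel d"
    unfolding d_def using gi ui by simp
  have g_alt: "g u = exp (complex_of_real u * (- (2 * pi * t) * \<i>) - complex_of_real (pi * s\<^sup>2 * u\<^sup>2))" for u
    unfolding g_def by (simp add: cis_conv_exp exp_of_real[symmetric] mult_exp_exp algebra_simps)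
  have der: "(g has_vector_derivative d u) (at u)" for u
  proof -
    \<comment> \<open>The function is differentiated as an entire function of a complex variable and
      then restricted to the real line.\<close>
    define G where "G z = exp (z * (- (2 * pi * t) * \<i>) - pi * s\<^sup>2 * z\<^sup>2)" for z :: complex
    have "(G has_field_derivative (- (2 * pi * t) * \<i> - 2 * pi * s\<^sup>2 * complex_of_real u) * G (complex_of_real u)) (at (complex_of_real u))"
      unfolding G_def by (auto intro!: derivative_eq_intros simp: algebra_simps)
    then have "((\<lambda>u. G (complex_of_real u)) has_vector_derivative
        (- (2 * pi * t) * \<i> - 2 * pi * s\<^sup>2 * complex_of_real u) * G (complex_of_real u)) (at u)"
      by (rule has_vector_derivative_real_field)
    moreover have "G (complex_of_real u) = g u" for u
      unfolding G_def g_alt by simp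
    ultimately show ?thesis by (simp add: d_def algebra_simps)
  qed
  have cont: "isCont d u" for u
    unfolding d_def g_alt by (intro continuous_intros)
  have "(LBINT u=-\<infinity>..\<infinity>. d u) = 0 - 0"
  proof (rule interval_integral_FTC_integrable)
    show "set_integrable lborel (einterval (-\<infinity>) \<infinity>) d"
      using di by (simp add: set_integrable_def)
    define K where "K = pi * s\<^sup>2"
    have K: "K > 0" using s by (simp add: K_def)
    have "LIM u at_top. - K * (u::real)\<^sup>2 :> at_bot"
      by (rule filterlim_tendsto_neg_mult_at_bot[OF tendsto_const])
         (use K filterlim_pow_at_top[OF zero_less_numeral filterlim_ident, of "Num.Bit0 Num.One"] in simp_all)
    then have "((\<lambda>u. exp (- K * u\<^sup>2)) \<longlongrightarrow> 0) at_top"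
      by (rule filterlim_compose[OF exp_at_bot])
    moreover have "LIM u at_bot. - K * (u::real)\<^sup>2 :> at_bot"
      by (rule filterlim_tendsto_neg_mult_at_bot[OF tendsto_const])
         (use K filterlim_pow_at_bot_even[OF zero_less_numeral filterlim_ident, of "Num.Bit0 Num.One"] in simp_all)
    then have "((\<lambda>u. exp (- K * u\<^sup>2)) \<longlongrightarrow> 0) at_bot"
      by (rule filterlim_compose[OF exp_at_bot])
    ultimately have "(g \<longlongrightarrow> 0) at_top" "(g \<longlongrightarrow> 0) at_bot"
      by (auto intro!: tendsto_norm_zero_cancel[of g] simp: ng K_def)
    then show "((g \<circ> real_of_ereal) \<longlongrightarrow> 0) (at_left \<infinity>)" "((g \<circ> real_of_ereal) \<longlongrightarrow> 0) (at_right (-\<infinity>))"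
      by (simp_all add: ereal_tendsto_simps)
  qed (use der cont in auto)
  then have "integral\<^sup>L lborel d = 0"
    by (simp add: interval_lebesgue_integral_def set_lebesgue_integral_def)
  also have "integral\<^sup>L lborel d = - (2 * pi * t) * \<i> * integral\<^sup>L lborel g - 2 * pi * s\<^sup>2 * (LINT u|lborel. complex_of_real u * g u)"
    unfolding d_def using gi(1) ui by simp
  finally have z: "0 = complex_of_real (- (2 * pi * t)) * \<i> * integral\<^sup>L lborel g
      - complex_of_real (2 * pi * s\<^sup>2) * (LINT u|lborel. complex_of_real u * g u)" by simp
  define Y where "Y = exp (- pi * t\<^sup>2 / s\<^sup>2) / s"
  \<comment> \<open>Writing I for the transform of the Gaussian and J for that of its first moment,
    the vanishing integral reads 0 = -2\<pi>\<i>t I - 2\<pi>s^2 J; solving for J gives the factor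
    -\<i>t/s^2.\<close>
  have "2 * pi * t * Y = 2 * pi * s\<^sup>2 * (t / s\<^sup>2 * Y)" using s by simp
  then have "complex_of_real (2 * pi * t) * complex_of_real Y = complex_of_real (2 * pi * s\<^sup>2) * complex_of_real (t / s\<^sup>2 * Y)"
    by (metis of_real_mult)
  then have "complex_of_real (2 * pi * s\<^sup>2) * (LINT u|lborel. complex_of_real u * g u)
      = complex_of_real (2 * pi * s\<^sup>2) * (- \<i> * complex_of_real (t / s\<^sup>2 * Y))"
    using z unfolding gi(2) Y_def[symmetric] by (simp add: algebra_simps)
  then have "(LINT u|lborel. complex_of_real u * g u) = - \<i> * complex_of_real (t / s\<^sup>2 * Y)"
    using s by (subst (asm) mult_left_cancel) auto
  with ui show ?thesis by (simp add: has_bochner_integral_iff g_def Y_def)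
qed

text \<open>Lebesgue measure on a Euclidean space is the image of the product of the one-dimensional
  measures under the coordinate map, so a product of functions of single coordinates integrates to
  the product of the integrals.\<close>

lemma has_bochner_integral_prod_Basis:
  fixes g :: "'a::euclidean_space \<Rightarrow> real \<Rightarrow> complex"
  assumes "\<And>b. b \<in> Basis \<Longrightarrow> has_bochner_integral lborel (g b) (v b)"
  shows "has_bochner_integral lborel (\<lambda>x::'a. \<Prod>b\<in>Basis. g b (x \<bullet> b)) (\<Prod>b\<in>Basis. v b)"
proof -
  interpret product_sigma_finite "\<lambda>b::'a. lborel :: real measure" ..
  have i: "integrable lborel (g b)" and v: "integral\<^sup>L lborel (g b) = v b" if "b \<in> Basis" for b
    using assms[OF that] by (auto simp: has_bochner_integral_iff)
  have gm: "g b \<in> borel_measurable borel" if "b \<in> Basis" for b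
    using i[OF that] by auto
  have m: "(\<lambda>x. \<Prod>b\<in>Basis. g b (x \<bullet> b)) \<in> borel_measurable (borel :: 'a measure)"
    by (intro borel_measurable_prod measurable_compose[OF _ gm]) auto
  have T: "(\<lambda>f. \<Sum>b\<in>Basis. f b *\<^sub>R b) \<in> (\<Pi>\<^sub>M b\<in>(Basis::'a set). lborel) \<rightarrow>\<^sub>M borel"
    by measurable
  have L: "(lborel :: 'a measure) = distr (\<Pi>\<^sub>M b\<in>Basis. lborel) borel (\<lambda>f. \<Sum>b\<in>Basis. f b *\<^sub>R b)"
    by (rule lborel_eq)
  have eq: "(\<Prod>b\<in>Basis. g b ((\<Sum>b\<in>Basis. f b *\<^sub>R b) \<bullet> b)) = (\<Prod>b\<in>Basis. g b (f b))" for f :: "'a \<Rightarrow> real"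
    by (intro prod.cong) (auto simp: inner_sum_left_Basis)
  have "integrable (\<Pi>\<^sub>M b\<in>(Basis::'a set). lborel) (\<lambda>f. \<Prod>b\<in>Basis. g b (f b))"
    by (rule product_integrable_prod) (auto simp: i)
  then have "integrable lborel (\<lambda>x::'a. \<Prod>b\<in>Basis. g b (x \<bullet> b))"
    unfolding L using integrable_distr_eq[OF T m] by (simp add: eq)
  moreover have "integral\<^sup>L lborel (\<lambda>x::'a. \<Prod>b\<in>Basis. g b (x \<bullet> b)) = (\<Prod>b\<in>Basis. v b)"
  proof -
    have "integral\<^sup>L lborel (\<lambda>x::'a. \<Prod>b\<in>Basis. g b (x \<bullet> b)) = integral\<^sup>L (\<Pi>\<^sub>M b\<in>(Basis::'a set). lborel) (\<lambda>f. \<Prod>b\<in>Basis. g b (f b))"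
      unfolding L using integral_distr[OF T m] by (simp add: eq)
    also have "\<dots> = (\<Prod>b\<in>Basis. integral\<^sup>L lborel (g b))"
      by (rule product_integral_prod) (auto simp: i)
    finally show ?thesis by (simp add: v)
  qed
  ultimately show ?thesis by (simp add: has_bochner_integral_iff)
qed

lemma has_bochner_integral_prod_vec:
  fixes g :: "'n::finite \<Rightarrow> real \<Rightarrow> complex"
  assumes "\<And>k. has_bochner_integral lborel (g k) (v k)"
  shows "has_bochner_integral lborel (\<lambda>x::real^'n. \<Prod>k\<in>UNIV. g k (x $ k)) (\<Prod>k\<in>UNIV. v k)"
proof -
  have B: "(Basis :: (real^'n) set) = range (\<lambda>k. axis k 1)"
    by (auto simp: Basis_vec_def)
  have inj: "inj (\<lambda>k::'n. axis k (1::real))"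
    by (auto simp: inj_on_def axis_eq_axis)
  have "has_bochner_integral lborel (\<lambda>x::real^'n. \<Prod>b\<in>Basis. g (axis_index b) (x \<bullet> b))
      (\<Prod>b\<in>(Basis::(real^'n) set). v (axis_index b))"
    by (rule has_bochner_integral_prod_Basis[where g="\<lambda>b. g (axis_index b)" and v="\<lambda>b. v (axis_index b)"]) (rule assms)
  then show ?thesis
    unfolding B prod.reindex[OF inj] by (simp add: axis_index_axis cart_eq_inner_axis[symmetric] o_def)
qed

lemma norm_vec3_power2: "(norm (x::real^3))\<^sup>2 = (x$1)\<^sup>2 + (x$2)\<^sup>2 + (x$3)\<^sup>2"
  by (simp add: norm_vec_def L2_set_def sum_3)

lemma inner_vec3: "x \<bullet> y = x$1 * y$1 + x$2 * y$2 + x$3 * (y::real^3)$3"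
  by (simp add: inner_vec_def sum_3)

lemma cis_gauss_prod:
  "(\<Prod>k\<in>UNIV. cis (- (2 * pi * x$k * \<xi>$k)) * exp (- pi * s\<^sup>2 * (\<xi>$k)\<^sup>2))
   = cis (- (2 * pi * (\<xi> \<bullet> (x::real^3)))) * complex_of_real (exp (- pi * s\<^sup>2 * (norm \<xi>)\<^sup>2))"
proof -
  have *: "(cis a * complex_of_real p) * ((cis b * complex_of_real q) * (cis c * complex_of_real r))
      = cis (a + b + c) * complex_of_real (p * q * r)" for a b c p q r
    by (simp add: cis_mult[symmetric] mult_ac)
  have "(\<Prod>k\<in>UNIV. cis (- (2 * pi * x$k * \<xi>$k)) * exp (- pi * s\<^sup>2 * (\<xi>$k)\<^sup>2))
      = (cis (- (2 * pi * x$1 * \<xi>$1)) * complex_of_real (exp (- pi * s\<^sup>2 * (\<xi>$1)\<^sup>2))) *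
        ((cis (- (2 * pi * x$2 * \<xi>$2)) * complex_of_real (exp (- pi * s\<^sup>2 * (\<xi>$2)\<^sup>2))) *
         (cis (- (2 * pi * x$3 * \<xi>$3)) * complex_of_real (exp (- pi * s\<^sup>2 * (\<xi>$3)\<^sup>2))))"
    unfolding UNIV_3 by simp
  moreover have "exp (- pi * s\<^sup>2 * (\<xi>$1)\<^sup>2) * exp (- pi * s\<^sup>2 * (\<xi>$2)\<^sup>2) * exp (- pi * s\<^sup>2 * (\<xi>$3)\<^sup>2) = exp (- pi * s\<^sup>2 * (norm \<xi>)\<^sup>2)"
    unfolding norm_vec3_power2 by (simp add: mult_exp_exp algebra_simps)
  moreover have "- (2 * pi * x$1 * \<xi>$1) + - (2 * pi * x$2 * \<xi>$2) + - (2 * pi * x$3 * \<xi>$3) = - (2 * pi * (\<xi> \<bullet> x))"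
    by (simp add: inner_vec3 algebra_simps)
  ultimately show ?thesis unfolding * by metis
qed

lemma gaussian_fourier:
  fixes x :: "real^3"
  assumes s: "s > 0"
  shows "has_bochner_integral lborel (\<lambda>\<xi>. cis (- (2 * pi * (\<xi> \<bullet> x))) * complex_of_real (exp (- pi * s\<^sup>2 * (norm \<xi>)\<^sup>2)))
    (complex_of_real (exp (- pi * (norm x)\<^sup>2 / s\<^sup>2) / s^3))"
proof -
  have "has_bochner_integral lborel (\<lambda>\<xi>. \<Prod>k\<in>UNIV. cis (- (2 * pi * x$k * \<xi>$k)) * exp (- pi * s\<^sup>2 * (\<xi>$k)\<^sup>2))
      (\<Prod>k\<in>UNIV. complex_of_real (exp (- pi * (x$k)\<^sup>2 / s\<^sup>2) / s))"
    by (rule has_bochner_integral_prod_vec) (rule gaussian_fourier_real[OF s])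
  moreover have "(\<Prod>k\<in>UNIV. complex_of_real (exp (- pi * (x$k)\<^sup>2 / s\<^sup>2) / s)) = complex_of_real (exp (- pi * (norm x)\<^sup>2 / s\<^sup>2) / s^3)"
    unfolding UNIV_3 norm_vec3_power2 of_real_prod[symmetric] of_real_eq_iff
    by (simp add: mult_exp_exp add_divide_distrib diff_divide_distrib algebra_simps power3_eq_cube)
  ultimately show ?thesis unfolding cis_gauss_prod by simp
qed

text \<open>Only the j-th of the three one-dimensional factors carries the moment. It contributes
  the extra -\<i> x_j/s^2, which raises the power of s from 3 to 5.\<close>

lemma gaussian_moment_fourier:
  fixes x :: "real^3"
  assumes s: "s > 0"
  shows "has_bochner_integral lborel
     (\<lambda>\<xi>. complex_of_real (\<xi>$j) * (cis (- (2 * pi * (\<xi> \<bullet> x))) * complex_of_real (exp (- pi * s\<^sup>2 * (norm \<xi>)\<^sup>2))))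
     (- \<i> * complex_of_real (x$j * exp (- pi * (norm x)\<^sup>2 / s\<^sup>2) / s^5))"
proof -
  define g where "g k u = (if k = j then complex_of_real u else 1) * (cis (- (2 * pi * x$k * u)) * exp (- pi * s\<^sup>2 * u\<^sup>2))" for k u
  define v where "v k = (if k = j then - \<i> * complex_of_real (x$k / s\<^sup>2) else 1) * complex_of_real (exp (- pi * (x$k)\<^sup>2 / s\<^sup>2) / s)" for k
  have "has_bochner_integral lborel (g k) (v k)" for k
    unfolding g_def v_def using gaussian_moment_fourier_real[OF s, of "x$k"] gaussian_fourier_real[OF s, of "x$k"]
    by (cases "k = j") (simp_all add: mult_ac)
  then have *: "has_bochner_integral lborel (\<lambda>\<xi>. \<Prod>k\<in>UNIV. g k (\<xi> $ k)) (\<Prod>k\<in>UNIV. v k)"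
    by (rule has_bochner_integral_prod_vec)
  have "(\<Prod>k\<in>UNIV. g k (\<xi> $ k)) = complex_of_real (\<xi>$j) * (cis (- (2 * pi * (\<xi> \<bullet> x))) * complex_of_real (exp (- pi * s\<^sup>2 * (norm \<xi>)\<^sup>2)))" for \<xi>
    unfolding g_def prod.distrib cis_gauss_prod[symmetric] by simp
  moreover have "(\<Prod>k\<in>UNIV. v k) = - \<i> * complex_of_real (x$j * exp (- pi * (norm x)\<^sup>2 / s\<^sup>2) / s^5)"
  proof -
    have "(\<Prod>k\<in>UNIV. complex_of_real (exp (- pi * (x$k)\<^sup>2 / s\<^sup>2) / s)) = complex_of_real (exp (- pi * (norm x)\<^sup>2 / s\<^sup>2) / s^3)"
      unfolding UNIV_3 norm_vec3_power2 of_real_prod[symmetric] of_real_eq_iff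
      by (simp add: mult_exp_exp add_divide_distrib diff_divide_distrib algebra_simps power3_eq_cube)
    then show ?thesis
      unfolding v_def prod.distrib using s by (simp add: field_simps eval_nat_numeral)
  qed
  ultimately show ?thesis using * by simp
qed

lemma fourier_integral_gaussian:
  assumes s: "s > 0"
  shows "fourier_integral (\<lambda>\<xi>. exp (- pi * s\<^sup>2 * (norm \<xi>)\<^sup>2) *\<^sub>R c) x = (exp (- pi * (norm x)\<^sup>2 / s\<^sup>2) / s^3) *\<^sub>R c"
    and "integrable lborel (\<lambda>\<xi>::real^3. exp (- pi * s\<^sup>2 * (norm \<xi>)\<^sup>2))"
proof -
  note G = gaussian_fourier[OF s]
  show "fourier_integral (\<lambda>\<xi>. exp (- pi * s\<^sup>2 * (norm \<xi>)\<^sup>2) *\<^sub>R c) x = (exp (- pi * (norm x)\<^sup>2 / s\<^sup>2) / s^3) *\<^sub>R c"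
    unfolding fourier_integral_cis scaleR_eq_complex_scale vector_smult_assoc
    using has_bochner_integral_bounded_linear[OF bounded_bilinear.bounded_linear_left[OF bounded_bilinear_complex_scale, of c] G[of x]]
    by (simp add: has_bochner_integral_iff)
  have "integrable lborel (\<lambda>\<xi>::real^3. cmod (cis (- (2 * pi * (\<xi> \<bullet> 0))) * complex_of_real (exp (- pi * s\<^sup>2 * (norm \<xi>)\<^sup>2))))"
    using G[of 0] by (intro integrable_norm) (simp add: has_bochner_integral_iff)
  then show "integrable lborel (\<lambda>\<xi>::real^3. exp (- pi * s\<^sup>2 * (norm \<xi>)\<^sup>2))"
    by (simp add: norm_mult)
qed

text \<open>The \<i> in front of \<xi> cancels the -\<i> produced by a first moment, so the vector
  field \<i>\<xi> times a Gaussian goes to a real positive multiple of x.\<close>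

lemma has_bochner_integral_gaussian_moment:
  assumes s: "s > 0"
  shows "has_bochner_integral lborel
     (\<lambda>\<xi>. cis (- (2 * pi * (\<xi> \<bullet> x))) *s (exp (- pi * s\<^sup>2 * (norm \<xi>)\<^sup>2) *\<^sub>R (\<i> *s pure_quat \<xi>)))
     ((exp (- pi * (norm x)\<^sup>2 / s\<^sup>2) / s^5) *\<^sub>R pure_quat x)"
proof -
  define h where "h j \<xi> = complex_of_real (\<xi>$j) * (cis (- (2 * pi * (\<xi> \<bullet> x))) * complex_of_real (exp (- pi * s\<^sup>2 * (norm \<xi>)\<^sup>2)))" for j and \<xi> :: "real^3"
  define v where "v j = - \<i> * complex_of_real (x$j * exp (- pi * (norm x)\<^sup>2 / s\<^sup>2) / s^5)" for j
  have *: "has_bochner_integral lborel (\<lambda>\<xi>. h j \<xi> *s q) (v j *s q)" for j and q :: cquat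
    unfolding h_def v_def
    by (rule has_bochner_integral_bounded_linear[OF bounded_bilinear.bounded_linear_left[OF bounded_bilinear_complex_scale, of q] gaussian_moment_fourier[OF s]])
  have "has_bochner_integral lborel (\<lambda>\<xi>. h 1 \<xi> *s (\<i> *s e1) + h 2 \<xi> *s (\<i> *s e2) + h 3 \<xi> *s (\<i> *s e3))
      (v 1 *s (\<i> *s e1) + v 2 *s (\<i> *s e2) + v 3 *s (\<i> *s e3))"
    by (intro has_bochner_integral_add *)
  moreover have "h 1 \<xi> *s (\<i> *s e1) + h 2 \<xi> *s (\<i> *s e2) + h 3 \<xi> *s (\<i> *s e3)
      = cis (- (2 * pi * (\<xi> \<bullet> x))) *s (exp (- pi * s\<^sup>2 * (norm \<xi>)\<^sup>2) *\<^sub>R (\<i> *s pure_quat \<xi>))" for \<xi>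
    unfolding h_def scaleR_eq_complex_scale pure_quat_def
    by (simp add: vector_add_ldistrib mult_ac)
  moreover have "v 1 *s (\<i> *s e1) + v 2 *s (\<i> *s e2) + v 3 *s (\<i> *s e3) = (exp (- pi * (norm x)\<^sup>2 / s\<^sup>2) / s^5) *\<^sub>R pure_quat x"
    unfolding v_def scaleR_eq_complex_scale pure_quat_def
    by (simp add: vector_add_ldistrib mult_ac)
  ultimately show ?thesis by simp
qed

section \<open>The Fourier transformation on \<open>L\<^sup>2\<close>\<close>

lemma lborel_integral_affine:
  fixes f :: "'a::euclidean_space \<Rightarrow> 'b::{banach, second_countable_topology}"
  assumes [measurable]: "f \<in> borel_measurable borel" and c: "c \<noteq> 0"
  shows "(LINT y|lborel. f y) = (\<bar>c\<bar> ^ DIM('a)) *\<^sub>R (LINT y|lborel. f (t + c *\<^sub>R y))"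
proof -
  have "(LINT y|lborel. f y) = integral\<^sup>L (density (distr lborel borel (\<lambda>x. t + c *\<^sub>R x)) (\<lambda>_. ennreal (\<bar>c\<bar> ^ DIM('a)))) f"
    using lborel_affine[OF c, of t] by (simp add: ennreal_power)
  also have "\<dots> = (\<bar>c\<bar> ^ DIM('a)) *\<^sub>R (LINT y|lborel. f (t + c *\<^sub>R y))"
    by (subst integral_density) (simp_all add: integral_distr)
  finally show ?thesis .
qed

text \<open>The convolution formula with a scalar Gaussian multiplier, applied to the reflection of
  f; a second reflection in the variable of integration turns the result into the mollification of f
  at x.\<close>

lemma fourier_integral_gaussian_damped:
  assumes s: "s > 0" and f: "integrable lborel f"
  shows "integrable lborel (\<lambda>\<xi>. exp (- pi * s\<^sup>2 * (norm \<xi>)\<^sup>2) *\<^sub>R fourier_integral f \<xi>)"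
    and "fourier_integral (\<lambda>\<xi>. exp (- pi * s\<^sup>2 * (norm \<xi>)\<^sup>2) *\<^sub>R fourier_integral f \<xi>) (- x)
      = (LINT y|lborel. (exp (- pi * (norm (x - y))\<^sup>2 / s\<^sup>2) / s^3) *\<^sub>R f y)"
proof -
  have [measurable]: "f \<in> borel_measurable borel" using f by auto
  define m where "m \<xi> = exp (- pi * s\<^sup>2 * (norm \<xi>)\<^sup>2) *\<^sub>R qone" for \<xi> :: "real^3"
  have m: "integrable lborel m"
    unfolding m_def using fourier_integral_gaussian(2)[OF s] by simp
  have f': "integrable lborel (\<lambda>x. f (- x))" using f by (simp add: lborel_integral_uminus)
  have eq: "exp (- pi * s\<^sup>2 * (norm \<xi>)\<^sup>2) *\<^sub>R fourier_integral f \<xi> = m \<xi> \<odot> fourier_integral (\<lambda>x. f (- x)) (- \<xi>)" for \<xi>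
    by (simp add: fourier_integral_uminus m_def scaleR_eq_complex_scale cq_mult_bilinear cq_units)
  note M = fourier_integral_multiplier[OF m f']
  show "integrable lborel (\<lambda>\<xi>. exp (- pi * s\<^sup>2 * (norm \<xi>)\<^sup>2) *\<^sub>R fourier_integral f \<xi>)"
    unfolding eq by (rule M(2))
  have Fm: "fourier_integral m z \<odot> q = (exp (- pi * (norm z)\<^sup>2 / s\<^sup>2) / s^3) *\<^sub>R q" for z q
    using fourier_integral_gaussian(1)[OF s, of qone z]
    by (simp add: m_def[abs_def] scaleR_eq_complex_scale cq_mult_bilinear cq_units)
  have "fourier_integral (\<lambda>\<xi>. exp (- pi * s\<^sup>2 * (norm \<xi>)\<^sup>2) *\<^sub>R fourier_integral f \<xi>) (- x)
      = (LINT y|lborel. (exp (- pi * (norm (- x - y))\<^sup>2 / s\<^sup>2) / s^3) *\<^sub>R f (- y))"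
    unfolding eq M(1) Fm ..
  also have "\<dots> = (LINT y|lborel. (exp (- pi * (norm (- x - (- y)))\<^sup>2 / s\<^sup>2) / s^3) *\<^sub>R f (- (- y)))"
    by (rule lborel_integral_uminus(2)[symmetric])
  also have "\<dots> = (LINT y|lborel. (exp (- pi * (norm (x - y))\<^sup>2 / s\<^sup>2) / s^3) *\<^sub>R f y)"
    by (simp add: norm_minus_commute)
  finally show "fourier_integral (\<lambda>\<xi>. exp (- pi * s\<^sup>2 * (norm \<xi>)\<^sup>2) *\<^sub>R fourier_integral f \<xi>) (- x)
      = (LINT y|lborel. (exp (- pi * (norm (x - y))\<^sup>2 / s\<^sup>2) / s^3) *\<^sub>R f y)" .
qed

text \<open>The Gaussian transform formula at frequency 0, with 1/s in place of s.\<close>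

lemma gaussian_kernel:
  assumes s: "s > 0"
  shows "integrable lborel (\<lambda>z::real^3. exp (- pi * (norm z)\<^sup>2 / s\<^sup>2) / s^3)"
    and "(LINT z|lborel. exp (- pi * (norm (z::real^3))\<^sup>2 / s\<^sup>2) / s^3) = 1"
proof -
  have s': "1 / s > 0" using s by simp
  have eq: "exp (- pi * (1/s)\<^sup>2 * (norm z)\<^sup>2) = exp (- pi * (norm z)\<^sup>2 / s\<^sup>2)" for z :: "real^3"
    by (simp add: power_divide)
  have i: "integrable lborel (\<lambda>z::real^3. exp (- pi * (norm z)\<^sup>2 / s\<^sup>2))"
    using fourier_integral_gaussian(2)[OF s'] unfolding eq .
  then show "integrable lborel (\<lambda>z::real^3. exp (- pi * (norm z)\<^sup>2 / s\<^sup>2) / s^3)"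
    by (intro integrable_divide_zero) simp
  have "complex_of_real (LINT z|lborel. exp (- pi * (norm (z::real^3))\<^sup>2 / s\<^sup>2)) = complex_of_real (s^3)"
    using gaussian_fourier[OF s', of 0] s unfolding eq
    by (simp add: has_bochner_integral_iff power_divide)
  then have *: "(LINT z|lborel. exp (- pi * (norm (z::real^3))\<^sup>2 / s\<^sup>2)) = s^3"
    by (simp only: of_real_eq_iff)
  have "(LINT z|lborel. exp (- pi * (norm (z::real^3))\<^sup>2 / s\<^sup>2) / s^3)
      = (LINT z|lborel. exp (- pi * (norm (z::real^3))\<^sup>2 / s\<^sup>2)) / s^3"
    by (rule integral_divide_zero)
  also have "\<dots> = s^3 / s^3" by (simp only: *)
  also have "\<dots> = 1" using s by simp
  finally show "(LINT z|lborel. exp (- pi * (norm (z::real^3))\<^sup>2 / s\<^sup>2) / s^3) = 1" .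
qed

lemma convolution_integral:
  fixes \<phi> u :: "real^3 \<Rightarrow> real"
  assumes \<phi>: "integrable lborel \<phi>" and u: "integrable lborel u"
    and nn: "\<And>z. 0 \<le> \<phi> z" "\<And>y. 0 \<le> u y"
  shows "integrable lborel (\<lambda>x. LINT y|lborel. \<phi> (x - y) * u y)"
    and "(LINT x|lborel. LINT y|lborel. \<phi> (x - y) * u y) = (LINT z|lborel. \<phi> z) * (LINT y|lborel. u y)"
proof -
  have [measurable]: "\<phi> \<in> borel_measurable borel" "u \<in> borel_measurable borel" using \<phi> u by auto
  have t: "integrable lborel (\<lambda>x. \<phi> (x - y))" "(LINT x|lborel. \<phi> (x - y)) = (LINT z|lborel. \<phi> z)" for y
    using lborel_integral_translate[of "\<lambda>z. \<phi> (- z)" y] \<phi> lborel_integral_uminus[of \<phi>] by simp_all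
  have i: "integrable (lborel \<Otimes>\<^sub>M lborel) (\<lambda>(y, x). \<phi> (x - y) * u y)"
  proof (rule lborel_pair.Fubini_integrable)
    show "integrable lborel (\<lambda>y. LINT x|lborel. norm (case (y, x) of (y, x) \<Rightarrow> \<phi> (x - y) * u y))"
      using u t nn by (simp add: abs_mult)
    show "AE y in lborel. integrable lborel (\<lambda>x. case (y, x) of (y, x) \<Rightarrow> \<phi> (x - y) * u y)"
      using t by simp
  qed measurable
  show "integrable lborel (\<lambda>x. LINT y|lborel. \<phi> (x - y) * u y)"
    using lborel_pair.integrable_snd[OF i] .
  show "(LINT x|lborel. LINT y|lborel. \<phi> (x - y) * u y) = (LINT z|lborel. \<phi> z) * (LINT y|lborel. u y)"
    using lborel_pair.Fubini_integral[OF i] t by simp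
qed

text \<open>Damping by a Gaussian turns \<open>|\<F> f|\<^sup>2\<close> into the pairing of \<open>f\<close> with its mollification.\<close>

lemma fourier_integral_damped_sq:
  assumes s: "s > 0" and f: "integrable lborel f" "f \<in> L2"
  shows "integrable lborel (\<lambda>\<xi>. exp (- pi * s\<^sup>2 * (norm \<xi>)\<^sup>2) * (norm (fourier_integral f \<xi>))\<^sup>2)"
    and "(LINT \<xi>|lborel. exp (- pi * s\<^sup>2 * (norm \<xi>)\<^sup>2) * (norm (fourier_integral f \<xi>))\<^sup>2) \<le> sq_int f"
proof -
  have [measurable]: "f \<in> borel_measurable borel" using f by auto
  define B where "B = (LINT x|lborel. norm (f x))"
  have B: "norm (fourier_integral f \<xi>) \<le> B" for \<xi> unfolding B_def by (rule norm_fourier_integral_le)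
  define h where "h \<xi> = exp (- pi * s\<^sup>2 * (norm \<xi>)\<^sup>2) *\<^sub>R fourier_integral f \<xi>" for \<xi>
  define \<phi> where "\<phi> z = exp (- pi * (norm z)\<^sup>2 / s\<^sup>2) / s^3" for z :: "real^3"
  have \<phi>: "integrable lborel \<phi>" "(LINT z|lborel. \<phi> z) = 1" "\<And>z. 0 \<le> \<phi> z" "\<And>z. \<phi> z \<le> 1 / s^3"
    unfolding \<phi>_def[abs_def] using s by (rule gaussian_kernel | simp add: divide_right_mono)+
  have [measurable]: "\<phi> \<in> borel_measurable borel" using \<phi>(1) by auto
  have eq: "exp (- pi * s\<^sup>2 * (norm \<xi>)\<^sup>2) * (norm (fourier_integral f \<xi>))\<^sup>2 = fourier_integral f \<xi> \<bullet> h \<xi>" for \<xi>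
    by (simp add: h_def power2_norm_eq_inner)
  have hi: "integrable lborel h"
    unfolding h_def by (rule fourier_integral_gaussian_damped(1)[OF s f(1)])
  have [measurable]: "h \<in> borel_measurable borel" using hi by auto
  show "integrable lborel (\<lambda>\<xi>. exp (- pi * s\<^sup>2 * (norm \<xi>)\<^sup>2) * (norm (fourier_integral f \<xi>))\<^sup>2)"
  proof (rule Bochner_Integration.integrable_bound)
    show "integrable lborel (\<lambda>\<xi>::real^3. exp (- pi * s\<^sup>2 * (norm \<xi>)\<^sup>2) * B\<^sup>2)"
      using fourier_integral_gaussian(2)[OF s] by simp
    show "AE \<xi> in lborel. norm (exp (- pi * s\<^sup>2 * (norm \<xi>)\<^sup>2) * (norm (fourier_integral f \<xi>))\<^sup>2)
        \<le> norm (exp (- pi * s\<^sup>2 * (norm \<xi>)\<^sup>2) * B\<^sup>2)"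
      using B by (auto intro!: power_mono simp: abs_mult)
  qed measurable
  have u: "integrable lborel (\<lambda>y. (norm (f y))\<^sup>2)" by (rule L2_integrable[OF f(2)])
  note C = convolution_integral[OF \<phi>(1) u \<phi>(3) zero_le_power2, unfolded \<phi>(2)]
  \<comment> \<open>The inequality a.b <= |a|^2/2 + |b|^2/2 is used under the integral. As
    \<open>\<phi>\<close> has total mass 1, integration over x turns each of the two halves into
    half the squared norm of f, and the constant 1 results.\<close>
  have pt: "f x \<bullet> fourier_integral h (- x) \<le> (norm (f x))\<^sup>2 / 2 + (LINT y|lborel. \<phi> (x - y) * (norm (f y))\<^sup>2) / 2" for x
  proof -
    have i1: "integrable lborel (\<lambda>y. \<phi> (x - y))" "(LINT y|lborel. \<phi> (x - y)) = 1"
      using lborel_integral_translate[of \<phi> x] \<phi> by simp_all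
    have bd: "integrable lborel (\<lambda>y. \<phi> (x - y) *\<^sub>R g y)" if "integrable lborel g" for g :: "real^3 \<Rightarrow> 'b::{banach,second_countable_topology}"
    proof (rule Bochner_Integration.integrable_bound)
      have [measurable]: "g \<in> borel_measurable borel" using that by auto
      show "(\<lambda>y. \<phi> (x - y) *\<^sub>R g y) \<in> borel_measurable lborel" by simp
      show "integrable lborel (\<lambda>y. (1 / s^3) * norm (g y))" using that by simp
      show "AE y in lborel. norm (\<phi> (x - y) *\<^sub>R g y) \<le> norm ((1 / s^3) * norm (g y))"
        using \<phi>(3,4)[of "x - y" for y] s by (auto intro!: AE_I2 mult_right_mono simp: abs_mult simp del: times_divide_eq_left)
    qed
    have i2: "integrable lborel (\<lambda>y. \<phi> (x - y) * (norm (f y))\<^sup>2)"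
      using bd[OF u] by simp
    have "f x \<bullet> fourier_integral h (- x) = (LINT y|lborel. f x \<bullet> (\<phi> (x - y) *\<^sub>R f y))"
    proof -
      have "fourier_integral h (- x) = (LINT y|lborel. \<phi> (x - y) *\<^sub>R f y)"
        unfolding h_def[abs_def] \<phi>_def by (rule fourier_integral_gaussian_damped(2)[OF s f(1)])
      then show ?thesis using integral_inner_right[of "f x", OF bd[OF f(1)]] by simp
    qed
    also have "\<dots> \<le> (LINT y|lborel. \<phi> (x - y) * ((norm (f x))\<^sup>2 / 2) + \<phi> (x - y) * (norm (f y))\<^sup>2 / 2)"
    proof (rule integral_mono)
      show "integrable lborel (\<lambda>y. f x \<bullet> (\<phi> (x - y) *\<^sub>R f y))"
        by (intro integrable_inner_right bd f)
      show "integrable lborel (\<lambda>y. \<phi> (x - y) * ((norm (f x))\<^sup>2 / 2) + \<phi> (x - y) * (norm (f y))\<^sup>2 / 2)"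
        using i1 i2 by simp
      show "f x \<bullet> (\<phi> (x - y) *\<^sub>R f y) \<le> \<phi> (x - y) * ((norm (f x))\<^sup>2 / 2) + \<phi> (x - y) * (norm (f y))\<^sup>2 / 2" for y
      proof -
        have "0 \<le> (norm (f x - f y))\<^sup>2" by simp
        then have "f x \<bullet> f y \<le> (norm (f x))\<^sup>2 / 2 + (norm (f y))\<^sup>2 / 2"
          unfolding power2_norm_eq_inner by (simp add: inner_diff_left inner_diff_right inner_commute)
        from mult_left_mono[OF this \<phi>(3)[of "x - y"]] show ?thesis by (simp add: algebra_simps)
      qed
    qed
    also have "\<dots> = (norm (f x))\<^sup>2 / 2 + (LINT y|lborel. \<phi> (x - y) * (norm (f y))\<^sup>2) / 2"
      using i1 i2 by simp
    finally show ?thesis .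
  qed
  have "(LINT \<xi>|lborel. exp (- pi * s\<^sup>2 * (norm \<xi>)\<^sup>2) * (norm (fourier_integral f \<xi>))\<^sup>2)
      = (LINT x|lborel. f x \<bullet> fourier_integral h (- x))"
    unfolding eq by (rule fourier_integral_adjoint[OF f(1) hi])
  also have "\<dots> \<le> (LINT x|lborel. (norm (f x))\<^sup>2 / 2 + (LINT y|lborel. \<phi> (x - y) * (norm (f y))\<^sup>2) / 2)"
  proof (rule integral_mono[OF _ _ pt])
    show "integrable lborel (\<lambda>x. (norm (f x))\<^sup>2 / 2 + (LINT y|lborel. \<phi> (x - y) * (norm (f y))\<^sup>2) / 2)"
      using u C(1) by simp
    show "integrable lborel (\<lambda>x. f x \<bullet> fourier_integral h (- x))"
    proof (rule Bochner_Integration.integrable_bound)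
      show "integrable lborel (\<lambda>x. norm (f x) * (LINT x|lborel. norm (h x)))" using f(1) by simp
      show "AE x in lborel. norm (f x \<bullet> fourier_integral h (- x)) \<le> norm (norm (f x) * (LINT x|lborel. norm (h x)))"
      proof (rule AE_I2)
        fix x
        have "norm (f x \<bullet> fourier_integral h (- x)) \<le> norm (f x) * norm (fourier_integral h (- x))"
          by (simp add: Cauchy_Schwarz_ineq2)
        also have "\<dots> \<le> norm (f x) * (LINT x|lborel. norm (h x))"
          by (intro mult_left_mono norm_fourier_integral_le) simp
        finally show "norm (f x \<bullet> fourier_integral h (- x)) \<le> norm (norm (f x) * (LINT x|lborel. norm (h x)))" by simp
      qed
    qed measurable
  qed
  also have "\<dots> = sq_int f"
    using u C by (simp add: sq_int_def)
  finally show "(LINT \<xi>|lborel. exp (- pi * s\<^sup>2 * (norm \<xi>)\<^sup>2) * (norm (fourier_integral f \<xi>))\<^sup>2) \<le> sq_int f" .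
qed

text \<open>The damped bounds are uniform in the width of the Gaussian, so Fatou's lemma removes the
  damping.\<close>

lemma fourier_integral_L2:
  assumes f: "integrable lborel f" "f \<in> L2"
  shows "fourier_integral f \<in> L2" and "sq_int (fourier_integral f) \<le> sq_int f"
proof -
  have [measurable]: "f \<in> borel_measurable borel" using f by auto
  define r where "r n = 1 / real (Suc n)" for n
  have r: "r n > 0" "r \<longlonglongrightarrow> 0" for n
    unfolding r_def using LIMSEQ_inverse_real_of_nat by (simp_all add: inverse_eq_divide)
  \<comment> \<open>The square root of the Gaussian appears because the damped estimate weights the
    squared norm.\<close>
  define u where "u n \<xi> = sqrt (exp (- pi * (r n)\<^sup>2 * (norm \<xi>)\<^sup>2)) *\<^sub>R fourier_integral f \<xi>" for n \<xi>
  have [measurable]: "u n \<in> borel_measurable borel" for n unfolding u_def by measurable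
  have sq: "(norm (u n \<xi>))\<^sup>2 = exp (- pi * (r n)\<^sup>2 * (norm \<xi>)\<^sup>2) * (norm (fourier_integral f \<xi>))\<^sup>2" for n \<xi>
    by (simp add: u_def power_mult_distrib)
  have L: "u n \<in> L2" for n
    by (rule L2I) (use fourier_integral_damped_sq(1)[OF r(1) f] in \<open>simp_all add: sq\<close>)
  have N: "sq_int (u n) \<le> sq_int f" for n
    unfolding sq_int_def sq using fourier_integral_damped_sq(2)[OF r(1) f] by (simp add: sq_int_def)
  have lim: "(\<lambda>n. u n \<xi>) \<longlonglongrightarrow> fourier_integral f \<xi>" for \<xi>
  proof -
    have "(\<lambda>n. u n \<xi>) \<longlonglongrightarrow> sqrt (exp (- pi * 0\<^sup>2 * (norm \<xi>)\<^sup>2)) *\<^sub>R fourier_integral f \<xi>"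
      unfolding u_def by (intro tendsto_intros r(2))
    then show ?thesis by simp
  qed
  show "fourier_integral f \<in> L2" "sq_int (fourier_integral f) \<le> sq_int f"
    using L2_Fatou[of u "fourier_integral f" "sq_int f"] L N lim by simp_all
qed

subsection \<open>Extension by continuity\<close>

text \<open>Extension of a bounded linear operator from a dense subspace, for the Fourier and the
  Hilbert transformation alike. Linearity is asked only almost everywhere, since for principal
  values it is obtained from the comparison with the Fourier multiplier.\<close>

locale L2_bounded_operator =
  fixes D :: "(real^3 \<Rightarrow> cquat) set" and T :: "(real^3 \<Rightarrow> cquat) \<Rightarrow> real^3 \<Rightarrow> cquat" and C :: real
  assumes D_L2: "f \<in> D \<Longrightarrow> f \<in> L2"
    and D_dense: "f \<in> L2 \<Longrightarrow> \<exists>s. (\<forall>n. s n \<in> D) \<and> L2_tendsto s f"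
    and D_add: "f \<in> D \<Longrightarrow> g \<in> D \<Longrightarrow> (\<lambda>x. f x + g x) \<in> D"
    and D_scale: "f \<in> D \<Longrightarrow> (\<lambda>x. c *s f x) \<in> D"
    and T_L2: "f \<in> D \<Longrightarrow> T f \<in> L2"
    and T_add: "f \<in> D \<Longrightarrow> g \<in> D \<Longrightarrow> T (\<lambda>x. f x + g x) =\<^sub>a\<^sub>e (\<lambda>x. T f x + T g x)"
    and T_scale: "f \<in> D \<Longrightarrow> T (\<lambda>x. c *s f x) =\<^sub>a\<^sub>e (\<lambda>x. c *s T f x)"
    and T_bounded: "f \<in> D \<Longrightarrow> sq_int (T f) \<le> C * sq_int f"
    and C_nonneg: "0 \<le> C"
begin

lemma T_diff_bounded:
  assumes "f \<in> D" "g \<in> D"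
  shows "sq_int (\<lambda>x. T f x - T g x) \<le> C * sq_int (\<lambda>x. f x - g x)"
proof -
  have g': "(\<lambda>x. (-1) *s g x) \<in> D" by (rule D_scale[OF assms(2)])
  have d: "(\<lambda>x. f x - g x) \<in> D" using D_add[OF assms(1) g'] by simp
  note [measurable] = L2_measurable[OF T_L2[OF assms(1)]] L2_measurable[OF T_L2[OF assms(2)]] L2_measurable[OF T_L2[OF d]]
  have "T (\<lambda>x. f x - g x) =\<^sub>a\<^sub>e (\<lambda>x. T f x - T g x)"
    using T_add[OF assms(1) g'] T_scale[OF assms(2), of "-1"] by eventually_elim simp
  then have "sq_int (\<lambda>x. T f x - T g x) = sq_int (T (\<lambda>x. f x - g x))"
    by (intro sq_int_cong_AE) auto
  then show ?thesis using T_bounded[OF d] by simp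
qed

text \<open>\<open>L2_extension\<close> picks some limit along some sequence t. Completeness shows
  that there is something to pick, and boundedness applied to the differences of s and t shows that
  every other approximating sequence s leads to the same limit.\<close>

lemma extension_tendsto:
  assumes s: "\<And>n. s n \<in> D" and sf: "L2_tendsto s f"
  shows "L2_tendsto (\<lambda>n. T (s n)) (L2_extension D T f)"
proof -
  note S = L2_tendstoD[OF sf]
  have "\<exists>g. L2_tendsto (\<lambda>n. T (s n)) g"
  proof (rule L2_complete)
    show "T (s n) \<in> L2" for n by (rule T_L2[OF s])
    fix e :: real assume e: "e > 0"
    \<comment> \<open>The 4 absorbs the two factors 2 of the triangle inequality for two terms below
      d; C + 1 keeps the denominator positive when C = 0.\<close>
    define d where "d = e / (4 * (C + 1))"
    have d: "d > 0" "C * (4 * d) \<le> e" using e C_nonneg by (simp_all add: d_def field_simps)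
    from order_tendstoD(2)[OF S(3) d(1)] obtain N where N: "\<And>n. n \<ge> N \<Longrightarrow> sq_int (\<lambda>x. s n x - f x) < d"
      by (auto simp: eventually_sequentially)
    have "sq_int (\<lambda>x. T (s m) x - T (s n) x) \<le> e" if "m \<ge> N" "n \<ge> N" for m n
    proof -
      have "sq_int (\<lambda>x. s m x - s n x) \<le> 2 * sq_int (\<lambda>x. s m x - f x) + 2 * sq_int (\<lambda>x. f x - s n x)"
        by (rule sq_int_triangle[OF S(1,2,1)])
      also have "\<dots> \<le> 4 * d"
        using N[OF that(1)] N[OF that(2)] by (simp add: sq_int_commute[of f])
      finally have "C * sq_int (\<lambda>x. s m x - s n x) \<le> C * (4 * d)"
        using C_nonneg by (rule mult_left_mono)
      with T_diff_bounded[OF s s, of m n] d(2) show ?thesis by linarith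
    qed
    then show "\<exists>N. \<forall>m\<ge>N. \<forall>n\<ge>N. sq_int (\<lambda>x. T (s m) x - T (s n) x) \<le> e" by blast
  qed
  with s sf have "\<exists>g s. (\<forall>n. s n \<in> D) \<and> L2_tendsto s f \<and> L2_tendsto (\<lambda>n. T (s n)) g" by blast
  from someI_ex[OF this] obtain t where t: "\<And>n. t n \<in> D" "L2_tendsto t f"
    and tg: "L2_tendsto (\<lambda>n. T (t n)) (L2_extension D T f)"
    unfolding L2_extension_def[symmetric] by blast
  note TT = L2_tendstoD[OF t(2)] and TG = L2_tendstoD[OF tg]
  show ?thesis
  proof (rule L2_tendsto_bound)
    show "T (s n) \<in> L2" "L2_extension D T f \<in> L2" for n using T_L2[OF s] TG by auto
    show "sq_int (\<lambda>x. T (s n) x - L2_extension D T f x)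
        \<le> 2 * (C * (2 * sq_int (\<lambda>x. s n x - f x) + 2 * sq_int (\<lambda>x. t n x - f x)))
          + 2 * sq_int (\<lambda>x. T (t n) x - L2_extension D T f x)" for n
    proof -
      have "sq_int (\<lambda>x. s n x - t n x) \<le> 2 * sq_int (\<lambda>x. s n x - f x) + 2 * sq_int (\<lambda>x. t n x - f x)"
        using sq_int_triangle[OF S(1,2) TT(1)] by (simp add: sq_int_commute[of f])
      from order_trans[OF T_diff_bounded[OF s t(1)] mult_left_mono[OF this C_nonneg]]
      show ?thesis
        using sq_int_triangle[OF T_L2[OF s] T_L2[OF t(1)] TG(2), of n n] by linarith
    qed
    have "(\<lambda>n. 2 * (C * (2 * sq_int (\<lambda>x. s n x - f x) + 2 * sq_int (\<lambda>x. t n x - f x)))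
          + 2 * sq_int (\<lambda>x. T (t n) x - L2_extension D T f x)) \<longlonglongrightarrow> 2 * (C * (2 * 0 + 2 * 0)) + 2 * 0"
      by (intro tendsto_intros S TT TG)
    then show "(\<lambda>n. 2 * (C * (2 * sq_int (\<lambda>x. s n x - f x) + 2 * sq_int (\<lambda>x. t n x - f x)))
          + 2 * sq_int (\<lambda>x. T (t n) x - L2_extension D T f x)) \<longlonglongrightarrow> 0" by simp
  qed
qed

lemma extension_L2: "f \<in> L2 \<Longrightarrow> L2_extension D T f \<in> L2"
  using D_dense extension_tendsto L2_tendstoD(2) by blast

lemma extension_eq: "f \<in> D \<Longrightarrow> L2_extension D T f =\<^sub>a\<^sub>e T f"
  using extension_tendsto[of "\<lambda>n. f" f] L2_tendsto_const[OF D_L2] L2_tendsto_unique L2_tendsto_const[OF T_L2] by blast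

lemma extension_add:
  assumes "f \<in> L2" "g \<in> L2"
  shows "L2_extension D T (\<lambda>x. f x + g x) =\<^sub>a\<^sub>e (\<lambda>x. L2_extension D T f x + L2_extension D T g x)"
proof -
  obtain s t where s: "\<And>n. s n \<in> D" "L2_tendsto s f" and t: "\<And>n. t n \<in> D" "L2_tendsto t g"
    using D_dense[OF assms(1)] D_dense[OF assms(2)] by blast
  have st: "(\<lambda>x. s n x + t n x) \<in> D" for n by (intro D_add s t)
  have 1: "L2_tendsto (\<lambda>n. T (\<lambda>x. s n x + t n x)) (L2_extension D T (\<lambda>x. f x + g x))"
    by (rule extension_tendsto[OF st L2_tendsto_add[OF s(2) t(2)]])
  have 2: "L2_tendsto (\<lambda>n x. T (s n) x + T (t n) x) (\<lambda>x. L2_extension D T f x + L2_extension D T g x)"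
    by (intro L2_tendsto_add extension_tendsto s t)
  have "L2_tendsto (\<lambda>n. T (\<lambda>x. s n x + t n x)) (\<lambda>x. L2_extension D T f x + L2_extension D T g x)"
    by (rule L2_tendsto_cong_AE[OF 2 L2_measurable[OF T_L2[OF st]] T_add[OF s(1) t(1)] L2_measurable[OF L2_tendstoD(2)[OF 2]]]) simp
  from L2_tendsto_unique[OF 1 this] show ?thesis .
qed

lemma extension_scale:
  assumes "f \<in> L2"
  shows "L2_extension D T (\<lambda>x. c *s f x) =\<^sub>a\<^sub>e (\<lambda>x. c *s L2_extension D T f x)"
proof -
  obtain s where s: "\<And>n. s n \<in> D" "L2_tendsto s f"
    using D_dense[OF assms(1)] by blast
  have st: "(\<lambda>x. c *s s n x) \<in> D" for n by (intro D_scale s)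
  have 1: "L2_tendsto (\<lambda>n. T (\<lambda>x. c *s s n x)) (L2_extension D T (\<lambda>x. c *s f x))"
    by (rule extension_tendsto[OF st L2_tendsto_complex_scale[OF s(2)]])
  have 2: "L2_tendsto (\<lambda>n x. c *s T (s n) x) (\<lambda>x. c *s L2_extension D T f x)"
    by (intro L2_tendsto_complex_scale extension_tendsto s)
  have "L2_tendsto (\<lambda>n. T (\<lambda>x. c *s s n x)) (\<lambda>x. c *s L2_extension D T f x)"
    by (rule L2_tendsto_cong_AE[OF 2 L2_measurable[OF T_L2[OF st]] T_scale[OF s(1)] L2_measurable[OF L2_tendstoD(2)[OF 2]]]) simp
  from L2_tendsto_unique[OF 1 this] show ?thesis .
qed

text \<open>Approximating f by s and the extension by \<open>T (s n)\<close> costs a factor 2 each,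
  hence the constant 4C; it serves for continuity only.\<close>

lemma extension_bounded:
  assumes "f \<in> L2"
  shows "sq_int (L2_extension D T f) \<le> 4 * C * sq_int f"
proof -
  obtain s where s: "\<And>n. s n \<in> D" "L2_tendsto s f"
    using D_dense[OF assms(1)] by blast
  note S = L2_tendstoD[OF s(2)] and E = L2_tendstoD[OF extension_tendsto[OF s]]
  let ?E = "L2_extension D T f"
  let ?b = "\<lambda>n. 2 * (C * (2 * sq_int (\<lambda>x. s n x - f x) + 2 * sq_int f)) + 2 * sq_int (\<lambda>x. T (s n) x - ?E x)"
  have l: "?b \<longlonglongrightarrow> 2 * (C * (2 * 0 + 2 * sq_int f)) + 2 * 0"
    by (intro tendsto_intros S E)
  have "sq_int ?E \<le> ?b n" for n
  proof -
    have "sq_int (s n) \<le> 2 * sq_int (\<lambda>x. s n x - f x) + 2 * sq_int f"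
      using L2_add(2)[OF L2_diff(1)[OF S(1,2)] S(2), of n] by simp
    from order_trans[OF T_bounded[OF s(1)] mult_left_mono[OF this C_nonneg]]
    show ?thesis
      using L2_diff(2)[OF E(1) L2_diff(1)[OF E(1,2)], of n n] by simp
  qed
  with LIMSEQ_le_const[OF l, of "sq_int ?E"] show ?thesis by (simp add: mult.assoc)
qed

lemma extension_diff:
  assumes "f \<in> L2" "g \<in> L2"
  shows "L2_extension D T (\<lambda>x. f x - g x) =\<^sub>a\<^sub>e (\<lambda>x. L2_extension D T f x - L2_extension D T g x)"
  using extension_add[OF assms(1) L2_complex_scale(1)[OF assms(2), of "-1"]] extension_scale[OF assms(2), of "-1"]
  by eventually_elim simp

lemma extension_diff_bounded:
  assumes "f \<in> L2" "g \<in> L2"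
  shows "sq_int (\<lambda>x. L2_extension D T f x - L2_extension D T g x) \<le> 4 * C * sq_int (\<lambda>x. f x - g x)"
proof -
  note d = L2_diff(1)[OF assms]
  have "sq_int (\<lambda>x. L2_extension D T f x - L2_extension D T g x) = sq_int (L2_extension D T (\<lambda>x. f x - g x))"
    using extension_diff[OF assms] L2_measurable[OF extension_L2[OF d]]
      L2_measurable[OF L2_diff(1)[OF extension_L2[OF assms(1)] extension_L2[OF assms(2)]]]
    by (intro sq_int_cong_AE) auto
  then show ?thesis using extension_bounded[OF d] by simp
qed

text \<open>The extension acts on representatives through a choice, so its compatibility with almost
  everywhere equality has to be derived from the bound on differences.\<close>

lemma extension_cong:
  assumes "f \<in> L2" "g \<in> L2" "f =\<^sub>a\<^sub>e g"
  shows "L2_extension D T f =\<^sub>a\<^sub>e L2_extension D T g"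
proof -
  have "sq_int (\<lambda>x. f x - g x) = 0"
    using assms(3) by (simp add: sq_int_eq_0[OF L2_diff(1)[OF assms(1,2)]])
  then have "sq_int (\<lambda>x. L2_extension D T f x - L2_extension D T g x) = 0"
    using extension_diff_bounded[OF assms(1,2)] by (simp add: antisym)
  then show ?thesis
    using sq_int_eq_0[OF L2_diff(1)[OF extension_L2[OF assms(1)] extension_L2[OF assms(2)]]] by simp
qed

lemma extension_continuous:
  assumes "L2_tendsto s f"
  shows "L2_tendsto (\<lambda>n. L2_extension D T (s n)) (L2_extension D T f)"
proof (rule L2_tendsto_bound)
  note S = L2_tendstoD[OF assms]
  show "L2_extension D T (s n) \<in> L2" "L2_extension D T f \<in> L2" for n
    using S extension_L2 by auto
  show "sq_int (\<lambda>x. L2_extension D T (s n) x - L2_extension D T f x) \<le> 4 * C * sq_int (\<lambda>x. s n x - f x)" for n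
    by (rule extension_diff_bounded[OF S(1,2)])
  show "(\<lambda>n. 4 * C * sq_int (\<lambda>x. s n x - f x)) \<longlonglongrightarrow> 0"
    using tendsto_mult_right_zero[OF S(3)] .
qed

end

lemma lipD_integrable:
  assumes f: "f \<in> lipD"
  shows "integrable lborel f"
proof -
  obtain R M where *: "\<And>x. R < norm x \<Longrightarrow> f x = 0" "M > 0" "\<And>x. norm (f x) \<le> M"
    using lipD_bounds[OF f] by metis
  have [measurable]: "f \<in> borel_measurable borel" using lipD_subset_L2[OF f] by simp
  have "integrable lborel (indicator (cball (0::real^3) R) :: _ \<Rightarrow> real)"
    using emeasure_lborel_cball_finite[of "0::real^3" R] by (simp add: integrable_indicator_iff less_top)
  then have "integrable lborel (\<lambda>x. M * indicator (cball (0::real^3) R) x :: real)"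
    by (rule integrable_mult_right)
  then show ?thesis
    by (rule Bochner_Integration.integrable_bound) (use * in \<open>auto intro!: AE_I2 simp: indicator_def not_le\<close>)
qed

interpretation fourier: L2_bounded_operator "{f \<in> L2. integrable lborel f}" fourier_integral 1
  rewrites "L2_extension {f \<in> L2. integrable lborel f} fourier_integral = fourier"
proof -
  show "L2_bounded_operator {f \<in> L2. integrable lborel f} fourier_integral 1"
  proof
    fix f g :: "real^3 \<Rightarrow> cquat" and c
    show "f \<in> L2" if "f \<in> {f \<in> L2. integrable lborel f}"
      using that by simp
    show "\<exists>s. (\<forall>n. s n \<in> {f \<in> L2. integrable lborel f}) \<and> L2_tendsto s f" if f: "f \<in> L2"
    proof -
      obtain s where "\<And>n. s n \<in> lipD" "L2_tendsto s f" using lipschitz_dense[OF f] by metis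
      then show ?thesis using lipD_subset_L2 lipD_integrable by blast
    qed
    show "(\<lambda>x. f x + g x) \<in> {f \<in> L2. integrable lborel f}" "fourier_integral (\<lambda>x. f x + g x) =\<^sub>a\<^sub>e (\<lambda>x. fourier_integral f x + fourier_integral g x)"
      if "f \<in> {f \<in> L2. integrable lborel f}" "g \<in> {f \<in> L2. integrable lborel f}"
      using that L2_add(1)[of f g] fourier_integral_add[of f g] by simp_all
    show "(\<lambda>x. c *s f x) \<in> {f \<in> L2. integrable lborel f}" "fourier_integral (\<lambda>x. c *s f x) =\<^sub>a\<^sub>e (\<lambda>x. c *s fourier_integral f x)"
      "fourier_integral f \<in> L2" "sq_int (fourier_integral f) \<le> 1 * sq_int f"
      if f: "f \<in> {f \<in> L2. integrable lborel f}"
    proof -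
      have "integrable lborel (\<lambda>x. c *s f x)"
        by (rule integrable_bounded_linear[OF bounded_bilinear.bounded_linear_right[OF bounded_bilinear_complex_scale]]) (use f in simp)
      then show "(\<lambda>x. c *s f x) \<in> {f \<in> L2. integrable lborel f}"
        using f L2_complex_scale(1)[of f c] by simp
      show "fourier_integral (\<lambda>x. c *s f x) =\<^sub>a\<^sub>e (\<lambda>x. c *s fourier_integral f x)"
        using f fourier_integral_complex_scale[of f c] by simp
      show "fourier_integral f \<in> L2" "sq_int (fourier_integral f) \<le> 1 * sq_int f"
        using f fourier_integral_L2[of f] by simp_all
    qed
  qed simp
  show "L2_extension {f \<in> L2. integrable lborel f} fourier_integral = fourier"
    by (simp add: fourier_def)
qed

section \<open>Fourier inversion\<close>

lemma L2_uminus_arg: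
  fixes f :: "real^3 \<Rightarrow> 'b::euclidean_space"
  assumes "f \<in> L2"
  shows "(\<lambda>x. f (- x)) \<in> L2" and "sq_int (\<lambda>x. f (- x)) = sq_int f"
proof -
  have [measurable]: "f \<in> borel_measurable borel" using assms by simp
  show "(\<lambda>x. f (- x)) \<in> L2"
    by (rule L2I) (use L2_integrable[OF assms] lborel_integral_uminus(1)[of "\<lambda>x. (norm (f x))\<^sup>2"] in auto)
  show "sq_int (\<lambda>x. f (- x)) = sq_int f"
    unfolding sq_int_def by (rule lborel_integral_uminus(2)[of "\<lambda>x. (norm (f x))\<^sup>2"])
qed

lemma L2_tendsto_uminus_arg:
  assumes "L2_tendsto s f"
  shows "L2_tendsto (\<lambda>n x. s n (- x)) (\<lambda>x. f (- x))"
  using L2_tendstoD[OF assms] L2_uminus_arg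
  by (auto simp: L2_tendsto_iff L2_uminus_arg(2)[OF L2_diff(1)])

text \<open>The substitution y = x + rz fixes the Gaussian and moves the dependence on r into the
  argument of f, where continuity and boundedness allow dominated convergence.\<close>

lemma gaussian_mollifier_tendsto:
  assumes f: "f \<in> lipD" and r: "\<And>n. r n > 0" "r \<longlonglongrightarrow> 0"
  shows "(\<lambda>n. LINT y|lborel. (exp (- pi * (norm (x - y))\<^sup>2 / (r n)\<^sup>2) / (r n)^3) *\<^sub>R f y) \<longlonglongrightarrow> f x"
proof -
  have [measurable]: "f \<in> borel_measurable borel" using lipD_subset_L2[OF f] by simp
  obtain M where M: "M > 0" "\<And>x. norm (f x) \<le> M" using lipD_bounds[OF f] by metis
  have eq: "(LINT y|lborel. (exp (- pi * (norm (x - y))\<^sup>2 / (r n)\<^sup>2) / (r n)^3) *\<^sub>R f y)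
      = (LINT z|lborel. exp (- pi * (norm z)\<^sup>2) *\<^sub>R f (x + r n *\<^sub>R z))" for n
  proof -
    have "(LINT y|lborel. (exp (- pi * (norm (x - y))\<^sup>2 / (r n)\<^sup>2) / (r n)^3) *\<^sub>R f y)
        = (r n)^3 *\<^sub>R (LINT z|lborel. (exp (- pi * (norm (x - (x + r n *\<^sub>R z)))\<^sup>2 / (r n)\<^sup>2) / (r n)^3) *\<^sub>R f (x + r n *\<^sub>R z))"
      using lborel_integral_affine[of "\<lambda>y. (exp (- pi * (norm (x - y))\<^sup>2 / (r n)\<^sup>2) / (r n)^3) *\<^sub>R f y" "r n" x] r(1)[of n]
      by simp
    also have "\<dots> = (LINT z|lborel. (r n)^3 *\<^sub>R ((exp (- pi * (norm (x - (x + r n *\<^sub>R z)))\<^sup>2 / (r n)\<^sup>2) / (r n)^3) *\<^sub>R f (x + r n *\<^sub>R z)))"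
      by (rule integral_scaleR_right[symmetric])
    also have "\<dots> = (LINT z|lborel. exp (- pi * (norm z)\<^sup>2) *\<^sub>R f (x + r n *\<^sub>R z))"
      using r(1)[of n] by (intro Bochner_Integration.integral_cong refl) (simp add: power_mult_distrib)
    finally show ?thesis .
  qed
  have g: "integrable lborel (\<lambda>z::real^3. exp (- pi * (norm z)\<^sup>2))" "(LINT z|lborel. exp (- pi * (norm (z::real^3))\<^sup>2)) = 1"
    using gaussian_kernel[of 1] by simp_all
  have "(\<lambda>n. LINT z|lborel. exp (- pi * (norm z)\<^sup>2) *\<^sub>R f (x + r n *\<^sub>R z)) \<longlonglongrightarrow> (LINT z|lborel. exp (- pi * (norm (z::real^3))\<^sup>2) *\<^sub>R f x)"
  proof (rule integral_dominated_convergence)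
    show "integrable lborel (\<lambda>z::real^3. M * exp (- pi * (norm z)\<^sup>2))" using g(1) by (rule integrable_mult_right)
    have "(\<lambda>n. x + r n *\<^sub>R z) \<longlonglongrightarrow> x + 0 *\<^sub>R z" for z
      by (intro tendsto_intros r(2))
    then have "(\<lambda>n. f (x + r n *\<^sub>R z)) \<longlonglongrightarrow> f (x + 0 *\<^sub>R z)" for z
      by (rule continuous_on_tendsto_compose[OF lipD_continuous[OF f]]) simp_all
    then show "AE z in lborel. (\<lambda>n. exp (- pi * (norm z)\<^sup>2) *\<^sub>R f (x + r n *\<^sub>R z)) \<longlonglongrightarrow> exp (- pi * (norm z)\<^sup>2) *\<^sub>R f x"
      by (auto intro!: tendsto_intros AE_I2)
    show "AE z in lborel. norm (exp (- pi * (norm z)\<^sup>2) *\<^sub>R f (x + r n *\<^sub>R z)) \<le> M * exp (- pi * (norm z)\<^sup>2)" for n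
      using M(2) by (auto intro!: AE_I2 simp: mult.commute mult_right_mono)
  qed measurable
  also have "(LINT z|lborel. exp (- pi * (norm (z::real^3))\<^sup>2) *\<^sub>R f x) = f x"
    using g by simp
  finally show ?thesis unfolding eq .
qed

text \<open>The damped transforms \<open>u n\<close> are integrable, tend to the transform of f in
  L^2, and are transformed into mollifications of f at -x. The L^2 limit of the latter is the double
  transform and the pointwise limit is f(-x), so the two agree.\<close>

lemma fourier_fourier_lipD:
  assumes f: "f \<in> lipD"
  shows "fourier (fourier f) =\<^sub>a\<^sub>e (\<lambda>x. f (- x))"
proof -
  have fi: "integrable lborel f" "f \<in> L2" using lipD_integrable[OF f] lipD_subset_L2[OF f] by auto
  then have [measurable]: "f \<in> borel_measurable borel" by simp
  define r where "r n = 1 / real (Suc n)" for n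
  have r: "r n > 0" "r \<longlonglongrightarrow> 0" for n
    unfolding r_def using LIMSEQ_inverse_real_of_nat by (simp_all add: inverse_eq_divide)
  define u where "u n \<xi> = exp (- pi * (r n)\<^sup>2 * (norm \<xi>)\<^sup>2) *\<^sub>R fourier_integral f \<xi>" for n \<xi>
  have [measurable]: "u n \<in> borel_measurable borel" for n unfolding u_def by measurable
  note F = fourier_integral_L2[OF fi]
  have lim: "L2_tendsto u (fourier_integral f)"
  proof (rule L2_tendsto_dominated[OF F(1), of 1])
    show "AE \<xi> in lborel. (\<lambda>n. u n \<xi>) \<longlonglongrightarrow> fourier_integral f \<xi>"
    proof (rule AE_I2)
      fix \<xi>
      have "(\<lambda>n. u n \<xi>) \<longlonglongrightarrow> exp (- pi * 0\<^sup>2 * (norm \<xi>)\<^sup>2) *\<^sub>R fourier_integral f \<xi>"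
        unfolding u_def by (intro tendsto_intros r(2))
      then show "(\<lambda>n. u n \<xi>) \<longlonglongrightarrow> fourier_integral f \<xi>" by simp
    qed
    show "AE \<xi> in lborel. norm (u n \<xi>) \<le> 1 * norm (fourier_integral f \<xi>)" for n
      by (auto intro!: AE_I2 mult_left_le_one_le simp: u_def)
  qed auto
  have D: "u n \<in> {f \<in> L2. integrable lborel f}" for n
    using L2_tendstoD(1)[OF lim] fourier_integral_gaussian_damped(1)[OF r(1) fi(1)] by (simp add: u_def[abs_def])
  have "L2_tendsto (\<lambda>n. fourier_integral (u n)) (fourier (fourier_integral f))"
    by (rule fourier.extension_tendsto[OF D lim])
  moreover have "AE x in lborel. (\<lambda>n. fourier_integral (u n) x) \<longlonglongrightarrow> f (- x)"
  proof (rule AE_I2)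
    fix x
    have "fourier_integral (u n) x = (LINT y|lborel. (exp (- pi * (norm (- x - y))\<^sup>2 / (r n)\<^sup>2) / (r n)^3) *\<^sub>R f y)" for n
      unfolding u_def using fourier_integral_gaussian_damped(2)[OF r(1) fi(1), of n "- x"] by simp
    then show "(\<lambda>n. fourier_integral (u n) x) \<longlonglongrightarrow> f (- x)"
      using gaussian_mollifier_tendsto[OF f r, of "- x"] by simp
  qed
  ultimately have 1: "(\<lambda>x. f (- x)) =\<^sub>a\<^sub>e fourier (fourier_integral f)"
    by (intro L2_tendsto_AE_eq) auto
  have "fourier f =\<^sub>a\<^sub>e fourier_integral f"
    using fourier.extension_eq fi by simp
  then have "fourier (fourier f) =\<^sub>a\<^sub>e fourier (fourier_integral f)"
    by (intro fourier.extension_cong fourier.extension_L2 fi F)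
  with 1 show ?thesis by eventually_elim simp
qed

theorem fourier_fourier:
  assumes f: "f \<in> L2"
  shows "fourier (fourier f) =\<^sub>a\<^sub>e (\<lambda>x. f (- x))"
proof -
  obtain s where s: "\<And>n. s n \<in> lipD" "L2_tendsto s f" using lipschitz_dense[OF f] by metis
  have 1: "L2_tendsto (\<lambda>n. fourier (fourier (s n))) (fourier (fourier f))"
    by (intro fourier.extension_continuous s)
  note m = L2_tendstoD[OF 1]
  have "L2_tendsto (\<lambda>n. fourier (fourier (s n))) (\<lambda>x. f (- x))"
    by (rule L2_tendsto_cong_AE[OF L2_tendsto_uminus_arg[OF s(2)] L2_measurable[OF m(1)] fourier_fourier_lipD[OF s(1)]])
       (use L2_measurable[OF L2_uminus_arg(1)[OF f]] in simp_all)
  from L2_tendsto_unique[OF 1 this] show ?thesis .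
qed

lemma fourier_inverse:
  assumes f: "f \<in> L2"
  shows "fourier (fourier (\<lambda>x. f (- x))) =\<^sub>a\<^sub>e f"
  using fourier_fourier[OF L2_uminus_arg(1)[OF f]] by simp

text \<open>Reflecting the transform amounts to applying the Fourier transformation twice more, and
  its fourth power is the identity.\<close>

lemma fourier_inverse':
  assumes f: "f \<in> L2"
  shows "fourier (\<lambda>x. fourier f (- x)) =\<^sub>a\<^sub>e f"
proof -
  note L = fourier.extension_L2
  have 1: "(\<lambda>x. fourier f (- x)) =\<^sub>a\<^sub>e fourier (fourier (fourier f))"
    using fourier_fourier[OF L[OF f]] by eventually_elim simp
  have 2: "fourier (\<lambda>x. fourier f (- x)) =\<^sub>a\<^sub>e fourier (fourier (fourier (fourier f)))"
    by (rule fourier.extension_cong[OF _ _ 1]) (intro L L2_uminus_arg f)+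
  have 3: "fourier (fourier (fourier (fourier f))) =\<^sub>a\<^sub>e (\<lambda>x. fourier (fourier f) (- x))"
    by (intro fourier_fourier L f)
  have 4: "(\<lambda>x. fourier (fourier f) (- x)) =\<^sub>a\<^sub>e (\<lambda>x. f (- (- x)))"
    by (rule AE_uminus[OF fourier_fourier[OF f]])
  show ?thesis using 2 3 4 by eventually_elim simp
qed

lemma fourier_injective:
  assumes "f \<in> L2" "g \<in> L2" "fourier f =\<^sub>a\<^sub>e fourier g"
  shows "f =\<^sub>a\<^sub>e g"
proof -
  note L = fourier.extension_L2
  have "fourier (\<lambda>x. fourier f (- x)) =\<^sub>a\<^sub>e fourier (\<lambda>x. fourier g (- x))"
    by (rule fourier.extension_cong[OF _ _ AE_uminus[OF assms(3)]]) (intro L2_uminus_arg L assms)+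
  with fourier_inverse'[OF assms(1)] fourier_inverse'[OF assms(2)] show ?thesis
    by eventually_elim simp
qed

section \<open>The Riesz kernel as a superposition of Gaussians\<close>

text \<open>Cutting off small s gives the multiplier Gaussian decay and bounds the factor s^-5 in
  the kernel; cutting off large s leaves a set of finite measure for Fubini. The successor keeps the
  endpoints positive and finite for n = 0.\<close>

definition riesz_interval :: "nat \<Rightarrow> real set" where
  "riesz_interval n = {1 / real (Suc n) .. real (Suc n)}"

text \<open>A radial profile, to be multiplied by \<i>\<xi>; the Fourier integral of that product is
  x times the profile defined next.\<close>

definition riesz_mult :: "nat \<Rightarrow> real \<Rightarrow> real" where
  "riesz_mult n r = (LINT s|lborel. indicator (riesz_interval n) s * (2 * exp (- pi * s\<^sup>2 * r\<^sup>2)))"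

definition riesz_kernel :: "nat \<Rightarrow> real \<Rightarrow> real" where
  "riesz_kernel n r = (LINT s|lborel. indicator (riesz_interval n) s * (2 * (exp (- pi * r\<^sup>2 / s\<^sup>2) / s^5)))"

lemma riesz_interval_pos: "s \<in> riesz_interval n \<Longrightarrow> 0 < s \<and> 1 / real (Suc n) \<le> s"
  unfolding riesz_interval_def by (auto intro: less_le_trans[of 0 "1 / real (Suc n)"])

lemma riesz_interval_sets [measurable]: "riesz_interval n \<in> sets borel"
  by (simp add: riesz_interval_def)

lemma integrable_riesz_interval: "integrable lborel (indicator (riesz_interval n) :: real \<Rightarrow> real)"
  unfolding riesz_interval_def by (simp add: integrable_indicator_iff emeasure_lborel_Icc_eq)

lemma riesz_interval_eventually:
  assumes "s > 0"
  shows "eventually (\<lambda>n. s \<in> riesz_interval n) sequentially"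
proof -
  obtain N :: nat where N: "s < real N" "1 / s < real N"
    using reals_Archimedean2[of "max s (1/s)"] by auto
  show ?thesis
    using eventually_ge_at_top[of N]
  proof eventually_elim
    fix n assume n: "N \<le> n"
    then have "1 / s < real (Suc n)" "s \<le> real (Suc n)" using N by linarith+
    then show "s \<in> riesz_interval n"
      using assms unfolding riesz_interval_def by (simp add: field_simps)
  qed
qed

text \<open>The one-dimensional Gaussian formula at t = 0, with r in the role of the width
  parameter, gives 1/r on the whole line; by evenness the half line carries half of it, compensated
  by the factor 2.\<close>

lemma half_gaussian:
  assumes r: "r > 0"
  shows "has_bochner_integral lborel (\<lambda>s. indicator {0<..} s * (2 * exp (- pi * s\<^sup>2 * r\<^sup>2))) (1 / r)"
proof -
  define g where "g s = exp (- pi * s\<^sup>2 * r\<^sup>2)" for s :: real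
  have eq: "complex_of_real (g s) = cis (- (2 * pi * 0 * s)) * exp (- pi * r\<^sup>2 * s\<^sup>2)" for s
    by (simp add: g_def mult_ac)
  have gc: "has_bochner_integral lborel (\<lambda>s. complex_of_real (g s)) (complex_of_real (1 / r))"
    unfolding eq using gaussian_fourier_real[OF r, of 0] by simp
  have g: "has_bochner_integral lborel g (1 / r)"
    using has_bochner_integral_bounded_linear[OF bounded_linear_Re gc] by simp
  then have gi: "integrable lborel g" "integral\<^sup>L lborel g = 1 / r" by (auto simp: has_bochner_integral_iff)
  have [measurable]: "g \<in> borel_measurable borel" using gi by auto
  have i: "integrable lborel (\<lambda>s. indicator A s * g s)" if "A \<in> sets borel" for A
    using integrable_mult_indicator[OF _ gi(1), of A] that by simp
  have "(LINT s|lborel. indicator {..<0} s * g s) = (LINT s|lborel. indicator {..<0} (- s) * g (- s))"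
    using lborel_integral_uminus(2)[of "\<lambda>s. indicator {..<0} s * g s"] by simp
  also have "\<dots> = (LINT s|lborel. indicator {0<..} s * g s)"
    by (intro Bochner_Integration.integral_cong refl) (auto simp: g_def indicator_def)
  finally have refl': "(LINT s|lborel. indicator {..<0} s * g s) = (LINT s|lborel. indicator {0<..} s * g s)" .
  have "1 / r = (LINT s|lborel. indicator {..<0} s * g s + indicator {0<..} s * g s)"
    unfolding gi(2)[symmetric]
  proof (rule integral_cong_AE)
    show "AE s in lborel. g s = indicator {..<0} s * g s + indicator {0<..} s * g s"
      using AE_lborel_singleton[of 0] by eventually_elim (auto simp: indicator_def)
  qed measurable
  also have "\<dots> = (LINT s|lborel. indicator {0<..} s * (2 * g s))"
    using i by (subst Bochner_Integration.integral_add) (simp_all add: refl' mult.left_commute)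
  finally have v: "(LINT s|lborel. indicator {0<..} s * (2 * g s)) = 1 / r" ..
  moreover have "integrable lborel (\<lambda>s. indicator {0<..} s * (2 * g s))"
    using integrable_mult_right[OF i[of "{0<..}"], of 2] by (simp add: mult.left_commute)
  ultimately show ?thesis by (simp add: has_bochner_integral_iff g_def[abs_def])
qed

text \<open>The second claim says that the truncated multipliers, of size |\<xi>| times this
  profile, are bounded by 1 uniformly in n; with the limit it feeds dominated convergence on the
  Fourier side.\<close>

lemma riesz_mult_bounds:
  assumes r: "r > 0"
  shows "0 \<le> riesz_mult n r" "riesz_mult n r * r \<le> 1" "(\<lambda>n. riesz_mult n r) \<longlonglongrightarrow> 1 / r"
proof -
  define g where "g s = 2 * exp (- pi * s\<^sup>2 * r\<^sup>2)" for s :: real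
  have h: "integrable lborel (\<lambda>s. indicator {0<..} s * g s)" "(LINT s|lborel. indicator {0<..} s * g s) = 1 / r"
    using half_gaussian[OF r] by (simp_all add: has_bochner_integral_iff g_def[abs_def])
  have g0: "0 \<le> g s" for s by (simp add: g_def)
  have [measurable]: "g \<in> borel_measurable borel" unfolding g_def by measurable
  have le: "indicator (riesz_interval n) s * g s \<le> indicator {0<..} s * g s" for n s
    using riesz_interval_pos[of s n] g0 by (auto simp: indicator_def)
  have m: "riesz_mult n r = (LINT s|lborel. indicator (riesz_interval n) s * g s)" for n
    by (simp add: riesz_mult_def g_def)
  have i: "integrable lborel (\<lambda>s. indicator (riesz_interval n) s * g s)" for n
    by (rule Bochner_Integration.integrable_bound[OF h(1)]) (use le g0 in \<open>auto simp: abs_mult\<close>)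
  show "0 \<le> riesz_mult n r" unfolding m using g0 by (intro Bochner_Integration.integral_nonneg) simp
  have "riesz_mult n r \<le> 1 / r" unfolding m h(2)[symmetric] by (rule integral_mono[OF i h(1) le])
  then show "riesz_mult n r * r \<le> 1" using r by (simp add: field_simps)
  show "(\<lambda>n. riesz_mult n r) \<longlonglongrightarrow> 1 / r"
    unfolding m h(2)[symmetric]
  proof (rule integral_dominated_convergence[OF _ _ h(1)])
    show "AE s in lborel. norm (indicator (riesz_interval n) s * g s) \<le> indicator {0<..} s * g s" for n
      using le g0 by (auto simp: abs_mult)
    show "AE s in lborel. (\<lambda>n. indicator (riesz_interval n) s * g s) \<longlonglongrightarrow> indicator {0<..} s * g s"
    proof (rule AE_I2)
      fix s :: real
      show "(\<lambda>n. indicator (riesz_interval n) s * g s) \<longlonglongrightarrow> indicator {0<..} s * g s"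
      proof (cases "s > 0")
        case True
        have "eventually (\<lambda>n. indicator (riesz_interval n) s * g s = indicator {0<..} s * g s) sequentially"
          using riesz_interval_eventually[OF True] by eventually_elim (use True in simp)
        then show ?thesis by (rule tendsto_eventually)
      next
        case False
        then have "s \<notin> riesz_interval n" for n using riesz_interval_pos by blast
        then show ?thesis using False by simp
      qed
    qed
  qed measurable
qed

lemma borel_measurable_riesz_mult [measurable]: "riesz_mult n \<in> borel_measurable borel"
  unfolding riesz_mult_def[abs_def] by measurable

lemma borel_measurable_riesz_kernel [measurable]: "riesz_kernel n \<in> borel_measurable borel"
  unfolding riesz_kernel_def[abs_def] by measurable

text \<open>
  With \<open>c = \<pi> r\<^sup>2\<close>, an antiderivative of \<open>2 exp (-c/s\<^sup>2) / s\<^sup>5\<close> is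
  \<open>(1 + c/s\<^sup>2) exp (-c/s\<^sup>2) / c\<^sup>2\<close>; it tends to \<open>0\<close> at \<open>0\<close> and to \<open>1/c\<^sup>2\<close> at infinity.
\<close>

lemma riesz_kernel_eq:
  assumes r: "r > 0"
  shows "riesz_kernel n r = ((1 + pi * r\<^sup>2 / (real (Suc n))\<^sup>2) * exp (- (pi * r\<^sup>2 / (real (Suc n))\<^sup>2))
     - (1 + pi * r\<^sup>2 * (real (Suc n))\<^sup>2) * exp (- (pi * r\<^sup>2 * (real (Suc n))\<^sup>2))) / (pi * r\<^sup>2)\<^sup>2"
proof -
  define c where "c = pi * r\<^sup>2"
  have c: "c > 0" using r by (simp add: c_def)
  define G where "G s = (1 + c / s\<^sup>2) * exp (- (c / s\<^sup>2)) / c\<^sup>2" for s :: real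
  define g where "g s = 2 * (exp (- pi * r\<^sup>2 / s\<^sup>2) / s^5)" for s :: real
  have g_alt: "g s = 2 * (exp (- (c / s\<^sup>2)) / s^5)" for s by (simp add: g_def c_def)
  have "riesz_kernel n r = (LINT s|lborel. g s * indicator {1 / real (Suc n) .. real (Suc n)} s)"
    unfolding riesz_kernel_def riesz_interval_def g_def by (simp add: mult.commute)
  also have "\<dots> = G (real (Suc n)) - G (1 / real (Suc n))"
  proof (rule integral_FTC_Icc_real)
    show "1 / real (Suc n) \<le> real (Suc n)"
      using mult_mono[of 1 "real (Suc n)" 1 "real (Suc n)"] by (simp add: field_simps)
    fix s assume "1 / real (Suc n) \<le> s" "s \<le> real (Suc n)"
    then have s: "s > 0" using riesz_interval_pos[of s n] by (simp add: riesz_interval_def)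
    \<comment> \<open>In terms of v the function (1 + v) exp(-v) has derivative -v' v exp(-v),
      because the derivative of the factor 1 + v cancels one summand; here -v' v = 2c^2/s^5.\<close>
    define v where "v s = c / s\<^sup>2" for s :: real
    define w where "w = - 2 * c / s^3"
    have "(v has_real_derivative w) (at s)"
      unfolding v_def w_def using s by (auto intro!: derivative_eq_intros simp: field_simps eval_nat_numeral)
    note dv = this DERIV_chain2[OF DERIV_exp DERIV_minus[OF this]]
    have "((\<lambda>s. (1 + v s) * exp (- v s) / c\<^sup>2) has_real_derivative
        ((0 + w) * exp (- v s) + exp (- v s) * - w * (1 + v s)) / c\<^sup>2) (at s)"
      by (intro DERIV_cdivide DERIV_mult DERIV_add DERIV_const dv)
    also have "(\<lambda>s. (1 + v s) * exp (- v s) / c\<^sup>2) = G"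
      by (simp add: G_def[abs_def] v_def)
    also have "((0 + w) * exp (- v s) + exp (- v s) * - w * (1 + v s)) / c\<^sup>2 = - w * v s / c\<^sup>2 * exp (- v s)"
      by (simp add: algebra_simps)
    also have "- w * v s / c\<^sup>2 = 2 / s^5"
      unfolding w_def v_def using s c by (simp add: field_simps eval_nat_numeral)
    also have "2 / s^5 * exp (- v s) = g s"
      by (simp add: g_alt v_def)
    finally show "DERIV G s :> g s" .
    show "isCont g s" unfolding g_def using s by (intro continuous_intros) auto
  qed
  finally show ?thesis by (simp add: G_def c_def power_divide diff_divide_distrib)
qed

lemma one_plus_exp_minus: "(1 + u) * exp (- u) \<le> (1::real)"
  using exp_ge_add_one_self[of u] by (simp add: exp_minus field_simps)

text \<open>The explicit formula is a difference of two values of k(u) = (1 + u) exp(-u), divided by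
  c^2 = \<pi>^2 r^4. One argument tends to 0, where k is 1, the other to infinity, where k
  vanishes.\<close>

lemma riesz_kernel_bounds:
  assumes r: "r > 0"
  shows "0 \<le> riesz_kernel n r" "riesz_kernel n r \<le> 1 / (pi\<^sup>2 * r^4)" "(\<lambda>n. riesz_kernel n r) \<longlonglongrightarrow> 1 / (pi\<^sup>2 * r^4)"
proof -
  define c where "c = pi * r\<^sup>2"
  have c: "c > 0" using r by (simp add: c_def)
  have c2: "c\<^sup>2 = pi\<^sup>2 * r^4" by (simp add: c_def power_mult_distrib flip: power_mult)
  define k where "k u = (1 + u) * exp (- u)" for u :: real
  have K: "riesz_kernel n r = (k (c / (real (Suc n))\<^sup>2) - k (c * (real (Suc n))\<^sup>2)) / c\<^sup>2" for n
    unfolding riesz_kernel_eq[OF r] k_def c_def ..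
  show "0 \<le> riesz_kernel n r"
    unfolding riesz_kernel_def
    by (rule Bochner_Integration.integral_nonneg) (auto simp: indicator_def dest!: riesz_interval_pos)
  have "k (c / (real (Suc n))\<^sup>2) - k (c * (real (Suc n))\<^sup>2) \<le> 1 - 0"
    using one_plus_exp_minus c by (intro diff_mono) (auto simp: k_def)
  then show "riesz_kernel n r \<le> 1 / (pi\<^sup>2 * r^4)"
    unfolding K c2[symmetric] by (intro divide_right_mono) auto
  have t: "filterlim (\<lambda>n. (real (Suc n))\<^sup>2) at_top sequentially"
    by (intro filterlim_pow_at_top filterlim_compose[OF filterlim_real_sequentially filterlim_Suc]) simp
  have "(\<lambda>n. c / (real (Suc n))\<^sup>2) \<longlonglongrightarrow> 0"
    by (rule tendsto_divide_0[OF tendsto_const filterlim_at_top_imp_at_infinity[OF t]])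
  then have "(\<lambda>n. k (c / (real (Suc n))\<^sup>2)) \<longlonglongrightarrow> (1 + 0) * exp (- 0)"
    unfolding k_def by (intro tendsto_intros)
  then have k1: "(\<lambda>n. k (c / (real (Suc n))\<^sup>2)) \<longlonglongrightarrow> 1" by simp
  have "((\<lambda>u::real. u^0 / exp u + u^1 / exp u) \<longlongrightarrow> 0 + 0) at_top"
    by (intro tendsto_add tendsto_power_div_exp_0)
  moreover have "(\<lambda>u. u^0 / exp u + u^1 / exp u) = k"
    by (simp add: fun_eq_iff k_def exp_minus divide_inverse distrib_right)
  ultimately have "(k \<longlongrightarrow> 0) at_top" by simp
  then have k0: "(\<lambda>n. k (c * (real (Suc n))\<^sup>2)) \<longlonglongrightarrow> 0"
    by (rule filterlim_compose) (rule filterlim_tendsto_pos_mult_at_top[OF tendsto_const c t])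
  have "(\<lambda>n. (k (c / (real (Suc n))\<^sup>2) - k (c * (real (Suc n))\<^sup>2)) / c\<^sup>2) \<longlonglongrightarrow> (1 - 0) / c\<^sup>2"
    using c by (intro tendsto_intros k0 k1) auto
  then show "(\<lambda>n. riesz_kernel n r) \<longlonglongrightarrow> 1 / (pi\<^sup>2 * r^4)"
    unfolding K c2[symmetric] by simp
qed

section \<open>Fourier integral of the truncated multiplier\<close>

lemma riesz_kernel_integrand:
  fixes r s :: real
  shows "\<bar>indicator (riesz_interval n) s * (2 * (exp (- pi * r\<^sup>2 / s\<^sup>2) / s^5))\<bar>
      \<le> indicator (riesz_interval n) s * (2 * real (Suc n)^5)" (is ?le)
    and "integrable lborel (\<lambda>s. indicator (riesz_interval n) s * (2 * (exp (- pi * r\<^sup>2 / s\<^sup>2) / s^5)))"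
proof -
  show le: "\<bar>indicator (riesz_interval n) s * (2 * (exp (- pi * r\<^sup>2 / s\<^sup>2) / s^5))\<bar>
      \<le> indicator (riesz_interval n) s * (2 * real (Suc n)^5)" for s
  proof (cases "s \<in> riesz_interval n")
    case True
    then have s: "s > 0" "1 / real (Suc n) \<le> s" using riesz_interval_pos[of s n] by auto
    then have "1 / s \<le> real (Suc n)" by (simp add: field_simps)
    then have "(1 / s)^5 \<le> real (Suc n)^5" using s by (intro power_mono) auto
    moreover have "exp (- pi * r\<^sup>2 / s\<^sup>2) \<le> 1" using s by simp
    ultimately have "exp (- pi * r\<^sup>2 / s\<^sup>2) * (1 / s)^5 \<le> 1 * real (Suc n)^5"
      using s by (intro mult_mono) auto
    then show ?thesis using True s by (simp add: power_divide abs_mult)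
  qed simp
  have "integrable lborel (\<lambda>s. indicator (riesz_interval n) s * (2 * real (Suc n)^5))"
    by (rule integrable_mult_left[OF integrable_riesz_interval])
  then show "integrable lborel (\<lambda>s. indicator (riesz_interval n) s * (2 * (exp (- pi * r\<^sup>2 / s\<^sup>2) / s^5)))"
    by (rule Bochner_Integration.integrable_bound) (use le in \<open>auto intro!: AE_I2 order_trans[OF le]\<close>)
qed

lemma riesz_kernel_abs_le: "\<exists>B. \<forall>r. \<bar>riesz_kernel n r\<bar> \<le> B"
proof (intro exI allI)
  fix r :: real
  have "\<bar>riesz_kernel n r\<bar> \<le> (LINT s|lborel. \<bar>indicator (riesz_interval n) s * (2 * (exp (- pi * r\<^sup>2 / s\<^sup>2) / s^5))\<bar>)"
    unfolding riesz_kernel_def by (rule integral_abs_bound)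
  also have "\<dots> \<le> (LINT s|lborel. indicator (riesz_interval n) s * (2 * real (Suc n)^5))"
    by (intro integral_mono riesz_kernel_integrand(1) integrable_abs riesz_kernel_integrand(2)
        integrable_mult_left[OF integrable_riesz_interval])
  finally show "\<bar>riesz_kernel n r\<bar> \<le> (LINT s|lborel. indicator (riesz_interval n) s * (2 * real (Suc n)^5))" .
qed

text \<open>The integrals over s and \<xi> are exchanged, after which the inner integral is a
  Gaussian moment for each fixed s.\<close>

lemma riesz_mult_fourier:
  defines "m n \<xi> \<equiv> riesz_mult n (norm \<xi>) *\<^sub>R (\<i> *s pure_quat \<xi>)"
  shows "integrable lborel (m n)" and "fourier_integral (m n) x = riesz_kernel n (norm x) *\<^sub>R pure_quat x"
proof -
  \<comment> \<open>The left endpoint of the interval; its Gaussian in \<xi> is the widest one and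
    dominates those of all other s.\<close>
  define a where "a = 1 / real (Suc n)"
  have a: "a > 0" by (simp add: a_def)
  define h where "h x \<xi> s = (indicator (riesz_interval n) s * 2) *\<^sub>R
      (cis (- (2 * pi * (\<xi> \<bullet> x))) *s (exp (- pi * s\<^sup>2 * (norm \<xi>)\<^sup>2) *\<^sub>R (\<i> *s pure_quat \<xi>)))" for x \<xi> :: "real^3" and s :: real
  have "integrable lborel (\<lambda>\<xi>. norm (cis (- (2 * pi * (\<xi> \<bullet> 0))) *s (exp (- pi * a\<^sup>2 * (norm \<xi>)\<^sup>2) *\<^sub>R (\<i> *s pure_quat \<xi>))))"
    using has_bochner_integral_gaussian_moment[OF a, of 0] by (intro integrable_norm) (simp add: has_bochner_integral_iff)
  then have i1: "integrable lborel (\<lambda>\<xi>::real^3. exp (- pi * a\<^sup>2 * (norm \<xi>)\<^sup>2) * norm \<xi>)"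
    by (simp add: norm_complex_scale norm_pure_quat)
  have i2: "integrable lborel (\<lambda>s. indicator (riesz_interval n) s * (2::real))"
    by (rule integrable_mult_left[OF integrable_riesz_interval])
  have m: "(\<lambda>(\<xi>, s). h x \<xi> s) \<in> borel_measurable (lborel \<Otimes>\<^sub>M lborel)" for x
    unfolding h_def by measurable
  have b: "norm (h x \<xi> s) \<le> (exp (- pi * a\<^sup>2 * (norm \<xi>)\<^sup>2) * norm \<xi>) * (indicator (riesz_interval n) s * 2)" for x \<xi> s
  proof (cases "s \<in> riesz_interval n")
    case True
    then have "a \<le> s" using riesz_interval_pos[of s n] by (auto simp: a_def)
    then have "a\<^sup>2 \<le> s\<^sup>2" using a by (intro power_mono) auto
    then have "a\<^sup>2 * (norm \<xi>)\<^sup>2 \<le> s\<^sup>2 * (norm \<xi>)\<^sup>2" by (intro mult_right_mono) auto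
    then have "pi * (a\<^sup>2 * (norm \<xi>)\<^sup>2) \<le> pi * (s\<^sup>2 * (norm \<xi>)\<^sup>2)" by (intro mult_left_mono) auto
    then have "exp (- pi * s\<^sup>2 * (norm \<xi>)\<^sup>2) \<le> exp (- pi * a\<^sup>2 * (norm \<xi>)\<^sup>2)" by (simp add: mult.assoc)
    then show ?thesis using True by (simp add: h_def norm_complex_scale norm_pure_quat mult_right_mono)
  qed (simp add: h_def)
  have inner: "(LINT s|lborel. h x \<xi> s) = cis (- (2 * pi * (\<xi> \<bullet> x))) *s m n \<xi>" for x \<xi>
  proof -
    have "h x \<xi> s = (indicator (riesz_interval n) s * (2 * exp (- pi * s\<^sup>2 * (norm \<xi>)\<^sup>2))) *\<^sub>R
        (cis (- (2 * pi * (\<xi> \<bullet> x))) *s (\<i> *s pure_quat \<xi>))" for s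
      by (simp add: h_def scaleR_eq_complex_scale mult_ac)
    moreover have "integrable lborel (\<lambda>s. indicator (riesz_interval n) s * (2 * exp (- pi * s\<^sup>2 * (norm \<xi>)\<^sup>2)))"
      by (rule Bochner_Integration.integrable_bound[OF i2]) (auto simp: indicator_def)
    ultimately have "(LINT s|lborel. h x \<xi> s) = riesz_mult n (norm \<xi>) *\<^sub>R (cis (- (2 * pi * (\<xi> \<bullet> x))) *s (\<i> *s pure_quat \<xi>))"
      by (simp add: riesz_mult_def)
    then show ?thesis by (simp add: m_def scaleR_eq_complex_scale mult_ac)
  qed
  show "integrable lborel (m n)"
    using Fubini_bounded(2)[OF i1 i2 m b, of 0] unfolding inner by simp
  have "fourier_integral (m n) x = (LINT \<xi>|lborel. LINT s|lborel. h x \<xi> s)"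
    unfolding fourier_integral_cis inner ..
  also have "\<dots> = (LINT s|lborel. LINT \<xi>|lborel. h x \<xi> s)"
    by (rule Fubini_bounded(1)[OF i1 i2 m b])
  also have "\<dots> = (LINT s|lborel. (indicator (riesz_interval n) s * (2 * (exp (- pi * (norm x)\<^sup>2 / s\<^sup>2) / s^5))) *\<^sub>R pure_quat x)"
  proof (rule Bochner_Integration.integral_cong[OF refl])
    fix s
    show "(LINT \<xi>|lborel. h x \<xi> s) = (indicator (riesz_interval n) s * (2 * (exp (- pi * (norm x)\<^sup>2 / s\<^sup>2) / s^5))) *\<^sub>R pure_quat x"
    proof (cases "s \<in> riesz_interval n")
      case True
      then have "s > 0" using riesz_interval_pos by blast
      from has_bochner_integral_gaussian_moment[OF this, of x] True show ?thesis
        by (simp add: h_def has_bochner_integral_iff)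
    qed (simp add: h_def)
  qed
  also have "\<dots> = riesz_kernel n (norm x) *\<^sub>R pure_quat x"
    unfolding riesz_kernel_def by (rule integral_scaleR_left) (rule riesz_kernel_integrand(2))
  finally show "fourier_integral (m n) x = riesz_kernel n (norm x) *\<^sub>R pure_quat x" .
qed

section \<open>The principal value\<close>

text \<open>
  By Tonelli, since \<open>exp (-\<pi>|z|\<^sup>2) / (\<pi>|z|\<^sup>2)\<close> is the integral of \<open>2s exp (-\<pi>s\<^sup>2|z|\<^sup>2)\<close> over \<open>s \<ge> 1\<close>.
\<close>

lemma integrable_gaussian_over_square:
  "integrable lborel (\<lambda>z::real^3. exp (- pi * (norm z)\<^sup>2) / (pi * (norm z)\<^sup>2))"
proof (rule integrableI_nonneg)
  have F: "(\<integral>\<^sup>+s. ennreal (2 * s * exp (- pi * s\<^sup>2 * r\<^sup>2)) * indicator {1..} s \<partial>lborel)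
      = ennreal (exp (- pi * r\<^sup>2) / (pi * r\<^sup>2))" if r: "r > 0" for r :: real
  proof -
    define c where "c = pi * r\<^sup>2"
    have c: "c > 0" using r by (simp add: c_def)
    have "(\<integral>\<^sup>+s. ennreal (2 * s * exp (- c * s\<^sup>2)) * indicator {1..} s \<partial>lborel) = ennreal (0 - - exp (- c * 1\<^sup>2) / c)"
    proof (rule nn_integral_FTC_atLeast)
      show "((\<lambda>s. - exp (- c * s\<^sup>2) / c) has_real_derivative 2 * s * exp (- c * s\<^sup>2)) (at s)" for s
        using c by (auto intro!: derivative_eq_intros)
      have "LIM s at_top. - c * (s::real)\<^sup>2 :> at_bot"
        by (rule filterlim_tendsto_neg_mult_at_bot[OF tendsto_const])
           (use c filterlim_pow_at_top[OF zero_less_numeral filterlim_ident, of "Num.Bit0 Num.One"] in simp_all)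
      then have "((\<lambda>s. exp (- c * s\<^sup>2)) \<longlongrightarrow> 0) at_top"
        by (rule filterlim_compose[OF exp_at_bot])
      then have "((\<lambda>s. - exp (- c * s\<^sup>2) / c) \<longlongrightarrow> - 0 / c) at_top"
        using c by (intro tendsto_intros) auto
      then show "((\<lambda>s. - exp (- c * s\<^sup>2) / c) \<longlongrightarrow> 0) at_top" by simp
    qed auto
    then show ?thesis by (simp add: c_def mult_ac)
  qed
  have G: "(\<integral>\<^sup>+z. ennreal (exp (- pi * s\<^sup>2 * (norm z)\<^sup>2)) \<partial>(lborel :: (real^3) measure)) = ennreal (1 / s^3)" if s: "s > 0" for s :: real
  proof -
    have s': "1 / s > 0" using s by simp
    have eq: "exp (- pi * s\<^sup>2 * (norm z)\<^sup>2) = (1 / s)^3 * (exp (- pi * (norm z)\<^sup>2 / (1 / s)\<^sup>2) / (1 / s)^3)" for z :: "real^3"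
      using s by (simp add: power_divide mult_ac)
    show ?thesis
      unfolding eq
      by (subst nn_integral_eq_integral)
         (use gaussian_kernel[OF s'] s in \<open>auto intro!: integrable_mult_right simp: power_divide simp del: times_divide_eq_left times_divide_eq_right divide_divide_eq_right\<close>)
  qed
  \<comment> \<open>Integrating over z first leaves 2s times the Gaussian mass s^-3, that is 2/s^2,
    which is integrable on s >= 1.\<close>
  have T: "(\<integral>\<^sup>+s. ennreal (2 * (1 / s\<^sup>2)) * indicator {1..} s \<partial>lborel) = ennreal (0 - - 2 / 1)"
  proof (rule nn_integral_FTC_atLeast)
    show "((\<lambda>s. - 2 / s) has_real_derivative 2 * (1 / s\<^sup>2)) (at s)" if "1 \<le> s" for s :: real
      using that by (auto intro!: derivative_eq_intros simp: power2_eq_square)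
    show "((\<lambda>s. - 2 / s :: real) \<longlongrightarrow> 0) at_top"
      by (rule tendsto_divide_0[OF tendsto_const]) (rule filterlim_at_top_imp_at_infinity[OF filterlim_ident])
  qed auto
  have "(\<integral>\<^sup>+z. ennreal (exp (- pi * (norm z)\<^sup>2) / (pi * (norm z)\<^sup>2)) \<partial>(lborel :: (real^3) measure))
      = (\<integral>\<^sup>+z. (\<integral>\<^sup>+s. ennreal (2 * s * exp (- pi * s\<^sup>2 * (norm z)\<^sup>2)) * indicator {1..} s \<partial>lborel) \<partial>(lborel :: (real^3) measure))"
  proof (rule nn_integral_cong_AE)
    show "AE z in (lborel :: (real^3) measure). ennreal (exp (- pi * (norm z)\<^sup>2) / (pi * (norm z)\<^sup>2))
        = (\<integral>\<^sup>+s. ennreal (2 * s * exp (- pi * s\<^sup>2 * (norm z)\<^sup>2)) * indicator {1..} s \<partial>lborel)"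
      using AE_lborel_singleton[of "0::real^3"] by eventually_elim (rule F[symmetric], simp)
  qed
  also have "\<dots> = (\<integral>\<^sup>+s. (\<integral>\<^sup>+z. ennreal (2 * s * exp (- pi * s\<^sup>2 * (norm z)\<^sup>2)) * indicator {1..} s \<partial>(lborel :: (real^3) measure)) \<partial>lborel)"
    by (rule lborel_pair.Fubini'[symmetric]) measurable
  also have "\<dots> = (\<integral>\<^sup>+s. ennreal (2 * (1 / s\<^sup>2)) * indicator {1..} s \<partial>lborel)"
  proof (rule nn_integral_cong)
    fix s :: real
    show "(\<integral>\<^sup>+z. ennreal (2 * s * exp (- pi * s\<^sup>2 * (norm z)\<^sup>2)) * indicator {1..} s \<partial>(lborel :: (real^3) measure))
        = ennreal (2 * (1 / s\<^sup>2)) * indicator {1..} s"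
    proof (cases "s \<ge> 1")
      case True
      then have "(\<integral>\<^sup>+z. ennreal (2 * s * exp (- pi * s\<^sup>2 * (norm z)\<^sup>2)) * indicator {1..} s \<partial>(lborel :: (real^3) measure))
          = (\<integral>\<^sup>+z. ennreal (2 * s) * ennreal (exp (- pi * s\<^sup>2 * (norm z)\<^sup>2)) \<partial>(lborel :: (real^3) measure))"
        by (intro nn_integral_cong) (simp add: ennreal_mult'[symmetric])
      also have "\<dots> = ennreal (2 * s) * ennreal (1 / s^3)"
        using True by (subst nn_integral_cmult) (simp_all only: G, simp)
      also have "\<dots> = ennreal (2 * s * (1 / s^3))" using True by (simp only: ennreal_mult'[symmetric])
      also have "2 * s * (1 / s^3) = 2 * (1 / s\<^sup>2)" using True by (simp add: field_simps eval_nat_numeral)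
      finally show ?thesis using True by simp
    qed simp
  qed
  also have "\<dots> < \<infinity>" unfolding T by simp
  finally show "(\<integral>\<^sup>+z. ennreal (exp (- pi * (norm z)\<^sup>2) / (pi * (norm z)\<^sup>2)) \<partial>(lborel :: (real^3) measure)) < \<infinity>" .
qed auto

text \<open>On the ball of radius \<rho> the factor exp(\<pi>\<rho>^2 - \<pi>|z|^2) is at least 1,
  which reduces the claim to the Gaussian case.\<close>

lemma integrable_inverse_square_cball:
  "integrable lborel (\<lambda>z::real^3. indicator (cball 0 \<rho>) z / (norm z)\<^sup>2)"
proof (rule Bochner_Integration.integrable_bound)
  show "integrable lborel (\<lambda>z::real^3. (pi * exp (pi * \<rho>\<^sup>2)) * (exp (- pi * (norm z)\<^sup>2) / (pi * (norm z)\<^sup>2)))"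
    by (rule integrable_mult_right[OF integrable_gaussian_over_square])
  show "AE z::real^3 in lborel. norm (indicator (cball 0 \<rho>) z / (norm z)\<^sup>2)
      \<le> norm ((pi * exp (pi * \<rho>\<^sup>2)) * (exp (- pi * (norm z)\<^sup>2) / (pi * (norm z)\<^sup>2)))"
  proof (rule AE_I2)
    fix z :: "real^3"
    have eq: "(pi * exp (pi * \<rho>\<^sup>2)) * (exp (- pi * (norm z)\<^sup>2) / (pi * (norm z)\<^sup>2)) = exp (pi * \<rho>\<^sup>2 - pi * (norm z)\<^sup>2) / (norm z)\<^sup>2"
      by (simp add: exp_diff exp_minus field_simps)
    have "indicator (cball 0 \<rho>) z \<le> exp (pi * \<rho>\<^sup>2 - pi * (norm z)\<^sup>2)"
    proof (cases "norm z \<le> \<rho>")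
      case True
      then have "(norm z)\<^sup>2 \<le> \<rho>\<^sup>2" by (intro power_mono) auto
      then show ?thesis using True by simp
    qed simp
    then have "indicator (cball 0 \<rho>) z / (norm z)\<^sup>2 \<le> exp (pi * \<rho>\<^sup>2 - pi * (norm z)\<^sup>2) / (norm z)\<^sup>2"
      by (rule divide_right_mono) simp
    then show "norm (indicator (cball 0 \<rho>) z / (norm z)\<^sup>2)
      \<le> norm ((pi * exp (pi * \<rho>\<^sup>2)) * (exp (- pi * (norm z)\<^sup>2) / (pi * (norm z)\<^sup>2)))"
      unfolding eq by simp
  qed
  have "cball (0::real^3) \<rho> \<in> sets borel" by simp
  then show "(\<lambda>z::real^3. indicator (cball 0 \<rho>) z / (norm z)\<^sup>2) \<in> borel_measurable lborel"
    by measurable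
qed

text \<open>
  Odd kernels see only \<open>f (x - z) - f (x + z)\<close>, of size \<open>O(|z|)\<close>; this is the common limit of all the
  truncations below.
\<close>

definition pv_limit :: "(real^3 \<Rightarrow> cquat) \<Rightarrow> real^3 \<Rightarrow> cquat" where
  "pv_limit f x = (1/2) *\<^sub>R (LINT z|lborel. (1 / (pi\<^sup>2 * (norm z)^4)) *\<^sub>R (pure_quat z \<odot> (f (x - z) - f (x + z))))"

lemma pure_quat_uminus: "pure_quat (- z) = - pure_quat z"
  by (rule linear_neg[OF linear_pure_quat])

lemma cq_mult_uminus_left: "(- p) \<odot> q = - (p \<odot> q)"
  using bounded_bilinear.minus_left[OF bounded_bilinear_cq_mult] .

lemma cq_mult_diff_right: "p \<odot> (q - r) = p \<odot> q - p \<odot> r"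
  using bounded_bilinear.diff_right[OF bounded_bilinear_cq_mult] .

lemma cq_mult_zero_right: "p \<odot> 0 = 0"
  using bounded_bilinear.zero_right[OF bounded_bilinear_cq_mult] .

text \<open>Stated for general truncated profiles so that the sharp cutoff of the principal value
  and the truncated Gaussian superposition receive the same limit. After symmetrization the
  integrand is at most |z|^-4 |z| 2K|z| / \<pi>^2 = 2K / (\<pi>^2 |z|^2), supported in a ball. The
  bound on each single profile, not uniform in n, makes the individual integrals converge before
  symmetrization.\<close>

lemma truncated_kernel_tendsto:
  assumes f: "f \<in> lipD"
    and [measurable]: "\<And>n. \<kappa> n \<in> borel_measurable borel"
    and bd: "\<And>n. \<exists>B. \<forall>r. \<bar>\<kappa> n r\<bar> \<le> B"
    and pos: "\<And>n r. r > 0 \<Longrightarrow> 0 \<le> \<kappa> n r" and le: "\<And>n r. r > 0 \<Longrightarrow> \<kappa> n r \<le> 1 / (pi\<^sup>2 * r^4)"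
    and lim: "\<And>r. r > 0 \<Longrightarrow> (\<lambda>n. \<kappa> n r) \<longlonglongrightarrow> 1 / (pi\<^sup>2 * r^4)"
  shows "(\<lambda>n. LINT y|lborel. \<kappa> n (norm (x - y)) *\<^sub>R (pure_quat (x - y) \<odot> f y)) \<longlonglongrightarrow> pv_limit f x"
proof -
  have [measurable]: "f \<in> borel_measurable borel" using lipD_subset_L2[OF f] by simp
  obtain R K M where *: "K \<ge> 0" "\<And>x y. norm (f x - f y) \<le> K * norm (x - y)" "R > 0"
    "\<And>x. R < norm x \<Longrightarrow> f x = 0" "M > 0" "\<And>x. norm (f x) \<le> M"
    using lipD_bounds[OF f] by metis
  \<comment> \<open>Beyond this radius both x - z and x + z lie outside the support of f.\<close>
  define \<rho> where "\<rho> = norm x + R"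
  have out: "f (x - z) = 0" "f (x + z) = 0" if "\<rho> < norm z" for z
    using that norm_triangle_ineq2[of z x] norm_triangle_ineq2[of z "- x"]
    by (auto intro!: *(4) simp: \<rho>_def norm_minus_commute add.commute)
  define g where "g n z = \<kappa> n (norm z) *\<^sub>R (pure_quat z \<odot> f (x - z))" for n z
  define d where "d z = pure_quat z \<odot> (f (x - z) - f (x + z))" for z
  have [measurable]: "g n \<in> borel_measurable borel" "d \<in> borel_measurable borel" for n
    unfolding g_def d_def by measurable
  have cb: "integrable lborel (indicator (cball (0::real^3) \<rho>) :: _ \<Rightarrow> real)"
    using emeasure_lborel_cball_finite[of "0::real^3" \<rho>] by (simp add: integrable_indicator_iff less_top)
  have gi: "integrable lborel (g n)" for n
  proof -
    obtain B where B: "\<And>r. \<bar>\<kappa> n r\<bar> \<le> B" using bd[of n] by blast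
    then have "B \<ge> 0" using abs_ge_zero[of "\<kappa> n 0"] order_trans by blast
    show ?thesis
    proof (rule Bochner_Integration.integrable_bound)
      show "integrable lborel (\<lambda>z. (B * (\<rho> * M)) * indicator (cball (0::real^3) \<rho>) z :: real)"
        using cb by (rule integrable_mult_right)
      show "AE z in lborel. norm (g n z) \<le> norm ((B * (\<rho> * M)) * indicator (cball (0::real^3) \<rho>) z :: real)"
      proof (rule AE_I2)
        fix z
        show "norm (g n z) \<le> norm ((B * (\<rho> * M)) * indicator (cball (0::real^3) \<rho>) z :: real)"
        proof (cases "norm z \<le> \<rho>")
          case True
          have "norm (g n z) = \<bar>\<kappa> n (norm z)\<bar> * (norm z * norm (f (x - z)))"
            by (simp add: g_def norm_pure_quat_mult)
          also have "\<dots> \<le> B * (\<rho> * M)"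
            using True B *(5,6) \<open>B \<ge> 0\<close> order_trans[OF norm_ge_zero True] by (intro mult_mono) auto
          also have "\<dots> \<le> norm (B * (\<rho> * M))" by simp
          finally show ?thesis using True by simp
        next
          case False
          then have "f (x - z) = 0" by (intro out) simp
          then show ?thesis by (simp add: g_def cq_mult_zero_right)
        qed
      qed
    qed simp
  qed
  have eq: "(LINT y|lborel. \<kappa> n (norm (x - y)) *\<^sub>R (pure_quat (x - y) \<odot> f y))
      = (1/2) *\<^sub>R (LINT z|lborel. \<kappa> n (norm z) *\<^sub>R d z)" for n
  proof -
    have 1: "(LINT y|lborel. \<kappa> n (norm (x - y)) *\<^sub>R (pure_quat (x - y) \<odot> f y)) = integral\<^sup>L lborel (g n)"
      using lborel_integral_translate(1)[of "g n" x] by (simp add: g_def[abs_def])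
    have gi': "integrable lborel (\<lambda>z. g n (- z))" using gi[of n] by (simp add: lborel_integral_uminus)
    have "integral\<^sup>L lborel (g n) + integral\<^sup>L lborel (g n) = (LINT z|lborel. g n z + g n (- z))"
      using gi gi' lborel_integral_uminus(2)[of "g n"] by simp
    also have "\<dots> = (LINT z|lborel. \<kappa> n (norm z) *\<^sub>R d z)"
      by (intro Bochner_Integration.integral_cong refl)
         (simp add: g_def d_def pure_quat_uminus cq_mult_uminus_left cq_mult_diff_right scaleR_diff_right)
    finally have "2 *\<^sub>R integral\<^sup>L lborel (g n) = (LINT z|lborel. \<kappa> n (norm z) *\<^sub>R d z)"
      by (simp add: scaleR_2)
    then have "(1/2) *\<^sub>R (LINT z|lborel. \<kappa> n (norm z) *\<^sub>R d z) = (1/2) *\<^sub>R (2 *\<^sub>R integral\<^sup>L lborel (g n))" by simp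
    then show ?thesis unfolding 1 by simp
  qed
  have "(\<lambda>n. LINT z|lborel. \<kappa> n (norm z) *\<^sub>R d z) \<longlonglongrightarrow> (LINT z|lborel. (1 / (pi\<^sup>2 * (norm z)^4)) *\<^sub>R d z)"
  proof (rule integral_dominated_convergence)
    show "integrable lborel (\<lambda>z::real^3. (2 * K / pi\<^sup>2) * (indicator (cball 0 \<rho>) z / (norm z)\<^sup>2))"
      by (rule integrable_mult_right[OF integrable_inverse_square_cball])
    show "AE z in lborel. (\<lambda>n. \<kappa> n (norm z) *\<^sub>R d z) \<longlonglongrightarrow> (1 / (pi\<^sup>2 * (norm z)^4)) *\<^sub>R d z"
      using AE_lborel_singleton[of "0::real^3"]
      by eventually_elim (intro tendsto_intros lim, simp)
    show "AE z in lborel. norm (\<kappa> n (norm z) *\<^sub>R d z) \<le> (2 * K / pi\<^sup>2) * (indicator (cball 0 \<rho>) z / (norm z)\<^sup>2)" for n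
      using AE_lborel_singleton[of "0::real^3"]
    proof eventually_elim
      fix z :: "real^3" assume "z \<noteq> 0"
      then have z: "norm z > 0" by simp
      show "norm (\<kappa> n (norm z) *\<^sub>R d z) \<le> (2 * K / pi\<^sup>2) * (indicator (cball 0 \<rho>) z / (norm z)\<^sup>2)"
      proof (cases "norm z \<le> \<rho>")
        case True
        have "norm (f (x - z) - f (x + z)) \<le> K * norm ((x - z) - (x + z))" by (rule *(2))
        also have "(x - z) - (x + z) = - (2 *\<^sub>R z)" by (simp add: scaleR_2)
        finally have fd: "norm (f (x - z) - f (x + z)) \<le> K * (2 * norm z)" by simp
        have "norm (\<kappa> n (norm z) *\<^sub>R d z) = \<kappa> n (norm z) * (norm z * norm (f (x - z) - f (x + z)))"
          using pos[OF z] by (simp add: d_def norm_pure_quat_mult)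
        also have "\<dots> \<le> 1 / (pi\<^sup>2 * (norm z)^4) * (norm z * (K * (2 * norm z)))"
          using z le[OF z] fd *(1) by (intro mult_mono) auto
        also have "\<dots> = (2 * K / pi\<^sup>2) * (1 / (norm z)\<^sup>2)"
          using z by (simp add: field_simps eval_nat_numeral)
        finally show ?thesis using True by simp
      next
        case False
        then have "d z = 0" using out[of z] by (simp add: d_def cq_mult_zero_right)
        then show ?thesis using False by simp
      qed
    qed
  qed measurable
  then have "(\<lambda>n. (1/2) *\<^sub>R (LINT z|lborel. \<kappa> n (norm z) *\<^sub>R d z))
      \<longlonglongrightarrow> (1/2) *\<^sub>R (LINT z|lborel. (1 / (pi\<^sup>2 * (norm z)^4)) *\<^sub>R d z)"
    by (intro tendsto_intros)
  then show ?thesis unfolding eq pv_limit_def d_def .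
qed

text \<open>The one-sided limit is tested along arbitrary positive null sequences, each of which
  gives a sequence of sharp cutoffs. The principal value thus exists as a limit, so that
  \<open>Lim\<close> has its intended meaning.\<close>

lemma hilbert_pv_eq_pv_limit:
  assumes f: "f \<in> lipD"
  shows "hilbert_pv f x = pv_limit f x"
proof -
  let ?I = "\<lambda>\<epsilon>. LINT y:{y. \<epsilon> < norm (x - y)}|lborel. (1 / norm (x - y) ^ 4) *\<^sub>R (pure_quat (x - y) \<odot> f y)"
  have "(?I \<longlongrightarrow> pi\<^sup>2 *\<^sub>R pv_limit f x) (at_right 0)"
  proof (rule tendsto_at_right_sequentially[of 0 1])
    fix S :: "nat \<Rightarrow> real" assume S: "\<And>n. 0 < S n" "S \<longlonglongrightarrow> 0"
    \<comment> \<open>The profile includes the constant 1/\<pi>^2, which in the principal value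
      stands outside the limit; hence the factors \<pi>^2 below.\<close>
    define \<kappa> where "\<kappa> n r = indicator {S n<..} r * (1 / (pi\<^sup>2 * r^4))" for n and r :: real
    have "(\<lambda>n. LINT y|lborel. \<kappa> n (norm (x - y)) *\<^sub>R (pure_quat (x - y) \<odot> f y)) \<longlonglongrightarrow> pv_limit f x"
    proof (rule truncated_kernel_tendsto[OF f])
      show "\<kappa> n \<in> borel_measurable borel" for n unfolding \<kappa>_def by measurable
      show "\<exists>B. \<forall>r. \<bar>\<kappa> n r\<bar> \<le> B" for n
      proof (intro exI allI)
        fix r :: real
        show "\<bar>\<kappa> n r\<bar> \<le> 1 / (pi\<^sup>2 * (S n)^4)"
        proof (cases "S n < r")
          case True
          then have "(S n)^4 \<le> r^4" using S(1)[of n] by (intro power_mono) auto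
          then have "1 / (pi\<^sup>2 * r^4) \<le> 1 / (pi\<^sup>2 * (S n)^4)"
            using S(1)[of n] by (intro divide_left_mono mult_left_mono mult_pos_pos) auto
          then show ?thesis using True S(1)[of n] by (simp add: \<kappa>_def)
        qed (simp add: \<kappa>_def)
      qed
      show "0 \<le> \<kappa> n r" "\<kappa> n r \<le> 1 / (pi\<^sup>2 * r^4)" for n r by (auto simp: \<kappa>_def indicator_def)
      show "(\<lambda>n. \<kappa> n r) \<longlonglongrightarrow> 1 / (pi\<^sup>2 * r^4)" if "r > 0" for r
      proof (rule tendsto_eventually)
        show "eventually (\<lambda>n. \<kappa> n r = 1 / (pi\<^sup>2 * r^4)) sequentially"
          using order_tendstoD(2)[OF S(2) that] by eventually_elim (simp add: \<kappa>_def)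
      qed
    qed
    from tendsto_scaleR[OF tendsto_const[of "pi\<^sup>2"] this]
    have "(\<lambda>n. pi\<^sup>2 *\<^sub>R (LINT y|lborel. \<kappa> n (norm (x - y)) *\<^sub>R (pure_quat (x - y) \<odot> f y))) \<longlonglongrightarrow> pi\<^sup>2 *\<^sub>R pv_limit f x" .
    moreover have "pi\<^sup>2 *\<^sub>R (LINT y|lborel. \<kappa> n (norm (x - y)) *\<^sub>R (pure_quat (x - y) \<odot> f y)) = ?I (S n)" for n
    proof -
      have "pi\<^sup>2 *\<^sub>R (LINT y|lborel. \<kappa> n (norm (x - y)) *\<^sub>R (pure_quat (x - y) \<odot> f y))
          = (LINT y|lborel. pi\<^sup>2 *\<^sub>R (\<kappa> n (norm (x - y)) *\<^sub>R (pure_quat (x - y) \<odot> f y)))"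
        by (rule integral_scaleR_right[symmetric])
      also have "\<dots> = ?I (S n)"
        unfolding set_lebesgue_integral_def
        by (intro Bochner_Integration.integral_cong refl) (simp add: \<kappa>_def indicator_def)
      finally show ?thesis .
    qed
    ultimately show "(\<lambda>n. ?I (S n)) \<longlonglongrightarrow> pi\<^sup>2 *\<^sub>R pv_limit f x" by simp
  qed simp
  then have "Lim (at_right 0) ?I = pi\<^sup>2 *\<^sub>R pv_limit f x"
    by (intro tendsto_Lim) auto
  then show ?thesis by (simp add: hilbert_pv_def)
qed

section \<open>The Hilbert transformation as a Fourier multiplier\<close>

text \<open>
  The multiplier is \<open>-\<i>\<xi>/|\<xi>|\<close>, and it becomes \<open>\<i>\<xi>/|\<xi>|\<close> after the reflection relating \<open>fourier\<close> and its
  inverse.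
\<close>

definition direction_mult :: "(real^3 \<Rightarrow> cquat) \<Rightarrow> real^3 \<Rightarrow> cquat" where
  "direction_mult g \<xi> = \<i> *s (pure_quat (sgn \<xi>) \<odot> g \<xi>)"

lemma norm_direction_mult_le: "norm (direction_mult g \<xi>) \<le> norm (g \<xi>)"
  by (simp add: direction_mult_def norm_complex_scale norm_pure_quat_mult norm_sgn)

lemma L2_direction_mult:
  assumes "g \<in> L2"
  shows "direction_mult g \<in> L2" "sq_int (direction_mult g) \<le> sq_int g"
proof -
  have [measurable]: "g \<in> borel_measurable borel" using assms by simp
  have m: "direction_mult g \<in> borel_measurable borel"
    unfolding direction_mult_def[abs_def] by measurable
  show "direction_mult g \<in> L2" "sq_int (direction_mult g) \<le> sq_int g"
    using L2_dominated[OF assms m, of 1] norm_direction_mult_le[of g] by simp_all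
qed

lemma direction_mult_add: "direction_mult (\<lambda>x. f x + g x) = (\<lambda>x. direction_mult f x + direction_mult g x)"
  by (simp add: direction_mult_def fun_eq_iff cq_mult_bilinear vector_add_ldistrib)

lemma direction_mult_scale: "direction_mult (\<lambda>x. c *s f x) = (\<lambda>x. c *s direction_mult f x)"
  by (simp add: direction_mult_def fun_eq_iff cq_mult_bilinear mult.commute)

text \<open>The square of \<i> and that of a unit vector are both -1. The origin is excepted because
  \<open>sgn 0 = 0\<close>.\<close>

lemma direction_mult_involution: "direction_mult (direction_mult g) =\<^sub>a\<^sub>e g"
  using AE_lborel_singleton[of "0::real^3"]
proof eventually_elim
  fix x :: "real^3" assume "x \<noteq> 0"
  then have "pure_quat (sgn x) \<odot> (pure_quat (sgn x) \<odot> g x) = (- qone) \<odot> g x"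
    unfolding cq_mult_assoc[symmetric] pure_quat_square by (simp add: norm_sgn)
  then show "direction_mult (direction_mult g) x = g x"
    by (simp add: direction_mult_def cq_mult_bilinear cq_mult_uminus_left cq_units)
qed

lemma direction_mult_cong:
  "f =\<^sub>a\<^sub>e g \<Longrightarrow> direction_mult f =\<^sub>a\<^sub>e direction_mult g"
  by (elim eventually_mono) (simp add: direction_mult_def)

lemma L2_tendsto_direction_mult:
  assumes "L2_tendsto s f"
  shows "L2_tendsto (\<lambda>n. direction_mult (s n)) (direction_mult f)"
proof (rule L2_tendsto_bound)
  note S = L2_tendstoD[OF assms]
  show "direction_mult (s n) \<in> L2" "direction_mult f \<in> L2" for n using S by (auto intro: L2_direction_mult)
  show "sq_int (\<lambda>x. direction_mult (s n) x - direction_mult f x) \<le> sq_int (\<lambda>x. s n x - f x)" for n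
    using L2_direction_mult(2)[OF L2_diff(1)[OF S(1,2)], of n]
    by (simp add: direction_mult_def[abs_def] cq_mult_diff_right vector_ssub_ldistrib)
  show "(\<lambda>n. sq_int (\<lambda>x. s n x - f x)) \<longlonglongrightarrow> 0" by (rule S(3))
qed

text \<open>The transform of the reflected function is the inverse Fourier transform, so this is
  \<i>\<omega> conjugated by the Fourier transformation.\<close>

definition hilbert_fourier :: "(real^3 \<Rightarrow> cquat) \<Rightarrow> real^3 \<Rightarrow> cquat" where
  "hilbert_fourier f = fourier (direction_mult (fourier (\<lambda>x. f (- x))))"

lemma hilbert_fourier_L2: "f \<in> L2 \<Longrightarrow> hilbert_fourier f \<in> L2"
  unfolding hilbert_fourier_def
  by (intro fourier.extension_L2 L2_direction_mult L2_uminus_arg)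

text \<open>Each of the two Fourier transformations contributes a factor 4, the bound of the
  extension for C = 1.\<close>

lemma hilbert_fourier_bounded:
  assumes "f \<in> L2"
  shows "sq_int (hilbert_fourier f) \<le> 16 * sq_int f"
proof -
  note R = L2_uminus_arg[OF assms]
  note F = fourier.extension_L2[OF R(1)]
  have "sq_int (hilbert_fourier f) \<le> 4 * sq_int (direction_mult (fourier (\<lambda>x. f (- x))))"
    unfolding hilbert_fourier_def using fourier.extension_bounded[OF L2_direction_mult(1)[OF F]] by simp
  also have "\<dots> \<le> 4 * (4 * sq_int f)"
    using L2_direction_mult(2)[OF F] fourier.extension_bounded[OF R(1)] R(2) by simp
  finally show ?thesis by simp
qed

lemma hilbert_fourier_add:
  assumes "f \<in> L2" "g \<in> L2"
  shows "hilbert_fourier (\<lambda>x. f x + g x) =\<^sub>a\<^sub>e (\<lambda>x. hilbert_fourier f x + hilbert_fourier g x)"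
proof -
  note R = L2_uminus_arg(1)[OF assms(1)] L2_uminus_arg(1)[OF assms(2)]
  note F = R[THEN fourier.extension_L2]
  have "direction_mult (fourier (\<lambda>x. f (- x) + g (- x))) =\<^sub>a\<^sub>e
      (\<lambda>x. direction_mult (fourier (\<lambda>x. f (- x))) x + direction_mult (fourier (\<lambda>x. g (- x))) x)"
    using direction_mult_cong[OF fourier.extension_add[OF R]] unfolding direction_mult_add .
  then have "fourier (direction_mult (fourier (\<lambda>x. f (- x) + g (- x)))) =\<^sub>a\<^sub>e
      fourier (\<lambda>x. direction_mult (fourier (\<lambda>x. f (- x))) x + direction_mult (fourier (\<lambda>x. g (- x))) x)"
    by (intro fourier.extension_cong L2_direction_mult fourier.extension_L2 L2_add R F)
  with fourier.extension_add[OF L2_direction_mult(1)[OF F(1)] L2_direction_mult(1)[OF F(2)]]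
  show ?thesis
    unfolding hilbert_fourier_def by eventually_elim simp
qed

lemma hilbert_fourier_scale:
  assumes "f \<in> L2"
  shows "hilbert_fourier (\<lambda>x. c *s f x) =\<^sub>a\<^sub>e (\<lambda>x. c *s hilbert_fourier f x)"
proof -
  note R = L2_uminus_arg(1)[OF assms(1)]
  note F = R[THEN fourier.extension_L2]
  have "direction_mult (fourier (\<lambda>x. c *s f (- x))) =\<^sub>a\<^sub>e (\<lambda>x. c *s direction_mult (fourier (\<lambda>x. f (- x))) x)"
    using direction_mult_cong[OF fourier.extension_scale[OF R, of c]] unfolding direction_mult_scale .
  then have "fourier (direction_mult (fourier (\<lambda>x. c *s f (- x)))) =\<^sub>a\<^sub>e
      fourier (\<lambda>x. c *s direction_mult (fourier (\<lambda>x. f (- x))) x)"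
    by (intro fourier.extension_cong L2_direction_mult fourier.extension_L2 L2_complex_scale R F)
  with fourier.extension_scale[OF L2_direction_mult(1)[OF F(1)], of c]
  show ?thesis
    unfolding hilbert_fourier_def by eventually_elim simp
qed

lemma hilbert_fourier_continuous:
  "L2_tendsto s f \<Longrightarrow> L2_tendsto (\<lambda>n. hilbert_fourier (s n)) (hilbert_fourier f)"
  unfolding hilbert_fourier_def
  by (intro fourier.extension_continuous L2_tendsto_direction_mult L2_tendsto_uminus_arg)

text \<open>The truncated multipliers times g converge in L^2 to \<i>\<omega>g, and their Fourier
  integrals are convolutions of f with the truncated kernels, which converge at every point to the
  principal value. The limit in L^2 of the latter is the transform of \<i>\<omega>g, so the two
  limits are equal almost everywhere.\<close>

lemma hilbert_pv_eq_hilbert_fourier: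
  assumes f: "f \<in> lipD"
  shows "hilbert_pv f \<in> L2" "hilbert_pv f =\<^sub>a\<^sub>e hilbert_fourier f"
proof -
  have fi: "integrable lborel f" "f \<in> L2" using lipD_integrable[OF f] lipD_subset_L2[OF f] by auto
  then have [measurable]: "f \<in> borel_measurable borel" by simp
  have R: "(\<lambda>x. f (- x)) \<in> L2" "integrable lborel (\<lambda>x. f (- x))"
    using L2_uminus_arg(1)[OF fi(2)] fi(1) by (simp_all add: lborel_integral_uminus)
  \<comment> \<open>The inverse transform of f, here as a genuine integral.\<close>
  define g where "g = fourier_integral (\<lambda>x. f (- x))"
  have g: "g \<in> L2" "g \<xi> = fourier_integral f (- \<xi>)" for \<xi>
    unfolding g_def using fourier_integral_L2[OF R(2,1)] by (simp_all add: fourier_integral_uminus)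
  have [measurable]: "g \<in> borel_measurable borel" using g by simp
  define m where "m n \<xi> = riesz_mult n (norm \<xi>) *\<^sub>R (\<i> *s pure_quat \<xi>)" for n \<xi>
  have [measurable]: "m n \<in> borel_measurable borel" for n unfolding m_def by measurable
  define u where "u n \<xi> = m n \<xi> \<odot> g \<xi>" for n \<xi>
  have mi: "integrable lborel (m n)" and Fm: "fourier_integral (m n) x = riesz_kernel n (norm x) *\<^sub>R pure_quat x" for n x
    using riesz_mult_fourier[of n] by (simp_all add: m_def[abs_def])
  have ui: "integrable lborel (u n)" and Fu: "fourier_integral (u n) x = (LINT y|lborel. fourier_integral (m n) (x - y) \<odot> f y)" for n x
    using fourier_integral_multiplier[OF mi fi(1), of n] by (simp_all add: u_def[abs_def] g(2))
  have u_eq: "u n \<xi> = riesz_mult n (norm \<xi>) *\<^sub>R (\<i> *s (pure_quat \<xi> \<odot> g \<xi>))" for n \<xi>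
    by (simp add: u_def m_def scaleR_eq_complex_scale cq_mult_bilinear)
  have lim: "L2_tendsto u (direction_mult g)"
  proof (rule L2_tendsto_dominated[OF g(1), of 1])
    show "u n \<in> borel_measurable borel" for n unfolding u_def by measurable
    show "direction_mult g \<in> borel_measurable borel" using L2_direction_mult(1)[OF g(1)] by simp
    show "AE \<xi> in lborel. norm (u n \<xi>) \<le> 1 * norm (g \<xi>)" for n
      using AE_lborel_singleton[of "0::real^3"]
    proof eventually_elim
      fix \<xi> :: "real^3" assume "\<xi> \<noteq> 0"
      then have r: "norm \<xi> > 0" by simp
      have "norm (u n \<xi>) = (riesz_mult n (norm \<xi>) * norm \<xi>) * norm (g \<xi>)"
        using riesz_mult_bounds(1)[OF r, of n] by (simp add: u_eq norm_complex_scale norm_pure_quat_mult)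
      also have "\<dots> \<le> 1 * norm (g \<xi>)" by (intro mult_right_mono riesz_mult_bounds(2)[OF r]) simp
      finally show "norm (u n \<xi>) \<le> 1 * norm (g \<xi>)" .
    qed
    show "AE \<xi> in lborel. (\<lambda>n. u n \<xi>) \<longlonglongrightarrow> direction_mult g \<xi>"
      using AE_lborel_singleton[of "0::real^3"]
    proof eventually_elim
      fix \<xi> :: "real^3" assume "\<xi> \<noteq> 0"
      then have r: "norm \<xi> > 0" by simp
      have "(\<lambda>n. u n \<xi>) \<longlonglongrightarrow> (1 / norm \<xi>) *\<^sub>R (\<i> *s (pure_quat \<xi> \<odot> g \<xi>))"
        unfolding u_eq by (intro tendsto_intros riesz_mult_bounds(3)[OF r])
      also have "(1 / norm \<xi>) *\<^sub>R (\<i> *s (pure_quat \<xi> \<odot> g \<xi>)) = direction_mult g \<xi>"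
        by (simp add: direction_mult_def sgn_div_norm linear_cmul[OF linear_pure_quat] scaleR_eq_complex_scale
            cq_mult_bilinear divide_inverse mult.commute)
      finally show "(\<lambda>n. u n \<xi>) \<longlonglongrightarrow> direction_mult g \<xi>" .
    qed
  qed simp
  have D: "u n \<in> {f \<in> L2. integrable lborel f}" for n
    using L2_tendstoD(1)[OF lim] ui by simp
  have F: "L2_tendsto (\<lambda>n. fourier_integral (u n)) (fourier (direction_mult g))"
    by (rule fourier.extension_tendsto[OF D lim])
  have pt: "(\<lambda>n. fourier_integral (u n) x) \<longlonglongrightarrow> hilbert_pv f x" for x
  proof -
    have "(\<lambda>n. LINT y|lborel. riesz_kernel n (norm (x - y)) *\<^sub>R (pure_quat (x - y) \<odot> f y)) \<longlonglongrightarrow> pv_limit f x"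
      by (rule truncated_kernel_tendsto[OF f borel_measurable_riesz_kernel riesz_kernel_abs_le])
         (rule riesz_kernel_bounds; assumption)+
    then show ?thesis
      by (simp add: Fu Fm hilbert_pv_eq_pv_limit[OF f] scaleR_eq_complex_scale cq_mult_bilinear)
  qed
  \<comment> \<open>The definition by \<open>Lim\<close> does not exhibit measurability; it is
    inherited from the measurable functions that converge to the principal value at every
    point.\<close>
  have m: "hilbert_pv f \<in> borel_measurable borel"
    by (rule borel_measurable_LIMSEQ_metric[OF _ pt]) (use L2_tendstoD(1)[OF F] in auto)
  have 1: "hilbert_pv f =\<^sub>a\<^sub>e fourier (direction_mult g)"
    by (rule L2_tendsto_AE_eq[OF F m]) (use pt in simp)
  show "hilbert_pv f \<in> L2"
    by (rule L2_cong_AE[OF L2_tendstoD(2)[OF F] m 1])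
  have "fourier (\<lambda>x. f (- x)) =\<^sub>a\<^sub>e g"
    unfolding g_def using fourier.extension_eq R by simp
  then have "fourier (direction_mult (fourier (\<lambda>x. f (- x)))) =\<^sub>a\<^sub>e fourier (direction_mult g)"
    by (intro fourier.extension_cong direction_mult_cong L2_direction_mult fourier.extension_L2 R g)
  with 1 show "hilbert_pv f =\<^sub>a\<^sub>e hilbert_fourier f"
    unfolding hilbert_fourier_def by eventually_elim simp
qed

text \<open>Linearity and the bound 16 are transported from the multiplier operator through the
  almost everywhere equality on Lipschitz functions.\<close>

interpretation hilbert: L2_bounded_operator lipD hilbert_pv 16
  rewrites "L2_extension lipD hilbert_pv = hilbert"
proof -
  show "L2_bounded_operator lipD hilbert_pv 16"
  proof
    fix f g :: "real^3 \<Rightarrow> cquat" and c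
    show "\<exists>s. (\<forall>n. s n \<in> lipD) \<and> L2_tendsto s f" if "f \<in> L2"
      using lipschitz_dense[OF that] by metis
    show "hilbert_pv (\<lambda>x. f x + g x) =\<^sub>a\<^sub>e (\<lambda>x. hilbert_pv f x + hilbert_pv g x)" if "f \<in> lipD" "g \<in> lipD"
      using hilbert_pv_eq_hilbert_fourier(2)[OF lipD_add[OF that]] hilbert_fourier_add[OF lipD_subset_L2 lipD_subset_L2, OF that]
        hilbert_pv_eq_hilbert_fourier(2)[OF that(1)] hilbert_pv_eq_hilbert_fourier(2)[OF that(2)]
      by eventually_elim simp
    show "hilbert_pv (\<lambda>x. c *s f x) =\<^sub>a\<^sub>e (\<lambda>x. c *s hilbert_pv f x)" if "f \<in> lipD"
      using hilbert_pv_eq_hilbert_fourier(2)[OF lipD_complex_scale[OF that, of c]] hilbert_fourier_scale[OF lipD_subset_L2, OF that, of c]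
        hilbert_pv_eq_hilbert_fourier(2)[OF that]
      by eventually_elim simp
    show "sq_int (hilbert_pv f) \<le> 16 * sq_int f" if "f \<in> lipD"
    proof -
      note L = lipD_subset_L2[OF that]
      have "sq_int (hilbert_pv f) = sq_int (hilbert_fourier f)"
        using hilbert_pv_eq_hilbert_fourier[OF that] hilbert_fourier_L2[OF L] by (intro sq_int_cong_AE) auto
      then show ?thesis using hilbert_fourier_bounded[OF L] by simp
    qed
  qed (auto intro: lipD_subset_L2 lipD_add lipD_complex_scale hilbert_pv_eq_hilbert_fourier(1))
  show "L2_extension lipD hilbert_pv = hilbert"
    by (simp add: hilbert_def)
qed

lemma hilbert_eq_hilbert_fourier:
  assumes f: "f \<in> L2"
  shows "hilbert f =\<^sub>a\<^sub>e hilbert_fourier f"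
proof -
  obtain s where s: "\<And>n. s n \<in> lipD" "L2_tendsto s f" using lipschitz_dense[OF f] by metis
  have 1: "L2_tendsto (\<lambda>n. hilbert_pv (s n)) (hilbert f)"
    by (rule hilbert.extension_tendsto[OF s])
  have 2: "L2_tendsto (\<lambda>n. hilbert_pv (s n)) (hilbert_fourier f)"
    by (rule L2_tendsto_cong_AE[OF hilbert_fourier_continuous[OF s(2)] L2_measurable[OF L2_tendstoD(1)[OF 1]]
          hilbert_pv_eq_hilbert_fourier(2)[OF s(1)] L2_measurable[OF hilbert_fourier_L2[OF f]]]) simp
  show ?thesis by (rule L2_tendsto_unique[OF 1 2])
qed

text \<open>The inner transform in \<open>hilbert_fourier\<close> undoes the one applied to g. In
  this form H is diagonalized by the Fourier transformation.\<close>

lemma hilbert_fourier_image: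
  assumes g: "g \<in> L2"
  shows "hilbert (fourier g) =\<^sub>a\<^sub>e fourier (direction_mult g)"
proof -
  note F = fourier.extension_L2
  have "fourier (direction_mult (fourier (\<lambda>x. fourier g (- x)))) =\<^sub>a\<^sub>e fourier (direction_mult g)"
    by (intro fourier.extension_cong direction_mult_cong fourier_inverse' L2_direction_mult F L2_uminus_arg g)
  with hilbert_eq_hilbert_fourier[OF F[OF g]] show ?thesis
    unfolding hilbert_fourier_def by eventually_elim simp
qed

lemma hilbert_involution:
  assumes f: "f \<in> L2"
  shows "hilbert (hilbert f) =\<^sub>a\<^sub>e f"
proof -
  define g where "g = fourier (\<lambda>x. f (- x))"
  have g: "g \<in> L2" unfolding g_def by (intro fourier.extension_L2 L2_uminus_arg f)
  note D = L2_direction_mult(1)[OF g]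
  have "hilbert f =\<^sub>a\<^sub>e fourier (direction_mult g)"
    using hilbert_eq_hilbert_fourier[OF f] by (simp add: hilbert_fourier_def g_def)
  then have "hilbert (hilbert f) =\<^sub>a\<^sub>e hilbert (fourier (direction_mult g))"
    by (intro hilbert.extension_cong hilbert.extension_L2 fourier.extension_L2 D f)
  moreover have "fourier (direction_mult (direction_mult g)) =\<^sub>a\<^sub>e fourier g"
    by (intro fourier.extension_cong direction_mult_involution L2_direction_mult(1) D g)
  moreover note hilbert_fourier_image[OF D] fourier_inverse[OF f]
  ultimately show ?thesis
    unfolding g_def by eventually_elim simp
qed

section \<open>The eigenspaces of the Hilbert transformation\<close>

text \<open>The scalar is arbitrary: an unknown maximal space has to be placed in some eigenspace
  before its scalar is known to be 1 or -1.\<close>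

definition hilbert_eigenspace :: "complex \<Rightarrow> (real^3 \<Rightarrow> cquat) set" where
  "hilbert_eigenspace \<sigma> = {f \<in> L2. hilbert f =\<^sub>a\<^sub>e (\<lambda>x. \<sigma> *s f x)}"

lemma complex_scale_eq_cancel:
  fixes v :: cquat
  shows "a *s v = b *s v \<Longrightarrow> v \<noteq> 0 \<Longrightarrow> a = b"
  by (auto simp: vec_eq_iff)

lemma fourier_zero: "fourier (\<lambda>x. 0) =\<^sub>a\<^sub>e (\<lambda>x. 0)"
  using fourier.extension_scale[OF L2_zero, of 0] by simp

text \<open>Injectivity of the Fourier transformation turns the eigenvalue equation for H into a
  pointwise algebraic equation for g.\<close>

lemma hilbert_eigenspace_fourier:
  assumes g: "g \<in> L2"
  shows "fourier g \<in> hilbert_eigenspace \<sigma> \<longleftrightarrow> direction_mult g =\<^sub>a\<^sub>e (\<lambda>x. \<sigma> *s g x)"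
proof -
  note L = L2_direction_mult(1)[OF g] L2_complex_scale(1)[OF g, of \<sigma>]
  have H: "hilbert (fourier g) =\<^sub>a\<^sub>e fourier (direction_mult g)"
    and S: "fourier (\<lambda>x. \<sigma> *s g x) =\<^sub>a\<^sub>e (\<lambda>x. \<sigma> *s fourier g x)"
    by (rule hilbert_fourier_image[OF g], rule fourier.extension_scale[OF g])
  have "hilbert (fourier g) =\<^sub>a\<^sub>e (\<lambda>x. \<sigma> *s fourier g x) \<longleftrightarrow> fourier (direction_mult g) =\<^sub>a\<^sub>e fourier (\<lambda>x. \<sigma> *s g x)"
  proof
    assume "hilbert (fourier g) =\<^sub>a\<^sub>e (\<lambda>x. \<sigma> *s fourier g x)"
    with H S show "fourier (direction_mult g) =\<^sub>a\<^sub>e fourier (\<lambda>x. \<sigma> *s g x)" by eventually_elim simp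
  next
    assume "fourier (direction_mult g) =\<^sub>a\<^sub>e fourier (\<lambda>x. \<sigma> *s g x)"
    with H S show "hilbert (fourier g) =\<^sub>a\<^sub>e (\<lambda>x. \<sigma> *s fourier g x)" by eventually_elim simp
  qed
  also have "\<dots> \<longleftrightarrow> direction_mult g =\<^sub>a\<^sub>e (\<lambda>x. \<sigma> *s g x)"
    using fourier_injective[OF L] fourier.extension_cong[OF L] by blast
  finally show ?thesis by (simp add: hilbert_eigenspace_def fourier.extension_L2[OF g])
qed

lemma hilbert_eigenspace_cong:
  assumes "f \<in> hilbert_eigenspace \<sigma>" "g \<in> L2" "g =\<^sub>a\<^sub>e f"
  shows "g \<in> hilbert_eigenspace \<sigma>"
proof -
  have f: "f \<in> L2" "hilbert f =\<^sub>a\<^sub>e (\<lambda>x. \<sigma> *s f x)" using assms(1) by (auto simp: hilbert_eigenspace_def)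
  have "hilbert g =\<^sub>a\<^sub>e (\<lambda>x. \<sigma> *s g x)"
    using f(2) hilbert.extension_cong[OF assms(2) f(1) assms(3)] assms(3) by eventually_elim simp
  then show ?thesis using assms(2) by (simp add: hilbert_eigenspace_def)
qed

lemma hilbert_eigenspace_add:
  assumes "f \<in> hilbert_eigenspace \<sigma>" "g \<in> hilbert_eigenspace \<sigma>"
  shows "(\<lambda>x. f x + g x) \<in> hilbert_eigenspace \<sigma>"
proof -
  have f: "f \<in> L2" "hilbert f =\<^sub>a\<^sub>e (\<lambda>x. \<sigma> *s f x)" and g: "g \<in> L2" "hilbert g =\<^sub>a\<^sub>e (\<lambda>x. \<sigma> *s g x)"
    using assms by (auto simp: hilbert_eigenspace_def)
  have "hilbert (\<lambda>x. f x + g x) =\<^sub>a\<^sub>e (\<lambda>x. \<sigma> *s (f x + g x))"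
    using hilbert.extension_add[OF f(1) g(1)] f(2) g(2) by eventually_elim (simp add: vector_add_ldistrib)
  then show ?thesis using L2_add(1)[OF f(1) g(1)] by (simp add: hilbert_eigenspace_def)
qed

lemma hilbert_eigenspace_scale:
  assumes "f \<in> hilbert_eigenspace \<sigma>"
  shows "(\<lambda>x. c *s f x) \<in> hilbert_eigenspace \<sigma>"
proof -
  have f: "f \<in> L2" "hilbert f =\<^sub>a\<^sub>e (\<lambda>x. \<sigma> *s f x)" using assms by (auto simp: hilbert_eigenspace_def)
  have "hilbert (\<lambda>x. c *s f x) =\<^sub>a\<^sub>e (\<lambda>x. \<sigma> *s (c *s f x))"
    using hilbert.extension_scale[OF f(1), of c] f(2) by eventually_elim (simp add: mult.commute)
  then show ?thesis using L2_complex_scale(1)[OF f(1), of c] by (simp add: hilbert_eigenspace_def)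
qed

lemma hilbert_eigenspace_closed:
  assumes "\<And>n. s n \<in> hilbert_eigenspace \<sigma>" "L2_tendsto s f"
  shows "f \<in> hilbert_eigenspace \<sigma>"
proof -
  have s: "s n \<in> L2" "hilbert (s n) =\<^sub>a\<^sub>e (\<lambda>x. \<sigma> *s s n x)" for n
    using assms(1)[of n] by (auto simp: hilbert_eigenspace_def)
  have f: "f \<in> L2" by (rule L2_tendstoD(2)[OF assms(2)])
  have 1: "L2_tendsto (\<lambda>n. hilbert (s n)) (hilbert f)" by (rule hilbert.extension_continuous[OF assms(2)])
  have "L2_tendsto (\<lambda>n. hilbert (s n)) (\<lambda>x. \<sigma> *s f x)"
    by (rule L2_tendsto_cong_AE[OF L2_tendsto_complex_scale[OF assms(2), of \<sigma>] L2_measurable[OF L2_tendstoD(1)[OF 1]] s(2)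
          L2_measurable[OF L2_complex_scale(1)[OF f]]]) simp
  from L2_tendsto_unique[OF 1 this] f show ?thesis by (simp add: hilbert_eigenspace_def)
qed

lemma hilbert_eigenspace_zero: "(\<lambda>x. 0) \<in> hilbert_eigenspace \<sigma>"
  using hilbert.extension_scale[OF L2_zero, of 0] by (simp add: hilbert_eigenspace_def L2_zero)

lemma hilbert_eigenspace_scalar_invariant: "scalar_invariant hilbert (hilbert_eigenspace \<sigma>)"
  unfolding scalar_invariant_def L2_subspace_def
proof (intro conjI ballI allI impI)
  show "hilbert f \<in> hilbert_eigenspace \<sigma>" if "f \<in> hilbert_eigenspace \<sigma>" for f
    by (rule hilbert_eigenspace_cong[OF hilbert_eigenspace_scale[OF that, of \<sigma>]])
       (use that in \<open>auto simp: hilbert_eigenspace_def intro: hilbert.extension_L2\<close>)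
  show "\<exists>c. \<forall>f\<in>hilbert_eigenspace \<sigma>. hilbert f =\<^sub>a\<^sub>e (\<lambda>x. c *s f x)"
    by (auto simp: hilbert_eigenspace_def)
  show "f \<in> hilbert_eigenspace \<sigma>" if "(\<forall>n. s n \<in> hilbert_eigenspace \<sigma>) \<and> L2_tendsto s f" for s f
    using that hilbert_eigenspace_closed by blast
  show "hilbert_eigenspace \<sigma> \<subseteq> L2" by (auto simp: hilbert_eigenspace_def)
qed (fact hilbert_eigenspace_zero hilbert_eigenspace_add hilbert_eigenspace_scale)+

section \<open>Maximality of the eigenspaces and the decomposition of L^2\<close>

lemma scalar_invariant_eigenvalue:
  "scalar_invariant T V \<Longrightarrow> V \<subseteq> L2 \<and> (\<exists>c. \<forall>f\<in>V. T f =\<^sub>a\<^sub>e (\<lambda>x. c *s f x))"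
  unfolding scalar_invariant_def L2_subspace_def by blast

lemma hilbert_eigenvalue_unique:
  assumes "f \<in> hilbert_eigenspace \<sigma>" "hilbert f =\<^sub>a\<^sub>e (\<lambda>x. c *s f x)" "\<not> f =\<^sub>a\<^sub>e (\<lambda>x. 0)"
  shows "c = \<sigma>"
proof (rule ccontr)
  assume "c \<noteq> \<sigma>"
  have "hilbert f =\<^sub>a\<^sub>e (\<lambda>x. \<sigma> *s f x)" using assms(1) by (simp add: hilbert_eigenspace_def)
  with assms(2) have "f =\<^sub>a\<^sub>e (\<lambda>x. 0)"
    by eventually_elim (use \<open>c \<noteq> \<sigma>\<close> complex_scale_eq_cancel in metis)
  with assms(3) show False by simp
qed

text \<open>
  For \<open>\<sigma>\<^sup>2 = 1\<close> the function \<open>h + \<sigma> \<i>\<omega>h\<close> lies in the eigenspace; with \<open>h\<close> real scalar it cannot vanish, as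
  \<open>\<omega>h\<close> has no scalar part.
\<close>

lemma hilbert_eigenspace_nonzero:
  assumes \<sigma>: "\<sigma> * \<sigma> = 1"
  shows "\<exists>f\<in>hilbert_eigenspace \<sigma>. \<not> f =\<^sub>a\<^sub>e (\<lambda>x. 0)"
proof -
  define h :: "real^3 \<Rightarrow> cquat" where "h x = indicator (cball 0 1) x *\<^sub>R qone" for x
  have nq: "norm qone = 1"
    by (simp add: norm_vec_def L2_set_def sum_4 qone_def)
  have "h \<in> borel_measurable borel"
    unfolding h_def[abs_def] by (intro borel_measurable_scaleR borel_measurable_indicator) auto
  then have h: "h \<in> L2"
    by (rule L2_dominated(1)[OF L2_indicator_cball[of 1], of _ 1]) (auto simp: h_def nq)
  define g where "g x = h x + \<sigma> *s direction_mult h x" for x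
  note D = L2_direction_mult(1)[OF h]
  have g: "g \<in> L2" unfolding g_def by (intro L2_add L2_complex_scale D h)
  have "direction_mult g =\<^sub>a\<^sub>e (\<lambda>x. \<sigma> *s g x)"
  proof -
    have "direction_mult g = (\<lambda>x. direction_mult h x + \<sigma> *s direction_mult (direction_mult h) x)"
      unfolding g_def[abs_def] direction_mult_add direction_mult_scale ..
    with direction_mult_involution[of h] show ?thesis
      by (auto elim!: eventually_mono simp: g_def vector_add_ldistrib \<sigma>)
  qed
  then have E: "fourier g \<in> hilbert_eigenspace \<sigma>" by (simp add: hilbert_eigenspace_fourier[OF g])
  have "\<not> fourier g =\<^sub>a\<^sub>e (\<lambda>x. 0)"
  proof
    assume "fourier g =\<^sub>a\<^sub>e (\<lambda>x. 0)"
    with fourier_zero have "fourier g =\<^sub>a\<^sub>e fourier (\<lambda>x. 0)" by eventually_elim simp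
    from fourier_injective[OF g L2_zero this] have "AE x in lborel. x \<notin> cball (0::real^3) 1"
    proof eventually_elim
      fix x assume "g x = 0"
      then have "g x $ 1 = 0" by simp
      then show "x \<notin> cball 0 1"
        by (auto simp: g_def h_def direction_mult_def cq_mult_def pure_quat_def qone_def e1_def e2_def e3_def indicator_def split: if_splits)
    qed
    then have "emeasure lborel (cball (0::real^3) 1) = 0"
      by (subst (asm) AE_iff_measurable[of "cball 0 1"]) auto
    moreover have "measure lborel (cball (0::real^3) 1) > 0"
      by (rule content_cball_pos) simp
    ultimately show False by (simp add: measure_def)
  qed
  with E show ?thesis by blast
qed

text \<open>A nonzero eigenfunction lies in every larger space and fixes the scalar of that space,
  which is therefore contained in the same eigenspace.\<close>

lemma hilbert_eigenspace_maximal: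
  assumes \<sigma>: "\<sigma> * \<sigma> = 1"
  shows "maximal_invariant hilbert (hilbert_eigenspace \<sigma>)"
  unfolding maximal_invariant_def
proof (intro conjI allI impI hilbert_eigenspace_scalar_invariant)
  fix W assume W: "scalar_invariant hilbert W \<and> hilbert_eigenspace \<sigma> \<subseteq> W"
  then obtain c where c: "\<And>f. f \<in> W \<Longrightarrow> hilbert f =\<^sub>a\<^sub>e (\<lambda>x. c *s f x)" and L: "W \<subseteq> L2"
    using scalar_invariant_eigenvalue by blast
  obtain f where f: "f \<in> hilbert_eigenspace \<sigma>" "\<not> f =\<^sub>a\<^sub>e (\<lambda>x. 0)"
    using hilbert_eigenspace_nonzero[OF \<sigma>] by blast
  have "c = \<sigma>" using hilbert_eigenvalue_unique[OF f(1) _ f(2)] c W f(1) by blast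
  then show "W = hilbert_eigenspace \<sigma>" using W c L by (auto simp: hilbert_eigenspace_def)
qed

lemma hilbert_eigenspace_independent: "L2_independent (hilbert_eigenspace 1) (hilbert_eigenspace (- 1))"
  unfolding L2_independent_def
proof
  fix f assume "f \<in> hilbert_eigenspace 1 \<inter> hilbert_eigenspace (- 1)"
  then have "f \<in> hilbert_eigenspace 1" "hilbert f =\<^sub>a\<^sub>e (\<lambda>x. (- 1) *s f x)"
    by (simp_all add: hilbert_eigenspace_def)
  from hilbert_eigenvalue_unique[OF this] show "f =\<^sub>a\<^sub>e (\<lambda>x. 0)" by auto
qed

text \<open>The projections of an involution: f is the sum of (f + Hf)/2 and (f - Hf)/2.\<close>

lemma hilbert_eigenspace_sum: "L2 = L2_sum (hilbert_eigenspace 1) (hilbert_eigenspace (- 1))"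
proof
  show "L2_sum (hilbert_eigenspace 1) (hilbert_eigenspace (- 1)) \<subseteq> L2" by (auto simp: L2_sum_def)
  show "L2 \<subseteq> L2_sum (hilbert_eigenspace 1) (hilbert_eigenspace (- 1))"
  proof
    fix f :: "real^3 \<Rightarrow> cquat" assume f: "f \<in> L2"
    note H = hilbert.extension_L2[OF f]
    have u: "(\<lambda>x. (1/2) *s (f x + \<sigma> *s hilbert f x)) \<in> hilbert_eigenspace \<sigma>" if \<sigma>: "\<sigma> * \<sigma> = 1" for \<sigma>
    proof (rule hilbert_eigenspace_scale)
      have L: "(\<lambda>x. f x + \<sigma> *s hilbert f x) \<in> L2" by (intro L2_add L2_complex_scale f H)
      have "hilbert (\<lambda>x. f x + \<sigma> *s hilbert f x) =\<^sub>a\<^sub>e (\<lambda>x. \<sigma> *s (f x + \<sigma> *s hilbert f x))"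
        using hilbert.extension_add[OF f L2_complex_scale(1)[OF H, of \<sigma>]] hilbert.extension_scale[OF H, of \<sigma>] hilbert_involution[OF f]
        by eventually_elim (simp add: vector_add_ldistrib \<sigma>)
      with L show "(\<lambda>x. f x + \<sigma> *s hilbert f x) \<in> hilbert_eigenspace \<sigma>" by (simp add: hilbert_eigenspace_def)
    qed
    have "f = (\<lambda>x. (1/2) *s (f x + 1 *s hilbert f x) + (1/2) *s (f x + (- 1) *s hilbert f x))"
      by (simp add: fun_eq_iff vec_eq_iff field_simps)
    then have "f =\<^sub>a\<^sub>e (\<lambda>x. (1/2) *s (f x + 1 *s hilbert f x) + (1/2) *s (f x + (- 1) *s hilbert f x))"
      by (metis (mono_tags, lifting) AE_I2)
    moreover have "(\<lambda>x. (1/2) *s (f x + 1 *s hilbert f x)) \<in> hilbert_eigenspace 1"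
      "(\<lambda>x. (1/2) *s (f x + (- 1) *s hilbert f x)) \<in> hilbert_eigenspace (- 1)"
      by (rule u, simp)+
    ultimately show "f \<in> L2_sum (hilbert_eigenspace 1) (hilbert_eigenspace (- 1))"
      using f unfolding L2_sum_def mem_Collect_eq by (intro conjI bexI)
  qed
qed

lemma hilbert_eigenspace_neq: "hilbert_eigenspace 1 \<noteq> hilbert_eigenspace (- 1)"
  using hilbert_eigenspace_nonzero[of 1] hilbert_eigenspace_independent by (auto simp: L2_independent_def)

text \<open>A space with scalar c lies in the eigenspace of c, which is itself scalar invariant, so
  maximality gives equality. A nonzero element and H^2 = I then force c^2 = 1. Conversely, each of
  the two eigenspaces is proper because the other contains a nonzero function.\<close>

lemma maximal_invariant_hilbert:
  "{V. L2_nontrivial V \<and> maximal_invariant hilbert V} = {hilbert_eigenspace 1, hilbert_eigenspace (- 1)}"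
proof (intro equalityI subsetI)
  fix V assume "V \<in> {V. L2_nontrivial V \<and> maximal_invariant hilbert V}"
  then have V: "scalar_invariant hilbert V" "\<And>W. scalar_invariant hilbert W \<Longrightarrow> V \<subseteq> W \<Longrightarrow> W = V"
    and "\<exists>f\<in>V. \<not> f =\<^sub>a\<^sub>e (\<lambda>x. 0)"
    unfolding maximal_invariant_def L2_nontrivial_def by blast+
  then obtain f c where f: "f \<in> V" "\<not> f =\<^sub>a\<^sub>e (\<lambda>x. 0)" and c: "\<And>f. f \<in> V \<Longrightarrow> hilbert f =\<^sub>a\<^sub>e (\<lambda>x. c *s f x)"
    and L: "V \<subseteq> L2"
    using scalar_invariant_eigenvalue[OF V(1)] by blast
  have "V \<subseteq> hilbert_eigenspace c" using c L by (auto simp: hilbert_eigenspace_def)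
  from V(2)[OF hilbert_eigenspace_scalar_invariant this] have eq: "V = hilbert_eigenspace c" ..
  have fL: "f \<in> L2" using f L by blast
  have "hilbert (hilbert f) =\<^sub>a\<^sub>e hilbert (\<lambda>x. c *s f x)"
    by (rule hilbert.extension_cong[OF hilbert.extension_L2[OF fL] L2_complex_scale(1)[OF fL] c[OF f(1)]])
  with hilbert.extension_scale[OF fL, of c] hilbert_involution[OF fL] c[OF f(1)]
  have e: "AE x in lborel. f x = (c * c) *s f x"
    by eventually_elim simp
  have "c * c = 1"
  proof (rule ccontr)
    assume cc: "c * c \<noteq> 1"
    from e have "f =\<^sub>a\<^sub>e (\<lambda>x. 0)"
      by eventually_elim (use cc complex_scale_eq_cancel[of 1 _ "c * c"] in \<open>metis vector_smult_lid\<close>)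
    with f show False by simp
  qed
  then have "c = 1 \<or> c = - 1" by (simp add: square_eq_1_iff)
  with eq show "V \<in> {hilbert_eigenspace 1, hilbert_eigenspace (- 1)}" by auto
next
  fix V assume V: "V \<in> {hilbert_eigenspace 1, hilbert_eigenspace (- 1)}"
  have sub: "hilbert_eigenspace \<sigma> \<subseteq> L2" for \<sigma> by (auto simp: hilbert_eigenspace_def)
  obtain f g where f: "f \<in> hilbert_eigenspace 1" "\<not> f =\<^sub>a\<^sub>e (\<lambda>x. 0)" and g: "g \<in> hilbert_eigenspace (- 1)" "\<not> g =\<^sub>a\<^sub>e (\<lambda>x. 0)"
    using hilbert_eigenspace_nonzero[of 1] hilbert_eigenspace_nonzero[of "- 1"] by auto
  have "f \<notin> hilbert_eigenspace (- 1)" "g \<notin> hilbert_eigenspace 1"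
    using hilbert_eigenspace_independent f g by (auto simp: L2_independent_def)
  with f g sub have "L2_nontrivial (hilbert_eigenspace 1)" "L2_nontrivial (hilbert_eigenspace (- 1))"
    unfolding L2_nontrivial_def by blast+
  with V hilbert_eigenspace_maximal[of 1] hilbert_eigenspace_maximal[of "- 1"]
  show "V \<in> {V. L2_nontrivial V \<and> maximal_invariant hilbert V}" by auto
qed

section \<open>The spaces \<open>H\<^sub>j\<^sup>\<plusminus>\<close>\<close>

text \<open>
  The four spinors come in two pairs, \<open>e\<^sub>1 + \<sigma>\<i> e\<^sub>2\<close> and \<open>1 + \<sigma>\<i> e\<^sub>3\<close> with \<open>\<sigma> = \<plusminus>1\<close>, spanning the
  eigenspaces of left multiplication by \<open>\<i> e\<^sub>3\<close>.
\<close>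

lemma ie3_mult_spinors:
  assumes "\<sigma> * \<sigma> = 1"
  shows "\<i> *s (e3 \<odot> (e1 + (\<sigma> * \<i>) *s e2)) = \<sigma> *s (e1 + (\<sigma> * \<i>) *s e2)"
    "\<i> *s (e3 \<odot> (qone + (\<sigma> * \<i>) *s e3)) = \<sigma> *s (qone + (\<sigma> * \<i>) *s e3)"
proof -
  have *: "\<sigma> * (\<sigma> * z) = z" for z using assms by (simp flip: mult.assoc)
  show "\<i> *s (e3 \<odot> (e1 + (\<sigma> * \<i>) *s e2)) = \<sigma> *s (e1 + (\<sigma> * \<i>) *s e2)"
    "\<i> *s (e3 \<odot> (qone + (\<sigma> * \<i>) *s e3)) = \<sigma> *s (qone + (\<sigma> * \<i>) *s e3)"
    by (simp_all add: cq_simps * mult_ac)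
qed

text \<open>The eigenvalue equation ties the e2-coordinate to the e1-coordinate and the
  e3-coordinate to the scalar part; the two free coordinates are the coefficients.\<close>

lemma ie3_eigenvector:
  assumes \<sigma>: "\<sigma> * \<sigma> = 1" and p: "\<i> *s (e3 \<odot> p) = \<sigma> *s p"
  shows "p = p$2 *s (e1 + (\<sigma> * \<i>) *s e2) + p$1 *s (qone + (\<sigma> * \<i>) *s e3)"
proof -
  have p': "\<sigma> * p$3 = \<i> * p$2" "\<sigma> * p$4 = \<i> * p$1"
    using p by (simp_all add: cq_simps)
  have "p$3 = \<sigma> * (\<sigma> * p$3)" "p$4 = \<sigma> * (\<sigma> * p$4)" using \<sigma> by (simp_all flip: mult.assoc)
  then have "p$3 = \<sigma> * (\<i> * p$2)" "p$4 = \<sigma> * (\<i> * p$1)" unfolding p' by simp_all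
  then show ?thesis by (simp add: cq_simps)
qed

lemma spinors_independent:
  assumes "a *s (e1 + c *s e2) = b *s (qone + c *s e3)"
  shows "a = 0"
proof -
  have "(a *s (e1 + c *s e2)) $ 2 = (b *s (qone + c *s e3)) $ 2" unfolding assms ..
  then show ?thesis by (simp add: cq_simps)
qed

lemma Spin3_inverse:
  assumes "q \<in> Spin3"
  shows "cq_inverse q \<odot> q = qone" "q \<odot> cq_inverse q = qone" "\<forall>k. cq_inverse q $ k \<in> \<real>"
    "\<forall>k. q $ k \<in> \<real>" "norm q = 1" "norm (cq_inverse q) = 1"
proof -
  have r: "\<forall>k. q $ k \<in> \<real>" and n: "norm q = 1" using assms by (auto simp: Spin3_def)
  have "(\<Sum>k\<in>UNIV. (cmod (q$k))\<^sup>2) = 1" using n norm_cquat_power2[of q] by simp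
  moreover have "complex_of_real ((norm (q$k))\<^sup>2) = q$k * q$k" for k
    using r by (simp add: complex_is_Real_iff complex_eq_iff cmod_def power2_eq_square)
  ultimately have e: "q$1 * q$1 + q$2 * q$2 + q$3 * q$3 + q$4 * q$4 = 1"
    by (metis sum_4 of_real_1 of_real_add)
  show "cq_inverse q \<odot> q = qone" "q \<odot> cq_inverse q = qone"
    unfolding cq_inverse_Spin3[OF assms] using e by (simp_all add: cq_simps algebra_simps)
  show "\<forall>k. cq_inverse q $ k \<in> \<real>"
    unfolding cq_inverse_Spin3[OF assms] using r by (simp add: forall_4)
  have "(norm (cq_inverse q))\<^sup>2 = (norm q)\<^sup>2"
    unfolding cq_inverse_Spin3[OF assms] by (simp add: norm_cquat_power2 sum_4)
  then have "norm (cq_inverse q) = norm q" by (subst (asm) power2_eq_iff_nonneg) simp_all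
  then show "norm (cq_inverse q) = 1" using n by simp
qed (use assms in \<open>auto simp: Spin3_def\<close>)

text \<open>The section is only Lebesgue measurable along \<open>sgn\<close>, whereas L^2 consists
  of Borel functions, so a Borel version is used. The last relation is the defining property of the
  section multiplied by it from the right.\<close>

lemma spin_section_borel:
  assumes "spin_section \<gamma>"
  obtains \<Gamma> where "\<Gamma> \<in> borel_measurable borel"
    "AE y in lborel. \<Gamma> y = \<gamma> (sgn y) \<and> \<Gamma> y \<in> Spin3 \<and> \<Gamma> y \<odot> e3 = pure_quat (sgn y) \<odot> \<Gamma> y"
proof -
  have m: "(\<lambda>y. \<gamma> (sgn y)) \<in> borel_measurable lebesgue"
    and S: "\<And>\<omega>. \<omega> \<in> sphere 0 1 \<Longrightarrow> \<gamma> \<omega> \<in> Spin3 \<and> \<gamma> \<omega> \<odot> e3 \<odot> cq_inverse (\<gamma> \<omega>) = pure_quat \<omega>"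
    using assms by (auto simp: spin_section_def)
  \<comment> \<open>Elements of \<open>Spin3\<close> have real coordinates, so Borel versions of the
    real parts determine the section almost everywhere.\<close>
  have "\<exists>G\<in>borel_measurable lborel. AE y in lborel. Re (\<gamma> (sgn y) $ k) = G y" for k
    using m by (intro completion_ex_borel_measurable_real) measurable
  then have "\<forall>k. \<exists>G. G \<in> borel_measurable lborel \<and> (AE y in lborel. Re (\<gamma> (sgn y) $ k) = G y)"
    by blast
  from choice[OF this] obtain G where G: "\<And>k. G k \<in> borel_measurable lborel"
    "\<And>k. AE y in lborel. Re (\<gamma> (sgn y) $ k) = G k y"
    by blast
  note [measurable] = G(1)
  define \<Gamma> where "\<Gamma> y = complex_of_real (G 1 y) *s qone + complex_of_real (G 2 y) *s e1
      + complex_of_real (G 3 y) *s e2 + complex_of_real (G 4 y) *s e3" for y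
  show ?thesis
  proof
    have "\<Gamma> \<in> borel_measurable lborel" unfolding \<Gamma>_def by measurable
    then show "\<Gamma> \<in> borel_measurable borel" by simp
    show "AE y in lborel. \<Gamma> y = \<gamma> (sgn y) \<and> \<Gamma> y \<in> Spin3 \<and> \<Gamma> y \<odot> e3 = pure_quat (sgn y) \<odot> \<Gamma> y"
      using AE_lborel_singleton[of "0::real^3"] G(2)[of 1] G(2)[of 2] G(2)[of 3] G(2)[of 4]
    proof eventually_elim
      case (elim y)
      then have "sgn y \<in> sphere 0 1" by (simp add: norm_sgn)
      note s = S[OF this]
      then have r: "complex_of_real (Re (\<gamma> (sgn y) $ k)) = \<gamma> (sgn y) $ k" for k
        by (simp add: Spin3_def of_real_Re)
      have "\<Gamma> y = \<gamma> (sgn y)"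
        unfolding \<Gamma>_def elim(2-5)[symmetric] r by (simp add: cq_simps)
      moreover have "\<gamma> (sgn y) \<odot> e3 = pure_quat (sgn y) \<odot> \<gamma> (sgn y)"
      proof -
        have "pure_quat (sgn y) \<odot> \<gamma> (sgn y) = \<gamma> (sgn y) \<odot> e3 \<odot> cq_inverse (\<gamma> (sgn y)) \<odot> \<gamma> (sgn y)"
          using s by simp
        also have "\<dots> = \<gamma> (sgn y) \<odot> e3"
          unfolding cq_mult_assoc Spin3_inverse(1)[OF conjunct1[OF s]] by (simp add: cq_units)
        finally show ?thesis ..
      qed
      ultimately show ?case using s by simp
    qed
  qed
qed

section \<open>The spaces L(w) as eigenspaces of \<i>\<omega>\<close>

lemma Lspace_L2: "g \<in> Lspace \<gamma> w \<Longrightarrow> g \<in> L2"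
  by (simp add: Lspace_def)

lemma direction_mult_Lspace:
  assumes "spin_section \<gamma>" and w: "\<i> *s (e3 \<odot> w) = \<sigma> *s w" and g: "g \<in> Lspace \<gamma> w"
  shows "direction_mult g =\<^sub>a\<^sub>e (\<lambda>x. \<sigma> *s g x)"
proof -
  obtain \<Gamma> where "\<Gamma> \<in> borel_measurable borel" and \<Gamma>: "AE y in lborel. \<Gamma> y = \<gamma> (sgn y) \<and> \<Gamma> y \<in> Spin3 \<and> \<Gamma> y \<odot> e3 = pure_quat (sgn y) \<odot> \<Gamma> y"
    by (rule spin_section_borel[OF assms(1)])
  obtain \<alpha> where \<alpha>: "g =\<^sub>a\<^sub>e (\<lambda>y. \<gamma> (sgn y) \<odot> (\<alpha> y *s w))" using g by (auto simp: Lspace_def)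
  show ?thesis
    using \<Gamma> \<alpha>
  proof eventually_elim
    case (elim y)
    have "direction_mult g y = \<i> *s (\<alpha> y *s ((pure_quat (sgn y) \<odot> \<Gamma> y) \<odot> w))"
      using elim by (simp add: direction_mult_def cq_mult_bilinear cq_mult_assoc)
    also have "pure_quat (sgn y) \<odot> \<Gamma> y = \<Gamma> y \<odot> e3" by (metis elim(1))
    also have "\<i> *s (\<alpha> y *s ((\<Gamma> y \<odot> e3) \<odot> w)) = \<alpha> y *s (\<Gamma> y \<odot> (\<i> *s (e3 \<odot> w)))"
      by (simp add: cq_mult_bilinear cq_mult_assoc mult.commute)
    also have "\<dots> = \<sigma> *s g y"
      unfolding w using elim by (simp add: cq_mult_bilinear mult.commute)
    finally show ?case .
  qed
qed

text \<open>With p the product of the inverse of \<open>\<Gamma>\<close> and g, the pointwise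
  equation \<i>\<omega>g = \<sigma>g becomes \<i>e3 p = \<sigma>p, whose solutions are combinations
  of the two spinors. The coefficients are coordinates of p and hence square integrable, since p and
  g have the same norm almost everywhere.\<close>

lemma Lspace_decomposition:
  assumes "spin_section \<gamma>" and \<sigma>: "\<sigma> * \<sigma> = 1" and g: "g \<in> L2" "direction_mult g =\<^sub>a\<^sub>e (\<lambda>x. \<sigma> *s g x)"
  obtains u v where "u \<in> Lspace \<gamma> (e1 + (\<sigma> * \<i>) *s e2)" "v \<in> Lspace \<gamma> (qone + (\<sigma> * \<i>) *s e3)"
    "g =\<^sub>a\<^sub>e (\<lambda>x. u x + v x)"
proof -
  obtain \<Gamma> where [measurable]: "\<Gamma> \<in> borel_measurable borel"
    and \<Gamma>: "AE y in lborel. \<Gamma> y = \<gamma> (sgn y) \<and> \<Gamma> y \<in> Spin3 \<and> \<Gamma> y \<odot> e3 = pure_quat (sgn y) \<odot> \<Gamma> y"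
    by (rule spin_section_borel[OF assms(1)])
  have [measurable]: "g \<in> borel_measurable borel" using g by simp
  \<comment> \<open>The conjugate of \<open>\<Gamma>\<close>: measurable by its formula, and equal
    to \<open>cq_inverse\<close> wherever \<open>\<Gamma>\<close> takes values in
    \<open>Spin3\<close>.\<close>
  define q where "q y = \<Gamma> y $ 1 *s qone - \<Gamma> y $ 2 *s e1 - \<Gamma> y $ 3 *s e2 - \<Gamma> y $ 4 *s e3" for y
  define p where "p y = q y \<odot> g y" for y
  have [measurable]: "q \<in> borel_measurable borel" "p \<in> borel_measurable borel"
    unfolding q_def p_def by measurable
  have P: "AE y in lborel. norm (p y) = norm (g y) \<and> g y = \<Gamma> y \<odot> p y \<and> \<i> *s (e3 \<odot> p y) = \<sigma> *s p y"
    using \<Gamma> g(2)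
  proof eventually_elim
    case (elim y)
    then have S: "\<Gamma> y \<in> Spin3" and eq: "\<Gamma> y \<odot> e3 = pure_quat (sgn y) \<odot> \<Gamma> y" by blast+
    have q: "q y = cq_inverse (\<Gamma> y)"
      unfolding cq_inverse_Spin3[OF S] q_def by (simp add: cq_simps)
    note I = Spin3_inverse[OF S]
    have 1: "norm (p y) = norm (g y)" using norm_real_quat_mult[OF I(3)] by (simp add: p_def q I(6))
    have 2: "g y = \<Gamma> y \<odot> p y" by (simp add: p_def q I(2) cq_units flip: cq_mult_assoc)
    have "\<i> *s (e3 \<odot> p y) = cq_inverse (\<Gamma> y) \<odot> (\<i> *s ((\<Gamma> y \<odot> e3) \<odot> p y))"
      by (simp add: cq_mult_bilinear I(1) cq_units flip: cq_mult_assoc)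
    also have "\<i> *s ((\<Gamma> y \<odot> e3) \<odot> p y) = \<sigma> *s g y"
      using elim(2) 2 unfolding eq by (simp add: direction_mult_def cq_mult_assoc)
    also have "cq_inverse (\<Gamma> y) \<odot> (\<sigma> *s g y) = \<sigma> *s p y"
      by (simp add: p_def q cq_mult_bilinear)
    finally show ?case using 1 2 by simp
  qed
  have comp: "(\<lambda>y. p y $ k) \<in> L2" for k
  proof (rule L2_dominated(1)[OF g(1), of _ 1])
    show "AE y in lborel. norm (p y $ k) \<le> 1 * norm (g y)"
      using P
    proof eventually_elim
      case (elim y)
      then show ?case using Finite_Cartesian_Product.norm_nth_le[of "p y" k] by simp
    qed
  qed auto
  have part: "(\<lambda>y. \<Gamma> y \<odot> (p y $ k *s w)) \<in> Lspace \<gamma> w" for k and w :: cquat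
    unfolding Lspace_def
  proof (intro CollectI conjI bexI[OF _ comp[of k]])
    show "(\<lambda>y. \<Gamma> y \<odot> (p y $ k *s w)) =\<^sub>a\<^sub>e (\<lambda>y. \<gamma> (sgn y) \<odot> (p y $ k *s w))"
      using \<Gamma> by eventually_elim simp
    show "(\<lambda>y. \<Gamma> y \<odot> (p y $ k *s w)) \<in> L2"
    proof (rule L2_dominated(1)[OF comp[of k], of _ "norm w"])
      show "AE y in lborel. norm (\<Gamma> y \<odot> (p y $ k *s w)) \<le> norm w * norm (p y $ k)"
        using \<Gamma>
      proof eventually_elim
        case (elim y)
        then have S: "\<Gamma> y \<in> Spin3" by blast
        show ?case
          using norm_real_quat_mult[OF Spin3_inverse(4)[OF S]] Spin3_inverse(5)[OF S]
          by (simp add: norm_complex_scale mult.commute)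
      qed
    qed auto
  qed
  show ?thesis
  proof (rule that[OF part[of 2] part[of 1]])
    show "g =\<^sub>a\<^sub>e (\<lambda>y. \<Gamma> y \<odot> (p y $ 2 *s (e1 + (\<sigma> * \<i>) *s e2)) + \<Gamma> y \<odot> (p y $ 1 *s (qone + (\<sigma> * \<i>) *s e3)))"
      using P
    proof eventually_elim
      case (elim y)
      then show ?case
        using ie3_eigenvector[OF \<sigma>, of "p y"] unfolding cq_mult_bilinear(2)[symmetric] by simp
    qed
  qed
qed

lemma fourier_image_Lspace_sum:
  assumes \<gamma>: "spin_section \<gamma>" and \<sigma>: "\<sigma> * \<sigma> = 1"
  shows "L2_sum (fourier_image (Lspace \<gamma> (e1 + (\<sigma> * \<i>) *s e2))) (fourier_image (Lspace \<gamma> (qone + (\<sigma> * \<i>) *s e3)))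
    = hilbert_eigenspace \<sigma>" (is "L2_sum ?A ?B = _")
proof
  have im: "f \<in> hilbert_eigenspace \<sigma>" if "f \<in> fourier_image (Lspace \<gamma> w)" "\<i> *s (e3 \<odot> w) = \<sigma> *s w" for f w
  proof -
    from that(1) obtain g where f: "f \<in> L2" "f =\<^sub>a\<^sub>e fourier g" and g: "g \<in> Lspace \<gamma> w"
      by (auto simp: fourier_image_def)
    have "fourier g \<in> hilbert_eigenspace \<sigma>"
      using hilbert_eigenspace_fourier[OF Lspace_L2[OF g]] direction_mult_Lspace[OF \<gamma> that(2) g] by simp
    from hilbert_eigenspace_cong[OF this f] show ?thesis .
  qed
  show "L2_sum ?A ?B \<subseteq> hilbert_eigenspace \<sigma>"
  proof
    fix f assume "f \<in> L2_sum ?A ?B"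
    then obtain u v where f: "f \<in> L2" "f =\<^sub>a\<^sub>e (\<lambda>x. u x + v x)" and uv: "u \<in> ?A" "v \<in> ?B"
      by (auto simp: L2_sum_def)
    have "u \<in> hilbert_eigenspace \<sigma>" "v \<in> hilbert_eigenspace \<sigma>"
      using im[OF uv(1)] im[OF uv(2)] ie3_mult_spinors[OF \<sigma>] by auto
    from hilbert_eigenspace_cong[OF hilbert_eigenspace_add[OF this] f] show "f \<in> hilbert_eigenspace \<sigma>" .
  qed
  show "hilbert_eigenspace \<sigma> \<subseteq> L2_sum ?A ?B"
  proof
    fix f assume E: "f \<in> hilbert_eigenspace \<sigma>"
    then have f: "f \<in> L2" by (simp add: hilbert_eigenspace_def)
    define g where "g = fourier (\<lambda>x. f (- x))"
    have g: "g \<in> L2" unfolding g_def by (intro fourier.extension_L2 L2_uminus_arg f)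
    have fg: "fourier g =\<^sub>a\<^sub>e f" unfolding g_def by (rule fourier_inverse[OF f])
    have "fourier g \<in> hilbert_eigenspace \<sigma>"
      by (rule hilbert_eigenspace_cong[OF E fourier.extension_L2[OF g] fg])
    then have "direction_mult g =\<^sub>a\<^sub>e (\<lambda>x. \<sigma> *s g x)" by (simp add: hilbert_eigenspace_fourier[OF g])
    then obtain u v
      where u: "u \<in> Lspace \<gamma> (e1 + (\<sigma> * \<i>) *s e2)" and v: "v \<in> Lspace \<gamma> (qone + (\<sigma> * \<i>) *s e3)"
        and guv: "g =\<^sub>a\<^sub>e (\<lambda>x. u x + v x)"
      by (rule Lspace_decomposition[OF \<gamma> \<sigma> g])
    note L = Lspace_L2[OF u] Lspace_L2[OF v]
    have "f =\<^sub>a\<^sub>e (\<lambda>x. fourier u x + fourier v x)"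
      using fg fourier.extension_cong[OF g L2_add(1)[OF L] guv] fourier.extension_add[OF L]
      by eventually_elim simp
    moreover have "fourier u \<in> ?A" "fourier v \<in> ?B"
      using u v L by (auto simp: fourier_image_def fourier.extension_L2)
    ultimately show "f \<in> L2_sum ?A ?B" using f by (auto simp: L2_sum_def)
  qed
qed

text \<open>After removing the Fourier transformation by injectivity and cancelling
  \<open>\<Gamma>\<close>, a multiple of a spinor in the span of e1 and e2 equals a multiple of one
  in the span of 1 and e3, so both vanish.\<close>

lemma fourier_image_Lspace_independent:
  assumes "spin_section \<gamma>"
  shows "L2_independent (fourier_image (Lspace \<gamma> (e1 + c *s e2))) (fourier_image (Lspace \<gamma> (qone + c *s e3)))"
  unfolding L2_independent_def
proof
  fix f assume "f \<in> fourier_image (Lspace \<gamma> (e1 + c *s e2)) \<inter> fourier_image (Lspace \<gamma> (qone + c *s e3))"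
  then obtain u v where fu: "f =\<^sub>a\<^sub>e fourier u" and fv: "f =\<^sub>a\<^sub>e fourier v"
    and u: "u \<in> Lspace \<gamma> (e1 + c *s e2)" and v: "v \<in> Lspace \<gamma> (qone + c *s e3)"
    by (auto simp: fourier_image_def)
  obtain \<alpha> \<beta> where \<alpha>: "u =\<^sub>a\<^sub>e (\<lambda>y. \<gamma> (sgn y) \<odot> (\<alpha> y *s (e1 + c *s e2)))"
    and \<beta>: "v =\<^sub>a\<^sub>e (\<lambda>y. \<gamma> (sgn y) \<odot> (\<beta> y *s (qone + c *s e3)))"
    using u v by (auto simp: Lspace_def)
  obtain \<Gamma> where "\<Gamma> \<in> borel_measurable borel" and \<Gamma>: "AE y in lborel. \<Gamma> y = \<gamma> (sgn y) \<and> \<Gamma> y \<in> Spin3 \<and> \<Gamma> y \<odot> e3 = pure_quat (sgn y) \<odot> \<Gamma> y"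
    by (rule spin_section_borel[OF assms(1)])
  have "fourier u =\<^sub>a\<^sub>e fourier v" using fu fv by eventually_elim simp
  from fourier_injective[OF Lspace_L2[OF u] Lspace_L2[OF v] this] \<alpha> \<beta> \<Gamma>
  have "u =\<^sub>a\<^sub>e (\<lambda>x. 0)"
  proof eventually_elim
    case (elim y)
    then have eq: "\<Gamma> y \<odot> (\<alpha> y *s (e1 + c *s e2)) = \<Gamma> y \<odot> (\<beta> y *s (qone + c *s e3))" by simp
    have "\<Gamma> y \<in> Spin3" using elim by blast
    from arg_cong[OF eq, of "\<lambda>z. cq_inverse (\<Gamma> y) \<odot> z"]
    have "\<alpha> y *s (e1 + c *s e2) = \<beta> y *s (qone + c *s e3)"
      unfolding cq_mult_assoc[symmetric] Spin3_inverse(1)[OF \<open>\<Gamma> y \<in> Spin3\<close>] cq_units .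
    then have "\<alpha> y = 0" by (rule spinors_independent)
    then show ?case using elim by (simp add: cq_mult_zero_right)
  qed
  with fourier.extension_cong[OF Lspace_L2[OF u] L2_zero this] fourier_zero fu
  show "f =\<^sub>a\<^sub>e (\<lambda>x. 0)" by eventually_elim simp
qed

text \<open>Needed for the order of summands: the index 1 belongs to the spinor in e1 and e2 for the
  plus sign, but to the one in 1 and e3 for the minus sign.\<close>

lemma L2_sum_commute: "L2_sum U V = L2_sum V U"
proof -
  have "L2_sum U V \<subseteq> L2_sum V U" for U V
  proof
    fix f assume "f \<in> L2_sum U V"
    then obtain u v where f: "f \<in> L2" "u \<in> U" "v \<in> V" "f =\<^sub>a\<^sub>e (\<lambda>x. u x + v x)"
      unfolding L2_sum_def by blast
    have "f =\<^sub>a\<^sub>e (\<lambda>x. v x + u x)"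
      using f(4) by eventually_elim (simp add: add.commute)
    with f show "f \<in> L2_sum V U" unfolding L2_sum_def by blast
  qed
  then show ?thesis by blast
qed

lemma L2_independent_commute: "L2_independent U V \<longleftrightarrow> L2_independent V U"
  by (auto simp: L2_independent_def)

lemma qH_plus_eq: "spin_section \<gamma> \<Longrightarrow> qH_plus \<gamma> = hilbert_eigenspace 1"
  using fourier_image_Lspace_sum[of \<gamma> 1] by (simp add: qH_plus_def qH1_plus_def qH2_plus_def)

lemma qH_minus_eq: "spin_section \<gamma> \<Longrightarrow> qH_minus \<gamma> = hilbert_eigenspace (- 1)"
  using fourier_image_Lspace_sum[of \<gamma> "- 1"]
  by (simp add: qH_minus_def qH1_minus_def qH2_minus_def L2_sum_commute)

theorem theorem5p9:
  fixes \<gamma> :: "real^3 \<Rightarrow> cquat"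
  assumes "spin_section \<gamma>"
  shows "L2_independent (qH1_plus \<gamma>) (qH2_plus \<gamma>) \<and> L2_independent (qH1_minus \<gamma>) (qH2_minus \<gamma>)
    \<and> qH_plus \<gamma> \<noteq> qH_minus \<gamma>
    \<and> {V. L2_nontrivial V \<and> maximal_invariant hilbert V} = {qH_plus \<gamma>, qH_minus \<gamma>}
    \<and> L2 = L2_sum (qH_plus \<gamma>) (qH_minus \<gamma>) \<and> L2_independent (qH_plus \<gamma>) (qH_minus \<gamma>)
    \<and> (\<forall>f \<in> qH_plus \<gamma>. hilbert f =\<^sub>a\<^sub>e f)
    \<and> (\<forall>g \<in> qH_minus \<gamma>. hilbert g =\<^sub>a\<^sub>e (\<lambda>x. - g x))"
  unfolding qH_plus_eq[OF assms] qH_minus_eq[OF assms]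
proof (intro conjI)
  show "L2_independent (qH1_plus \<gamma>) (qH2_plus \<gamma>)"
    using fourier_image_Lspace_independent[OF assms, of \<i>] by (simp add: qH1_plus_def qH2_plus_def)
  show "L2_independent (qH1_minus \<gamma>) (qH2_minus \<gamma>)"
    using fourier_image_Lspace_independent[OF assms, of "- \<i>"]
    by (subst L2_independent_commute) (simp add: qH1_minus_def qH2_minus_def)
  show "\<forall>f\<in>hilbert_eigenspace 1. hilbert f =\<^sub>a\<^sub>e f" "\<forall>g\<in>hilbert_eigenspace (- 1). hilbert g =\<^sub>a\<^sub>e (\<lambda>x. - g x)"
    by (simp_all add: hilbert_eigenspace_def)
qed (fact hilbert_eigenspace_neq maximal_invariant_hilbert hilbert_eigenspace_sum hilbert_eigenspace_independent)+

end
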